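(* Let $\Lambda\subset\Sigma\times\mathbb R^{n+1,1}$ be an immersed surface in $S^n$ with Gauss--Codazzi--Ricci data $(c,\mathcal M^\Sigma,\nabla,\mathrm{II}^0)$, and let $q\in C^\infty(\Sigma,S^2_0T^*\Sigma)$ be a quadratic differential. Then the following conditions are equivalent: (i) $\Sigma$ is constrained Willmore with Lagrange multiplier $q$, i.e. $dq=0$ and $(\mathcal H^\nabla)^*(\mathrm{II}^0)=\langle q,\mathrm{II}^0\rangle$; (ii) there is a $1$-form $\xi\in\Omega^1(\Sigma,\mathfrak{stab}(\Lambda)^\perp)$ with $[\xi]=q$ such that $d^{\mathfrak h}\xi=0$ and $d^{\mathfrak D^{\mathfrak h}-\xi}{*\mathcal N}=0$; (iii) there is a $1$-form $\xi\in\Omega^1(\Sigma,\mathfrak{stab}(\Lambda)^\perp\cap\mathfrak{so}(V_\Sigma))$ with $[\xi]=q$ such that the connection $d+(e^{tJ}-1)\mathcal N+\frac12(e^{2tJ}-1)\xi$ on $\Sigma\times\mathbb R^{n+1,1}$ is flat for all $t\in\mathbb R$.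
   Context: Immersions. $\mathbb R^{n+1,1}$ has inner product $(\cdot,\cdot)$ of signature $(n+1,1)$; $S^n$ is the set of its null lines; a half of the light-cone is fixed. $\Sigma$ is a surface ($n>2$, with a (local) orientation), $L$ its bundle of weight-one densities ($L^{-2}=|\Lambda^2T^*\Sigma|$); tensor signs with line bundles are omitted. An immersion in $S^n$ is a null line subbundle $\Lambda\subset\Sigma\times\mathbb R^{n+1,1}$, oriented by the half light-cone, with $X\mapsto d_X\sigma$ mod $\Lambda$ injective. It induces the conformal metric $c=\langle\cdot,\cdot\rangle\in S^2T^*\Sigma\,L^2$, $(d_X\sigma,d_Y\sigma)=\langle X,Y\rangle\sigma^2$, with $\Lambda=L^{-1}$ so that $c$ has volume form of modulus one. $\Lambda^{(1)}$ is the span of $\sigma,d\sigma$; $N\Sigma=\mathrm{Hom}(\Lambda,\Lambda^\perp/\Lambda^{(1)})$; $N\Sigma\,\Lambda=\Lambda^\perp/\Lambda^{(1)}$ is the weightless normal bundle. An enveloped sphere congruence is a signature $(3,1)$ subbundle $V\supset\Lambda^{(1)}$; $V^\perp\cong N\Sigma\,\Lambda$. Write $d=\mathfrak D^V+\nabla^V+\mathcal N^V$ (metric connections on $V,V^\perp$; off-diagonal part); $\nabla$ is the connection on $N\Sigma\,\Lambda$ given by $\nabla^V$ (independent of $V$); $\mathrm{II}^V_XY\,\sigma=-\mathcal N^V_X(d_Y\sigma)$. $V_\Sigma$ is the unique $V$ with $\mathrm{II}^V$ tracefree; $\mathrm{II}^0=\mathrm{II}^{V_\Sigma}$, $\mathcal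 N=\mathcal N^{V_\Sigma}$. M\"obius structure $\mathcal M^\Sigma$: for a positive section $\sigma$ of $\Lambda$ and $D$ the Levi-Civita connection of $(d\sigma,d\sigma)$, the $V_\Sigma$-component of the tracefree part of $D\,d\sigma$ is $-r_0\otimes\sigma$ with $r_0\in S^2_0T^*\Sigma$, and $\mathcal H\ell=\mathrm{sym}_0D^2\ell+r_0\ell$ on sections $\ell$ of $L$ (independent of $\sigma$). $(\mathcal H^\nabla)^*\Psi=\mathrm{div}\,\mathrm{div}\,\Psi+\langle r_0,\Psi\rangle$ for $\Psi\in S^2_0T^*\Sigma\otimes N\Sigma$, with divergences formed using $c$, $D$ on tensors and densities and $\nabla$ on $N\Sigma\,L^{-1}$; $\langle q,\Psi\rangle$ contracts using $c$. $(dq)_{X,Y}=(D_Xq)(Y,\cdot)-(D_Yq)(X,\cdot)$ (independent of $\sigma$). Lie algebra notation. $\mathfrak{stab}(\Lambda)^\perp=\{S\in\mathfrak{so}(n+1,1):S|_\Lambda=0,\ S(\Lambda^\perp)\subset\Lambda\}$, a bundle over $\Sigma$; for $\xi\in\Omega^1(\Sigma,\mathfrak{stab}(\Lambda)^\perp)$ write $\xi_X\cdot d_Y\sigma=-\xi(X,Y)\sigma$ for $X,Y\in T\Sigma$, and $[\xi]$ is the symmetric tracefree part of the bilinear form $\xi(\cdot,\cdot)$ (the Lie algebra homology class). $\mathfrak{so}(V_\Sigma)$ consists of the elements vanishing on $V_\Sigma^\perp$. A section $Q$ of $S^2T^*\Sigma$ is viewed as a $1$-form with values in $\mathfrak{stab}(\Lambda)^\perp\cap\mathfrak{so}(V_\Sigma)$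 by $Q_X\cdot d_Y\sigma=-Q(X,Y)\sigma$. With $Q=\frac14|\mathrm{II}^0|^2c$, $\mathfrak D^{\mathfrak h}=\mathfrak D^{V_\Sigma}+\nabla^{V_\Sigma}-Q$ (so $d=\mathfrak D^{\mathfrak h}+Q+\mathcal N$). $d^{\mathfrak h}$ and $d^{\mathfrak D^{\mathfrak h}-\xi}$ are the exterior covariant derivatives on $\mathfrak{so}(n+1,1)$-valued forms coupled to $\mathfrak D^{\mathfrak h}$ and $\mathfrak D^{\mathfrak h}-\xi$. $*$ is the Hodge star of $c$ on $1$-forms; on $\mathfrak{so}(n+1,1)$-valued $1$-forms, $e^{tJ}\alpha=\cos t\,\alpha+\sin t\,{*\alpha}$. *)

theory Defs
  imports "HOL-Analysis.Analysis"
begin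

section \<open>Lorentzian linear algebra\<close>

text \<open>Lorentz space of signature \<open>(n+1,1)\<close> with \<open>CARD('m) = n+1\<close>; the negative direction is the
  second factor.  The chosen half of the light-cone is the one with positive second component.\<close>

type_synonym 'm lorentz = "(real ^ 'm) \<times> real"

definition lor :: "('m::finite) lorentz \<Rightarrow> 'm lorentz \<Rightarrow> real" where
  "lor v w = fst v \<bullet> fst w - snd v * snd w"

definition lperp :: "('m::finite) lorentz set \<Rightarrow> 'm lorentz set" where
  "lperp E = {v. \<forall>w\<in>E. lor v w = 0}"

definition pos_cone :: "('m::finite) lorentz set" where
  "pos_cone = {v. lor v v = 0 \<and> snd v > 0}"

definition null_line :: "('m::finite) lorentz set \<Rightarrow> bool" where
  "null_line l \<longleftrightarrow> (\<exists>v. v \<noteq> 0 \<and> lor v v = 0 \<and> l = span {v})"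

definition has_signature :: "nat \<Rightarrow> nat \<Rightarrow> ('m::finite) lorentz set \<Rightarrow> bool" where
  "has_signature p q E \<longleftrightarrow> (\<exists>B C. finite B \<and> finite C \<and> card B = p \<and> card C = q \<and>
     (\<forall>b\<in>B. lor b b = 1) \<and> (\<forall>c\<in>C. lor c c = -1) \<and>
     (\<forall>b\<in>B \<union> C. \<forall>c\<in>B \<union> C. b \<noteq> c \<longrightarrow> lor b c = 0) \<and> E = span (B \<union> C))"

text \<open>Orthogonal projection onto a nondegenerate subspace.\<close>

definition lproj :: "('m::finite) lorentz set \<Rightarrow> 'm lorentz \<Rightarrow> 'm lorentz" where
  "lproj E v = (THE w. w \<in> E \<and> v - w \<in> lperp E)"

definition so_lor :: "(('m::finite) lorentz \<Rightarrow> 'm lorentz) set" where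
  "so_lor = {S. linear S \<and> (\<forall>v w. lor (S v) w + lor v (S w) = 0)}"

definition stab_perp :: "('m::finite) lorentz set \<Rightarrow> ('m lorentz \<Rightarrow> 'm lorentz) set" where
  "stab_perp l = {S \<in> so_lor. (\<forall>v\<in>l. S v = 0) \<and> S ` lperp l \<subseteq> l}"

definition so_sub :: "('m::finite) lorentz set \<Rightarrow> ('m lorentz \<Rightarrow> 'm lorentz) set" where
  "so_sub V = {S \<in> so_lor. \<forall>v\<in>lperp V. S v = 0}"


section \<open>Smooth functions in two real variables\<close>

definition dird :: "real^2 \<Rightarrow> (real^2 \<Rightarrow> 'b::real_normed_vector) \<Rightarrow> real^2 \<Rightarrow> 'b" where
  "dird X f u = frechet_derivative f (at u) X"

abbreviation ee :: "2 \<Rightarrow> real^2" where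
  "ee i \<equiv> axis i 1"

fun Ck_on :: "nat \<Rightarrow> (real^2 \<Rightarrow> 'b::real_normed_vector) \<Rightarrow> (real^2) set \<Rightarrow> bool" where
  "Ck_on 0 f W \<longleftrightarrow> continuous_on W f"
| "Ck_on (Suc k) f W \<longleftrightarrow> f differentiable_on W \<and> (\<forall>i. Ck_on k (dird (ee i) f) W)"

text \<open>Only used for open \<open>W\<close>.\<close>

definition smooth_on :: "(real^2 \<Rightarrow> 'b::real_normed_vector) \<Rightarrow> (real^2) set \<Rightarrow> bool" where
  "smooth_on f W \<longleftrightarrow> (\<forall>k. Ck_on k f W)"


section \<open>Surfaces, bundles and forms\<close>

text \<open>A surface is a topological space covered by an atlas of local parametrizations \<open>(W, x)\<close>,
  \<open>x : W \<rightarrow> \<Sigma>\<close>.  The atlas need not be maximal.  Each parametrization orients its image; this is the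
  local orientation used for the Hodge star below.  No relation between the orientations of different
  parametrizations is required, so an oriented surface is the case of an oriented atlas.\<close>

type_synonym 'a chart = "(real^2) set \<times> (real^2 \<Rightarrow> 'a)"

definition overlap :: "'a chart \<Rightarrow> 'a chart \<Rightarrow> (real^2) set" where
  "overlap P P' = {u \<in> fst P. snd P u \<in> snd P' ` fst P'}"

definition transition :: "'a chart \<Rightarrow> 'a chart \<Rightarrow> real^2 \<Rightarrow> real^2" where
  "transition P P' u = inv_into (fst P') (snd P') (snd P u)"

definition smooth_surface :: "'a::topological_space chart set \<Rightarrow> bool" where
  "smooth_surface A \<longleftrightarrow>
     (\<forall>P\<in>A. open (fst P) \<and> open (snd P ` fst P) \<and>
        homeomorphism (fst P) (snd P ` fst P) (snd P) (inv_into (fst P) (snd P))) \<and>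
     (\<Union>P\<in>A. snd P ` fst P) = UNIV \<and>
     (\<forall>P\<in>A. \<forall>P'\<in>A. smooth_on (transition P P') (overlap P P'))"

definition smooth_map_on ::
  "'a::topological_space chart set \<Rightarrow> 'a set \<Rightarrow> ('a \<Rightarrow> 'b::real_normed_vector) \<Rightarrow> bool" where
  "smooth_map_on A U f \<longleftrightarrow> (\<forall>P\<in>A. smooth_on (f \<circ> snd P) {u \<in> fst P. snd P u \<in> U})"

definition smooth_subbundle ::
  "'a::topological_space chart set \<Rightarrow> nat \<Rightarrow> ('a \<Rightarrow> 'b::real_normed_vector set) \<Rightarrow> bool" where
  "smooth_subbundle A k E \<longleftrightarrow> (\<forall>p. \<exists>U b. open U \<and> p \<in> U \<and> (\<forall>i<k. smooth_map_on A U (b i)) \<and>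
     (\<forall>p'\<in>U. inj_on (\<lambda>i. b i p') {..<k} \<and> independent ((\<lambda>i. b i p') ` {..<k}) \<and>
              E p' = span ((\<lambda>i. b i p') ` {..<k})))"

text \<open>Tensor fields on \<open>\<Sigma>\<close> are families of coordinate representations indexed by the atlas, related by
  pull-back along transitions.  In \<open>\<xi> P u X\<close>, \<open>u\<close> is a point of the coordinate domain of \<open>P\<close> and \<open>X\<close> a
  tangent vector in these coordinates.\<close>

definition quadratic_form_field ::
  "'a::topological_space chart set \<Rightarrow> ('a chart \<Rightarrow> real^2 \<Rightarrow> real^2 \<Rightarrow> real^2 \<Rightarrow> real) \<Rightarrow> bool" where
  "quadratic_form_field A q \<longleftrightarrow>
     (\<forall>P\<in>A. (\<forall>u\<in>fst P. bilinear (q P u) \<and> (\<forall>X Y. q P u X Y = q P u Y X)) \<and>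
            (\<forall>X Y. smooth_on (\<lambda>u. q P u X Y) (fst P))) \<and>
     (\<forall>P\<in>A. \<forall>P'\<in>A. \<forall>u\<in>overlap P P'. \<forall>X Y.
        q P u X Y = q P' (transition P P' u) (dird X (transition P P') u) (dird Y (transition P P') u))"

definition endo_one_form ::
  "'a::topological_space chart set \<Rightarrow> ('a \<Rightarrow> (('m::finite) lorentz \<Rightarrow> 'm lorentz) set) \<Rightarrow>
   ('a chart \<Rightarrow> real^2 \<Rightarrow> real^2 \<Rightarrow> 'm lorentz \<Rightarrow> 'm lorentz) \<Rightarrow> bool" where
  "endo_one_form A F \<xi> \<longleftrightarrow>
     (\<forall>P\<in>A. (\<forall>u\<in>fst P. (\<forall>v. linear (\<lambda>X. \<xi> P u X v)) \<and> (\<forall>X. \<xi> P u X \<in> F (snd P u))) \<and>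
            (\<forall>X v. smooth_on (\<lambda>u. \<xi> P u X v) (fst P))) \<and>
     (\<forall>P\<in>A. \<forall>P'\<in>A. \<forall>u\<in>overlap P P'. \<forall>X.
        \<xi> P u X = \<xi> P' (transition P P' u) (dird X (transition P P') u))"


section \<open>Immersions in the conformal sphere\<close>

definition positive_section ::
  "'a::topological_space chart set \<Rightarrow> ('a \<Rightarrow> ('m::finite) lorentz set) \<Rightarrow> ('a \<Rightarrow> 'm lorentz) \<Rightarrow> bool" where
  "positive_section A \<Lambda> \<sigma> \<longleftrightarrow> smooth_map_on A UNIV \<sigma> \<and> (\<forall>p. \<sigma> p \<in> \<Lambda> p \<inter> pos_cone)"

definition immersed_surface ::
  "'a::topological_space chart set \<Rightarrow> ('a \<Rightarrow> ('m::finite) lorentz set) \<Rightarrow> bool" where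
  "immersed_surface A \<Lambda> \<longleftrightarrow> smooth_subbundle A 1 \<Lambda> \<and> (\<forall>p. null_line (\<Lambda> p)) \<and>
     (\<forall>\<sigma>. positive_section A \<Lambda> \<sigma> \<longrightarrow> (\<forall>P\<in>A. \<forall>u\<in>fst P. \<forall>X.
        dird X (\<sigma> \<circ> snd P) u \<in> \<Lambda> (snd P u) \<longrightarrow> X = 0))"

text \<open>From here on \<open>s = \<sigma> \<circ> x\<close> is the coordinate expression of a positive section \<open>\<sigma>\<close> of \<open>\<Lambda>\<close>.
  It trivializes \<open>\<Lambda> = L\<^sup>-\<^sup>1\<close>, so that \<open>c\<close> becomes the metric \<open>(d\<sigma>,d\<sigma>)\<close> and densities become functions;
  \<open>\<sigma>\<close> is parallel for \<open>D\<close>.\<close>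

definition metric :: "(real^2 \<Rightarrow> ('m::finite) lorentz) \<Rightarrow> real^2 \<Rightarrow> real^2 \<Rightarrow> real^2 \<Rightarrow> real" where
  "metric s u X Y = lor (dird X s u) (dird Y s u)"

definition gmat :: "(real^2 \<Rightarrow> ('m::finite) lorentz) \<Rightarrow> real^2 \<Rightarrow> real^2^2" where
  "gmat s u = (\<chi> i j. metric s u (ee i) (ee j))"

definition ginv :: "(real^2 \<Rightarrow> ('m::finite) lorentz) \<Rightarrow> real^2 \<Rightarrow> real^2^2" where
  "ginv s u = matrix_inv (gmat s u)"

definition gtrace ::
  "(real^2 \<Rightarrow> ('m::finite) lorentz) \<Rightarrow> real^2 \<Rightarrow> (real^2 \<Rightarrow> real^2 \<Rightarrow> 'b::real_vector) \<Rightarrow> 'b" where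
  "gtrace s u B = (\<Sum>i\<in>UNIV. \<Sum>j\<in>UNIV. (ginv s u $ i $ j) *\<^sub>R B (ee i) (ee j))"

definition sym0 ::
  "(real^2 \<Rightarrow> ('m::finite) lorentz) \<Rightarrow> real^2 \<Rightarrow> (real^2 \<Rightarrow> real^2 \<Rightarrow> 'b::real_vector) \<Rightarrow>
   real^2 \<Rightarrow> real^2 \<Rightarrow> 'b" where
  "sym0 s u B X Y = (1/2) *\<^sub>R (B X Y + B Y X) - (metric s u X Y / 2) *\<^sub>R gtrace s u B"

text \<open>The pairing \<open>\<langle>q,\<Psi>\<rangle>\<close> of a scalar with a vector valued bilinear form.\<close>

definition contract ::
  "(real^2 \<Rightarrow> ('m::finite) lorentz) \<Rightarrow> real^2 \<Rightarrow> (real^2 \<Rightarrow> real^2 \<Rightarrow> real) \<Rightarrow>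
   (real^2 \<Rightarrow> real^2 \<Rightarrow> 'b::real_vector) \<Rightarrow> 'b" where
  "contract s u q \<Psi> = (\<Sum>i\<in>UNIV. \<Sum>j\<in>UNIV. \<Sum>k\<in>UNIV. \<Sum>l\<in>UNIV.
     (ginv s u $ i $ k * ginv s u $ j $ l * q (ee i) (ee j)) *\<^sub>R \<Psi> (ee k) (ee l))"

definition vol :: "(real^2 \<Rightarrow> ('m::finite) lorentz) \<Rightarrow> real^2 \<Rightarrow> real^2 \<Rightarrow> real^2 \<Rightarrow> real" where
  "vol s u X Y = sqrt (det (gmat s u)) * (X $ 1 * Y $ 2 - X $ 2 * Y $ 1)"

text \<open>Hodge star on \<open>1\<close>-forms at a point: the volume form contracted with the vector dual to \<open>\<alpha>\<close>.
  It depends only on the conformal class of the metric.\<close>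

definition hodge ::
  "(real^2 \<Rightarrow> ('m::finite) lorentz) \<Rightarrow> real^2 \<Rightarrow> (real^2 \<Rightarrow> 'b::real_vector) \<Rightarrow> real^2 \<Rightarrow> 'b" where
  "hodge s u \<alpha> X = (\<Sum>i\<in>UNIV. \<Sum>k\<in>UNIV. (ginv s u $ i $ k * vol s u (ee i) X) *\<^sub>R \<alpha> (ee k))"

text \<open>Christoffel symbols \<open>\<Gamma>\<^sup>k\<^sub>i\<^sub>j\<close> of the Levi-Civita connection \<open>D\<close> of \<open>(d\<sigma>,d\<sigma>)\<close>.\<close>

definition christoffel :: "(real^2 \<Rightarrow> ('m::finite) lorentz) \<Rightarrow> real^2 \<Rightarrow> 2 \<Rightarrow> 2 \<Rightarrow> 2 \<Rightarrow> real" where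
  "christoffel s u k i j = (1/2) * (\<Sum>l\<in>UNIV. ginv s u $ k $ l *
     (dird (ee i) (\<lambda>w. metric s w (ee j) (ee l)) u + dird (ee j) (\<lambda>w. metric s w (ee i) (ee l)) u
      - dird (ee l) (\<lambda>w. metric s w (ee i) (ee j)) u))"

text \<open>Connections on (subbundles of) a trivial bundle are operators \<open>\<nabla> X f\<close> with \<open>X\<close> a constant, hence
  coordinate, vector field; such fields commute.  \<open>cov1\<close> and \<open>cov2\<close> give the components
  \<open>(\<nabla>\<^sub>k \<omega>)\<^sub>j\<close> and \<open>(\<nabla>\<^sub>k \<Psi>)\<^sub>i\<^sub>j\<close> of the derivative coupled to \<open>D\<close>.\<close>

type_synonym 'b connection = "real^2 \<Rightarrow> (real^2 \<Rightarrow> 'b) \<Rightarrow> real^2 \<Rightarrow> 'b"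

definition cov1 ::
  "(real^2 \<Rightarrow> ('m::finite) lorentz) \<Rightarrow> 'b::real_vector connection \<Rightarrow> (real^2 \<Rightarrow> real^2 \<Rightarrow> 'b) \<Rightarrow>
   real^2 \<Rightarrow> 2 \<Rightarrow> 2 \<Rightarrow> 'b" where
  "cov1 s nab \<omega> u k j = nab (ee k) (\<lambda>w. \<omega> w (ee j)) u
     - (\<Sum>l\<in>UNIV. christoffel s u l k j *\<^sub>R \<omega> u (ee l))"

definition cov2 ::
  "(real^2 \<Rightarrow> ('m::finite) lorentz) \<Rightarrow> 'b::real_vector connection \<Rightarrow>
   (real^2 \<Rightarrow> real^2 \<Rightarrow> real^2 \<Rightarrow> 'b) \<Rightarrow> real^2 \<Rightarrow> 2 \<Rightarrow> 2 \<Rightarrow> 2 \<Rightarrow> 'b" where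
  "cov2 s nab \<Psi> u k i j = nab (ee k) (\<lambda>w. \<Psi> w (ee i) (ee j)) u
     - (\<Sum>l\<in>UNIV. christoffel s u l k i *\<^sub>R \<Psi> u (ee l) (ee j))
     - (\<Sum>l\<in>UNIV. christoffel s u l k j *\<^sub>R \<Psi> u (ee i) (ee l))"

definition div1 ::
  "(real^2 \<Rightarrow> ('m::finite) lorentz) \<Rightarrow> 'b::real_vector connection \<Rightarrow> (real^2 \<Rightarrow> real^2 \<Rightarrow> 'b) \<Rightarrow>
   real^2 \<Rightarrow> 'b" where
  "div1 s nab \<omega> u = (\<Sum>k\<in>UNIV. \<Sum>j\<in>UNIV. (ginv s u $ k $ j) *\<^sub>R cov1 s nab \<omega> u k j)"

definition div2 ::
  "(real^2 \<Rightarrow> ('m::finite) lorentz) \<Rightarrow> 'b::real_vector connection \<Rightarrow>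
   (real^2 \<Rightarrow> real^2 \<Rightarrow> real^2 \<Rightarrow> 'b) \<Rightarrow> real^2 \<Rightarrow> real^2 \<Rightarrow> 'b" where
  "div2 s nab \<Psi> u Y = (\<Sum>j\<in>UNIV. Y $ j *\<^sub>R
     (\<Sum>k\<in>UNIV. \<Sum>i\<in>UNIV. (ginv s u $ k $ i) *\<^sub>R cov2 s nab \<Psi> u k i j))"


section \<open>Sphere congruences and Gauss--Codazzi--Ricci data\<close>

text \<open>In coordinates, \<open>V\<close> stands for the pulled back bundle \<open>u \<mapsto> V (x u)\<close>.  The induced metric
  connection on a nondegenerate subbundle; \<open>ind_conn V\<close> is \<open>\<DD>\<^sup>V\<close> and \<open>ind_conn (lperp \<circ> V)\<close> is \<open>\<nabla>\<^sup>V\<close>.\<close>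

definition ind_conn :: "(real^2 \<Rightarrow> ('m::finite) lorentz set) \<Rightarrow> 'm lorentz connection" where
  "ind_conn E X f u = lproj (E u) (dird X f u)"

text \<open>The direct sum connection \<open>\<DD>\<^sup>V + \<nabla>\<^sup>V\<close> on the trivial bundle.\<close>

definition split_conn :: "(real^2 \<Rightarrow> ('m::finite) lorentz set) \<Rightarrow> 'm lorentz connection" where
  "split_conn V X f u = ind_conn V X (\<lambda>w. lproj (V w) (f w)) u
     + ind_conn (lperp \<circ> V) X (\<lambda>w. lproj (lperp (V w)) (f w)) u"

text \<open>\<open>\<N>\<^sup>V = d - (\<DD>\<^sup>V + \<nabla>\<^sup>V)\<close> is tensorial, so it is evaluated on constant sections.\<close>

definition NV ::
  "(real^2 \<Rightarrow> ('m::finite) lorentz set) \<Rightarrow> real^2 \<Rightarrow> real^2 \<Rightarrow> 'm lorentz \<Rightarrow> 'm lorentz" where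
  "NV V u X v = dird X (\<lambda>_. v) u - split_conn V X (\<lambda>_. v) u"

text \<open>\<open>II\<^sup>V\<close> takes values in \<open>N\<Sigma> = Hom(\<Lambda>, V\<^sup>\<bottom>)\<close>; this is its value on \<open>\<sigma>\<close>.\<close>

definition II ::
  "(real^2 \<Rightarrow> ('m::finite) lorentz set) \<Rightarrow> (real^2 \<Rightarrow> 'm lorentz) \<Rightarrow> real^2 \<Rightarrow>
   real^2 \<Rightarrow> real^2 \<Rightarrow> 'm lorentz" where
  "II V s u X Y = - NV V u X (dird Y s u)"

definition enveloped_congruence ::
  "'a::topological_space chart set \<Rightarrow> ('a \<Rightarrow> ('m::finite) lorentz set) \<Rightarrow> ('a \<Rightarrow> 'm lorentz set) \<Rightarrow> bool"
  where
  "enveloped_congruence A \<Lambda> V \<longleftrightarrow> smooth_subbundle A 4 V \<and> (\<forall>p. has_signature 3 1 (V p)) \<and>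
     (\<forall>\<sigma>. positive_section A \<Lambda> \<sigma> \<longrightarrow> (\<forall>P\<in>A. \<forall>u\<in>fst P.
        span (insert (\<sigma> (snd P u)) (range (\<lambda>X. dird X (\<sigma> \<circ> snd P) u))) \<subseteq> V (snd P u)))"

text \<open>\<open>V\<^sub>\<Sigma>\<close>.\<close>

definition central_congruence ::
  "'a::topological_space chart set \<Rightarrow> ('a \<Rightarrow> ('m::finite) lorentz set) \<Rightarrow> 'a \<Rightarrow> 'm lorentz set" where
  "central_congruence A \<Lambda> = (THE V. enveloped_congruence A \<Lambda> V \<and>
     (\<forall>\<sigma>. positive_section A \<Lambda> \<sigma> \<longrightarrow> (\<forall>P\<in>A. \<forall>u\<in>fst P.
        gtrace (\<sigma> \<circ> snd P) u (II (V \<circ> snd P) (\<sigma> \<circ> snd P) u) = 0)))"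

definition hess :: "(real^2 \<Rightarrow> ('m::finite) lorentz) \<Rightarrow> real^2 \<Rightarrow> real^2 \<Rightarrow> real^2 \<Rightarrow> 'm lorentz" where
  "hess s u X Y = (\<Sum>i\<in>UNIV. \<Sum>j\<in>UNIV. (X $ i * Y $ j) *\<^sub>R cov1 s dird (\<lambda>w Z. dird Z s w) u i j)"

text \<open>The zeroth order term of the Moebius structure, for \<open>V = V\<^sub>\<Sigma>\<close>.\<close>

definition r0 ::
  "(real^2 \<Rightarrow> ('m::finite) lorentz set) \<Rightarrow> (real^2 \<Rightarrow> 'm lorentz) \<Rightarrow> real^2 \<Rightarrow>
   real^2 \<Rightarrow> real^2 \<Rightarrow> real" where
  "r0 V s u X Y = (THE r. lproj (V u) (sym0 s u (hess s u) X Y) = - (r *\<^sub>R s u))"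

text \<open>\<open>(\<H>\<^sup>\<nabla>)\<^sup>*\<Psi>\<close>, with \<open>\<Psi>\<close> and the result given by their values on \<open>\<sigma>\<close>.\<close>

definition Hstar ::
  "(real^2 \<Rightarrow> ('m::finite) lorentz set) \<Rightarrow> (real^2 \<Rightarrow> 'm lorentz) \<Rightarrow>
   (real^2 \<Rightarrow> real^2 \<Rightarrow> real^2 \<Rightarrow> 'm lorentz) \<Rightarrow> real^2 \<Rightarrow> 'm lorentz" where
  "Hstar V s \<Psi> u = (let nab = ind_conn (lperp \<circ> V) in
     div1 s nab (div2 s nab \<Psi>) u + contract s u (r0 V s u) (\<Psi> u))"

definition quadratic_differential ::
  "'a::topological_space chart set \<Rightarrow> ('a \<Rightarrow> ('m::finite) lorentz set) \<Rightarrow>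
   ('a chart \<Rightarrow> real^2 \<Rightarrow> real^2 \<Rightarrow> real^2 \<Rightarrow> real) \<Rightarrow> bool" where
  "quadratic_differential A \<Lambda> q \<longleftrightarrow> quadratic_form_field A q \<and>
     (\<forall>\<sigma>. positive_section A \<Lambda> \<sigma> \<longrightarrow> (\<forall>P\<in>A. \<forall>u\<in>fst P. gtrace (\<sigma> \<circ> snd P) u (q P u) = 0))"

definition constrained_willmore ::
  "'a::topological_space chart set \<Rightarrow> ('a \<Rightarrow> ('m::finite) lorentz set) \<Rightarrow>
   ('a chart \<Rightarrow> real^2 \<Rightarrow> real^2 \<Rightarrow> real^2 \<Rightarrow> real) \<Rightarrow> bool" where
  "constrained_willmore A \<Lambda> q \<longleftrightarrow>
     (\<forall>\<sigma>. positive_section A \<Lambda> \<sigma> \<longrightarrow> (\<forall>P\<in>A. \<forall>u\<in>fst P.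
        let s = \<sigma> \<circ> snd P; V = central_congruence A \<Lambda> \<circ> snd P in
        (\<forall>i j k. cov2 s dird (q P) u i j k - cov2 s dird (q P) u j i k = 0) \<and>
        Hstar V s (II V s) u = contract s u (q P u) (II V s u)))"


section \<open>Forms with values in the orthogonal Lie algebra\<close>

text \<open>\<open>[\<xi>]\<close>.\<close>

definition homology_class ::
  "(real^2 \<Rightarrow> ('m::finite) lorentz) \<Rightarrow> (real^2 \<Rightarrow> real^2 \<Rightarrow> 'm lorentz \<Rightarrow> 'm lorentz) \<Rightarrow>
   real^2 \<Rightarrow> real^2 \<Rightarrow> real^2 \<Rightarrow> real" where
  "homology_class s \<xi> u = sym0 s u (\<lambda>X Y. THE r. \<xi> u X (dird Y s u) = - (r *\<^sub>R s u))"

text \<open>The \<open>stab(\<Lambda>)\<^sup>\<bottom> \<inter> so(V)\<close>-valued \<open>1\<close>-form of a bilinear form \<open>B\<close> on \<open>T\<Sigma>\<close>; the line \<open>\<Lambda>\<close> is \<open>span {\<sigma>}\<close>.\<close>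

definition form_to_endo ::
  "(real^2 \<Rightarrow> ('m::finite) lorentz set) \<Rightarrow> (real^2 \<Rightarrow> 'm lorentz) \<Rightarrow>
   (real^2 \<Rightarrow> real^2 \<Rightarrow> real^2 \<Rightarrow> real) \<Rightarrow> real^2 \<Rightarrow> real^2 \<Rightarrow> 'm lorentz \<Rightarrow> 'm lorentz" where
  "form_to_endo V s B u X = (THE S. S \<in> stab_perp (span {s u}) \<inter> so_sub (V u) \<and>
     (\<forall>Y. S (dird Y s u) = - (B u X Y *\<^sub>R s u)))"

text \<open>\<open>|II\<^sup>V|\<^sup>2\<close> in the gauge \<open>\<sigma>\<close>: the full tensor norm, summing over both indices of an orthonormal frame.\<close>

definition II_norm2 ::
  "(real^2 \<Rightarrow> ('m::finite) lorentz set) \<Rightarrow> (real^2 \<Rightarrow> 'm lorentz) \<Rightarrow> real^2 \<Rightarrow> real" where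
  "II_norm2 V s u = (\<Sum>i\<in>UNIV. \<Sum>j\<in>UNIV. \<Sum>k\<in>UNIV. \<Sum>l\<in>UNIV.
     ginv s u $ i $ k * ginv s u $ j $ l * lor (II V s u (ee i) (ee j)) (II V s u (ee k) (ee l)))"

definition Qform ::
  "(real^2 \<Rightarrow> ('m::finite) lorentz set) \<Rightarrow> (real^2 \<Rightarrow> 'm lorentz) \<Rightarrow> real^2 \<Rightarrow>
   real^2 \<Rightarrow> real^2 \<Rightarrow> real" where
  "Qform V s u X Y = (1/4) * II_norm2 V s u * metric s u X Y"

text \<open>\<open>\<DD>\<^sup>\<hh>\<close>, for \<open>V = V\<^sub>\<Sigma>\<close>.\<close>

definition Dh :: "(real^2 \<Rightarrow> ('m::finite) lorentz set) \<Rightarrow> (real^2 \<Rightarrow> 'm lorentz) \<Rightarrow> 'm lorentz connection"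
  where
  "Dh V s X f u = split_conn V X f u - form_to_endo V s (Qform V s) u X (f u)"

text \<open>\<open>(d\<^sup>\<nabla>\<alpha>)\<^sub>X\<^sub>,\<^sub>Y v\<close> for an endomorphism valued \<open>1\<close>-form \<open>\<alpha>\<close>, computed on the commuting coordinate fields
  \<open>X, Y\<close> and the constant section \<open>v\<close>: the sum is \<open>(\<nabla>\<^sub>X \<alpha>\<^sub>Y - \<nabla>\<^sub>Y \<alpha>\<^sub>X) v\<close> with \<open>\<nabla>\<close> acting on endomorphisms
  by commutators.\<close>

definition ext_cov ::
  "('m::finite) lorentz connection \<Rightarrow> (real^2 \<Rightarrow> real^2 \<Rightarrow> 'm lorentz \<Rightarrow> 'm lorentz) \<Rightarrow>
   real^2 \<Rightarrow> real^2 \<Rightarrow> real^2 \<Rightarrow> 'm lorentz \<Rightarrow> 'm lorentz" where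
  "ext_cov nab \<alpha> u X Y v =
     (nab X (\<lambda>w. \<alpha> w Y v) u - \<alpha> u Y (nab X (\<lambda>_. v) u))
   - (nab Y (\<lambda>w. \<alpha> w X v) u - \<alpha> u X (nab Y (\<lambda>_. v) u))"

definition hodge_endo ::
  "(real^2 \<Rightarrow> ('m::finite) lorentz) \<Rightarrow> (real^2 \<Rightarrow> real^2 \<Rightarrow> 'm lorentz \<Rightarrow> 'm lorentz) \<Rightarrow>
   real^2 \<Rightarrow> real^2 \<Rightarrow> 'm lorentz \<Rightarrow> 'm lorentz" where
  "hodge_endo s \<alpha> u X v = hodge s u (\<lambda>Y. \<alpha> u Y v) X"

text \<open>\<open>e\<^sup>t\<^sup>J \<alpha>\<close>.\<close>

definition rot_endo ::
  "(real^2 \<Rightarrow> ('m::finite) lorentz) \<Rightarrow> real \<Rightarrow> (real^2 \<Rightarrow> real^2 \<Rightarrow> 'm lorentz \<Rightarrow> 'm lorentz) \<Rightarrow>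
   real^2 \<Rightarrow> real^2 \<Rightarrow> 'm lorentz \<Rightarrow> 'm lorentz" where
  "rot_endo s t \<alpha> u X v = cos t *\<^sub>R \<alpha> u X v + sin t *\<^sub>R hodge_endo s \<alpha> u X v"

definition flat_on :: "(real^2) set \<Rightarrow> 'b::real_normed_vector connection \<Rightarrow> bool" where
  "flat_on W nab \<longleftrightarrow>
     (\<forall>f. smooth_on f W \<longrightarrow> (\<forall>X Y. \<forall>u\<in>W. nab X (nab Y f) u - nab Y (nab X f) u = 0))"

text \<open>The connection \<open>d + (e\<^sup>t\<^sup>J - 1)\<N> + \<onehalf>(e\<^sup>2\<^sup>t\<^sup>J - 1)\<xi>\<close>, for \<open>V = V\<^sub>\<Sigma>\<close>.\<close>

definition family_conn ::
  "(real^2 \<Rightarrow> ('m::finite) lorentz set) \<Rightarrow> (real^2 \<Rightarrow> 'm lorentz) \<Rightarrow>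
   (real^2 \<Rightarrow> real^2 \<Rightarrow> 'm lorentz \<Rightarrow> 'm lorentz) \<Rightarrow> real \<Rightarrow> 'm lorentz connection" where
  "family_conn V s \<xi> t X f u = dird X f u
     + (rot_endo s t (NV V) u X (f u) - NV V u X (f u))
     + (1/2) *\<^sub>R (rot_endo s (2 * t) \<xi> u X (f u) - \<xi> u X (f u))"

definition has_class ::
  "'a::topological_space chart set \<Rightarrow> ('a \<Rightarrow> ('m::finite) lorentz set) \<Rightarrow>
   ('a chart \<Rightarrow> real^2 \<Rightarrow> real^2 \<Rightarrow> 'm lorentz \<Rightarrow> 'm lorentz) \<Rightarrow>
   ('a chart \<Rightarrow> real^2 \<Rightarrow> real^2 \<Rightarrow> real^2 \<Rightarrow> real) \<Rightarrow> bool" where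
  "has_class A \<Lambda> \<xi> q \<longleftrightarrow> (\<forall>\<sigma>. positive_section A \<Lambda> \<sigma> \<longrightarrow>
     (\<forall>P\<in>A. \<forall>u\<in>fst P. homology_class (\<sigma> \<circ> snd P) (\<xi> P) u = q P u))"

definition d_closed_and_star_closed ::
  "'a::topological_space chart set \<Rightarrow> ('a \<Rightarrow> ('m::finite) lorentz set) \<Rightarrow>
   ('a chart \<Rightarrow> real^2 \<Rightarrow> real^2 \<Rightarrow> 'm lorentz \<Rightarrow> 'm lorentz) \<Rightarrow> bool" where
  "d_closed_and_star_closed A \<Lambda> \<xi> \<longleftrightarrow> (\<forall>\<sigma>. positive_section A \<Lambda> \<sigma> \<longrightarrow> (\<forall>P\<in>A. \<forall>u\<in>fst P.
     let s = \<sigma> \<circ> snd P; V = central_congruence A \<Lambda> \<circ> snd P in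
     (\<forall>X Y v. ext_cov (Dh V s) (\<xi> P) u X Y v = 0) \<and>
     (\<forall>X Y v. ext_cov (\<lambda>Z f w. Dh V s Z f w - \<xi> P w Z (f w)) (hodge_endo s (NV V)) u X Y v = 0)))"

definition flat_family ::
  "'a::topological_space chart set \<Rightarrow> ('a \<Rightarrow> ('m::finite) lorentz set) \<Rightarrow>
   ('a chart \<Rightarrow> real^2 \<Rightarrow> real^2 \<Rightarrow> 'm lorentz \<Rightarrow> 'm lorentz) \<Rightarrow> bool" where
  "flat_family A \<Lambda> \<xi> \<longleftrightarrow> (\<forall>\<sigma>. positive_section A \<Lambda> \<sigma> \<longrightarrow> (\<forall>P\<in>A.
     \<forall>t::real. flat_on (fst P)
       (family_conn (central_congruence A \<Lambda> \<circ> snd P) (\<sigma> \<circ> snd P) (\<xi> P) t)))"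

end

theory Submission
  imports Defs
begin

text \<open>Over a chart, let \<open>s\<close> be a positive section of \<open>\<Lambda>\<close> and \<open>z\<close> the null section of \<open>V\<^sub>\<Sigma>\<close> orthogonal to \<open>ds\<close>
  with \<open>(s, z) = -1\<close>.  In the frame \<open>s, ds, z\<close> the Codazzi equation reads \<open>\<N> z = - div II\<close>, so the Willmore
  operator is visible in the derivative of \<open>*\<N>\<close> at \<open>z\<close>.  Write \<open>D\<close> for \<open>\<DD>\<^sup>V + \<nabla>\<^sup>V\<close> and \<open>[\<alpha> \<and> \<beta>]\<close> for the bracket of
  \<open>1\<close>-forms.  Flatness of \<open>d\<close> gives \<open>d\<^sup>D \<N> = 0\<close>; together with \<open>[*\<alpha> \<and> *\<beta>] = [\<alpha> \<and> \<beta>]\<close>, \<open>[\<alpha> \<and> *\<beta>] = - [*\<alpha> \<and> \<beta>]\<close> and the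
  commutativity of \<open>stab(\<Lambda>)\<^sup>\<bottom>\<close> it follows that the family of connections has curvature
  \<open>sin t (d\<^sup>D *\<N> - [\<xi> \<and> *\<N>]) + (cos 2t - 1)/2 d\<^sup>D \<xi> + (sin 2t)/2 d\<^sup>D *\<xi>\<close>.

  If \<open>d\<^sup>D \<xi> = 0\<close>, evaluation on \<open>s\<close> and \<open>ds\<close> shows that \<open>\<xi>\<close> kills the normal bundle and comes from a closed,
  symmetric, tracefree form, necessarily \<open>q\<close>; conversely closedness of \<open>q\<close> implies \<open>d\<^sup>D \<xi> = 0\<close> and \<open>d\<^sup>D *\<xi> = 0\<close>.
  For such \<open>\<xi>\<close> the form \<open>d\<^sup>D *\<N> - [\<xi> \<and> *\<N>]\<close> vanishes identically as soon as it vanishes at \<open>z\<close>, where it is minus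
  the volume density times \<open>(\<H>\<^sup>\<nabla>)\<^sup>*(II) - \<langle>q, II\<rangle>\<close>.  The pure trace form \<open>Q\<close> contributes nothing to either condition.\<close>

section \<open>Calculus in two real variables\<close>

text \<open>The double angle and the factor 1/2 in the family are forced by the bracket rules. A
  rotation crosses a bracket with the opposite angle, so e^{2tJ} on \<xi> against e^{tJ} on \<N>
  acts like e^{-tJ} on \<N> alone, and the mixed terms reduce to sin t times the bracket of \<xi>
  with *\<N>. The bracket of e^{tJ} \<N> with itself does not depend on t and is absorbed by the
  flatness of d.

  Flatness for all t thus gives three equations, one more than (ii): closedness of *\<xi>, which for
  a closed symmetric tracefree form is a two-dimensional phenomenon. On the other hand (ii) does not
  place \<xi> in so(V). Hence the cycle from (i) to (iii) to (ii) and back, in which the passage to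
  (ii) only forgets information.

  Almost everything happens in one chart with one positive section. The obstacle is the congruence,
  a definite description over all charts and sections: it is built pointwise from a local formula
  and shown to be independent of both. Identities between skew maps are tested on \<open>s\<close>,
  \<open>ds\<close> and the normal bundle; what remains is the normal part at
  \<open>z\<close>.\<close>

lemma dird_eq: "(f has_derivative f') (at u) \<Longrightarrow> dird X f u = f' X"
  unfolding dird_def using frechet_derivative_at by metis

lemma has_derivative_dird: "f differentiable (at u) \<Longrightarrow> (f has_derivative (\<lambda>X. dird X f u)) (at u)"
  unfolding dird_def by (simp add: frechet_derivative_works[symmetric])

text \<open>\<open>frechet_derivative\<close> is a choice among the derivatives at a point, and
  agreement near \<open>u\<close> makes these the same for both functions. The rule therefore covers
  points where neither is differentiable.\<close>

lemma dird_cong: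
  assumes "open W" "u \<in> W" "\<And>w. w \<in> W \<Longrightarrow> f w = g w"
  shows "dird X f u = dird X g u"
proof -
  have "(f has_derivative f') (at u) \<longleftrightarrow> (g has_derivative f') (at u)" for f'
    using has_derivative_transform_within_open[of f f' u UNIV W g]
      has_derivative_transform_within_open[of g f' u UNIV W f] assms by auto
  then show ?thesis unfolding dird_def frechet_derivative_def by simp
qed

lemma differentiable_cong_open:
  assumes "open W" "u \<in> W" "\<And>w. w \<in> W \<Longrightarrow> f w = g w" "f differentiable (at u)"
  shows "g differentiable (at u)"
  using assms by (meson differentiable_def has_derivative_transform_within_open)

lemma linear_dird: "f differentiable (at u) \<Longrightarrow> linear (\<lambda>X. dird X f u)"
  by (simp add: dird_def linear_frechet_derivative)

lemma vec2_expand: "X = (X $ 1) *\<^sub>R ee 1 + (X $ 2) *\<^sub>R ee 2"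
  by (simp add: vec_eq_iff forall_2 axis_def)

lemma linear_expand2:
  assumes "linear (f :: real^2 \<Rightarrow> 'b::real_vector)"
  shows "f X = (X $ 1) *\<^sub>R f (ee 1) + (X $ 2) *\<^sub>R f (ee 2)"
  using arg_cong[OF vec2_expand[of X], of f] by (simp add: linear_add[OF assms] linear_scale[OF assms])

lemma dird_expand:
  "f differentiable (at u) \<Longrightarrow> dird X f u = (X $ 1) *\<^sub>R dird (ee 1) f u + (X $ 2) *\<^sub>R dird (ee 2) f u"
  by (rule linear_expand2[OF linear_dird])

lemma dird_const [simp]: "dird X (\<lambda>w. c) u = 0"
  by (simp add: dird_def)

lemma dird_add:
  assumes "f differentiable (at u)" "g differentiable (at u)"
  shows "dird X (\<lambda>w. f w + g w) u = dird X f u + dird X g u"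
  using has_derivative_add[OF assms[THEN has_derivative_dird]] by (rule dird_eq)

lemma dird_diff:
  assumes "f differentiable (at u)" "g differentiable (at u)"
  shows "dird X (\<lambda>w. f w - g w) u = dird X f u - dird X g u"
  using has_derivative_diff[OF assms[THEN has_derivative_dird]] by (rule dird_eq)

lemma dird_bounded_linear:
  assumes "bounded_linear L" "f differentiable (at u)"
  shows "dird X (\<lambda>w. L (f w)) u = L (dird X f u)"
  by (rule dird_eq) (rule bounded_linear.has_derivative[OF assms(1) has_derivative_dird[OF assms(2)]])

lemma dird_minus: "f differentiable (at u) \<Longrightarrow> dird X (\<lambda>w. - f w) u = - dird X f u"
  by (rule dird_bounded_linear[OF bounded_linear_minus[OF bounded_linear_ident]])

lemma dird_bilinear:
  assumes "bounded_bilinear B" "f differentiable (at u)" "g differentiable (at u)"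
  shows "dird X (\<lambda>w. B (f w) (g w)) u = B (dird X f u) (g u) + B (f u) (dird X g u)"
  using dird_eq[OF bounded_bilinear.FDERIV[OF assms(1) assms(2,3)[THEN has_derivative_dird]]]
  by (simp add: add.commute)

lemmas dird_scaleR = dird_bilinear[OF bounded_bilinear_scaleR]
lemmas dird_mult = dird_bilinear[OF bounded_bilinear_mult[where 'a = real]]

lemma dird_scaleR_const: "f differentiable (at u) \<Longrightarrow> dird X (\<lambda>w. c *\<^sub>R f w) u = c *\<^sub>R dird X f u"
  by (simp add: dird_scaleR)

lemma dird_sum:
  assumes "finite S" "\<And>i. i \<in> S \<Longrightarrow> f i differentiable (at u)"
  shows "dird X (\<lambda>w. \<Sum>i\<in>S. f i w) u = (\<Sum>i\<in>S. dird X (f i) u)"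
  by (rule dird_eq[OF has_derivative_sum]) (use assms in \<open>auto intro: has_derivative_dird\<close>)

lemma dird_inverse:
  fixes f :: "real^2 \<Rightarrow> real"
  assumes "f differentiable (at u)" "f u \<noteq> 0"
  shows "dird X (\<lambda>w. inverse (f w)) u = - (dird X f u * (inverse (f u) * inverse (f u)))"
  using dird_eq[OF Deriv.has_derivative_inverse[OF assms(2) has_derivative_dird[OF assms(1)]]]
  by (simp add: mult_ac)

lemma dird_compose:
  assumes "\<tau> differentiable (at u)" "f differentiable (at (\<tau> u))"
  shows "dird X (\<lambda>w. f (\<tau> w)) u = dird (dird X \<tau> u) f (\<tau> u)"
  by (rule dird_eq, rule has_derivative_compose[OF has_derivative_dird[OF assms(1)] has_derivative_dird[OF assms(2)]])

section \<open>Functions of class C^k and smooth functions\<close>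

lemma Ck_cong:
  assumes "open W"
  shows "(\<And>u. u \<in> W \<Longrightarrow> f u = g u) \<Longrightarrow> Ck_on k f W \<Longrightarrow> Ck_on k g W"
proof (induction k arbitrary: f g)
  case 0
  then show ?case by (simp cong: continuous_on_cong)
next
  case (Suc k)
  have "f differentiable_on W" using Suc by simp
  then have "g differentiable_on W"
    using Suc.prems(1) differentiable_cong_open[OF assms] differentiable_on_eq_differentiable_at[OF assms] by metis
  moreover have "Ck_on k (dird (ee i) g) W" for i
  proof (rule Suc.IH)
    show "dird (ee i) f u = dird (ee i) g u" if "u \<in> W" for u
      using dird_cong[OF assms that Suc.prems(1)] .
    show "Ck_on k (dird (ee i) f) W" using Suc.prems(2) by simp
  qed
  ultimately show ?case by simp
qed

lemma Ck_SucI: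
  assumes "open W" "\<And>u. u \<in> W \<Longrightarrow> (f has_derivative f' u) (at u)" "\<And>i. Ck_on k (\<lambda>u. f' u (ee i)) W"
  shows "Ck_on (Suc k) f W"
proof -
  have "f differentiable_on W"
    using assms(2) differentiable_def by (metis differentiable_at_imp_differentiable_on)
  moreover have "Ck_on k (dird (ee i) f) W" for i
    by (rule Ck_cong[OF assms(1) _ assms(3)]) (simp add: dird_eq[OF assms(2)])
  ultimately show ?thesis by simp
qed

lemma Ck_diff: "Ck_on (Suc k) f W \<Longrightarrow> open W \<Longrightarrow> u \<in> W \<Longrightarrow> f differentiable (at u)"
  by (simp add: differentiable_on_eq_differentiable_at)

lemma Ck_Suc_imp: "Ck_on (Suc k) f W \<Longrightarrow> Ck_on k f W"
proof (induction k arbitrary: f)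
  case 0
  then show ?case by (simp add: differentiable_imp_continuous_on)
next
  case (Suc k)
  then show ?case by (metis Ck_on.simps(2))
qed

lemma Ck_const: "open W \<Longrightarrow> Ck_on k (\<lambda>u. c) W"
proof (induction k arbitrary: c)
  case (Suc k)
  show ?case by (rule Ck_SucI[where f' = "\<lambda>u X. 0"]) (use Suc in auto)
qed simp

lemma Ck_add: "open W \<Longrightarrow> Ck_on k f W \<Longrightarrow> Ck_on k g W \<Longrightarrow> Ck_on k (\<lambda>u. f u + g u) W"
proof (induction k arbitrary: f g)
  case 0
  then show ?case by (simp add: continuous_on_add)
next
  case (Suc k)
  have d: "\<And>u. u \<in> W \<Longrightarrow> f differentiable (at u)" "\<And>u. u \<in> W \<Longrightarrow> g differentiable (at u)"
    using Ck_diff Suc.prems by metis+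
  show ?case
    by (rule Ck_SucI[where f' = "\<lambda>u X. dird X f u + dird X g u"])
      (use Suc d in \<open>auto intro!: has_derivative_add has_derivative_dird\<close>)
qed

lemma Ck_bilinear:
  assumes B: "bounded_bilinear B" and W: "open W"
  shows "Ck_on k f W \<Longrightarrow> Ck_on k g W \<Longrightarrow> Ck_on k (\<lambda>u. B (f u) (g u)) W"
proof (induction k arbitrary: f g)
  case 0
  then show ?case by (simp add: bounded_bilinear.continuous_on[OF B])
next
  case (Suc k)
  have d: "\<And>u. u \<in> W \<Longrightarrow> f differentiable (at u)" "\<And>u. u \<in> W \<Longrightarrow> g differentiable (at u)"
    using Ck_diff Suc.prems W by metis+
  have "Ck_on k f W" "Ck_on k g W" using Suc.prems Ck_Suc_imp by blast+
  then show ?case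
    using Suc d by (intro Ck_SucI[where f' = "\<lambda>u X. B (f u) (dird X g u) + B (dird X f u) (g u)"])
      (auto intro!: W Ck_add bounded_bilinear.FDERIV[OF B] has_derivative_dird)
qed

lemma Ck_linear:
  assumes "bounded_linear L" "open W" "Ck_on k f W"
  shows "Ck_on k (\<lambda>u. L (f u)) W"
proof -
  \<comment> \<open>Reduction to the bilinear rule: \<open>L x\<close> is
    \<open>r *\<^sub>R L x\<close> at the constant \<open>r = 1\<close>.\<close>
  have "bounded_bilinear (\<lambda>(r::real) x. r *\<^sub>R L x)"
    by (rule bounded_bilinear.comp[OF bounded_bilinear_scaleR bounded_linear_ident assms(1)])
  from Ck_bilinear[OF this assms(2) Ck_const[OF assms(2), of k 1] assms(3)] show ?thesis by simp
qed

lemma Ck_inverse: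
  assumes "open W"
  shows "Ck_on k f W \<Longrightarrow> (\<And>u. u \<in> W \<Longrightarrow> f u \<noteq> 0) \<Longrightarrow> Ck_on k (\<lambda>u. inverse (f u :: real)) W"
proof (induction k)
  case 0
  then show ?case by (simp add: continuous_on_inverse)
next
  case (Suc k)
  have d: "\<And>u. u \<in> W \<Longrightarrow> f differentiable (at u)"
    using Ck_diff Suc.prems assms by metis
  have i: "Ck_on k (\<lambda>u. inverse (f u)) W" using Suc Ck_Suc_imp by blast
  note m = Ck_bilinear[OF bounded_bilinear_mult assms]
  show ?case
    using Suc.prems d i by (intro Ck_SucI[where f' = "\<lambda>u X. - (inverse (f u) * dird X f u * inverse (f u))"])
      (auto intro!: assms m Ck_linear[OF bounded_linear_minus[OF bounded_linear_ident]]
        Deriv.has_derivative_inverse has_derivative_dird)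
qed

text \<open>The inner map is smooth to all orders, so each step of the induction can spend one order
  of \<open>f\<close> and still use the derivatives of \<tau> as coefficients of the chain
  rule.\<close>

lemma Ck_compose:
  fixes \<tau> :: "real^2 \<Rightarrow> real^2"
  assumes "open W" "open W'" "\<tau> ` W \<subseteq> W'" "\<And>k. Ck_on k \<tau> W"
  shows "Ck_on k f W' \<Longrightarrow> Ck_on k (\<lambda>u. f (\<tau> u)) W"
proof (induction k arbitrary: f)
  case 0
  moreover have "continuous_on W \<tau>" using assms(4)[of 0] by simp
  ultimately show ?case using assms(3) by (simp add: continuous_on_compose2)
next
  case (Suc k)
  have d: "\<And>u. u \<in> W \<Longrightarrow> f differentiable (at (\<tau> u))" "\<And>u. u \<in> W \<Longrightarrow> \<tau> differentiable (at u)"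
    using Ck_diff[OF Suc.prems assms(2)] Ck_diff[OF assms(4,1)] assms(3) by blast+
  have "Ck_on (Suc k) (\<lambda>u. f (\<tau> u)) W"
  proof (rule Ck_SucI[where f' = "\<lambda>u X. dird (dird X \<tau> u) f (\<tau> u)", OF assms(1)])
    show "((\<lambda>u. f (\<tau> u)) has_derivative (\<lambda>X. dird (dird X \<tau> u) f (\<tau> u))) (at u)" if "u \<in> W" for u
      using has_derivative_compose[OF has_derivative_dird[OF d(2)[OF that]] has_derivative_dird[OF d(1)[OF that]]] .
    fix i
    have t: "Ck_on k (\<lambda>u. dird (ee i) \<tau> u $ j) W" for j
      by (rule Ck_linear[OF bounded_linear_vec_nth assms(1)]) (metis assms(4) Ck_on.simps(2))
    have "Ck_on k (\<lambda>u. (dird (ee i) \<tau> u $ 1) *\<^sub>R dird (ee 1) f (\<tau> u)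
        + (dird (ee i) \<tau> u $ 2) *\<^sub>R dird (ee 2) f (\<tau> u)) W"
      using Suc by (intro Ck_add Ck_bilinear[OF bounded_bilinear_scaleR] t assms(1)) auto
    then show "Ck_on k (\<lambda>u. dird (dird (ee i) \<tau> u) f (\<tau> u)) W"
      by (rule Ck_cong[OF assms(1), rotated]) (metis d(1) dird_expand)
  qed
  then show ?case .
qed

lemma Ck_subset: "Ck_on k f W \<Longrightarrow> W' \<subseteq> W \<Longrightarrow> Ck_on k f W'"
  by (induction k arbitrary: f) (auto intro: continuous_on_subset differentiable_on_subset)

lemma smooth_on_const: "open W \<Longrightarrow> smooth_on (\<lambda>u. c) W"
  by (simp add: smooth_on_def Ck_const)

lemma smooth_on_add: "open W \<Longrightarrow> smooth_on f W \<Longrightarrow> smooth_on g W \<Longrightarrow> smooth_on (\<lambda>u. f u + g u) W"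
  by (simp add: smooth_on_def Ck_add)

lemma smooth_on_bilinear:
  "bounded_bilinear B \<Longrightarrow> open W \<Longrightarrow> smooth_on f W \<Longrightarrow> smooth_on g W \<Longrightarrow> smooth_on (\<lambda>u. B (f u) (g u)) W"
  by (simp add: smooth_on_def Ck_bilinear)

lemma smooth_on_linear:
  "bounded_linear L \<Longrightarrow> open W \<Longrightarrow> smooth_on f W \<Longrightarrow> smooth_on (\<lambda>u. L (f u)) W"
  by (simp add: smooth_on_def Ck_linear)

lemmas smooth_on_scaleR = smooth_on_bilinear[OF bounded_bilinear_scaleR]
lemmas smooth_on_mult = smooth_on_bilinear[OF bounded_bilinear_mult[where 'a = real]]
lemmas smooth_on_minus = smooth_on_linear[OF bounded_linear_minus[OF bounded_linear_ident]]

lemma smooth_on_diff: "open W \<Longrightarrow> smooth_on f W \<Longrightarrow> smooth_on g W \<Longrightarrow> smooth_on (\<lambda>u. f u - g u) W"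
  using smooth_on_add[OF _ _ smooth_on_minus, of W f g] by simp

lemma smooth_on_inverse:
  "open W \<Longrightarrow> smooth_on f W \<Longrightarrow> (\<And>u. u \<in> W \<Longrightarrow> f u \<noteq> 0) \<Longrightarrow> smooth_on (\<lambda>u. inverse (f u :: real)) W"
  by (simp add: smooth_on_def Ck_inverse)

lemma smooth_on_divide:
  "open W \<Longrightarrow> smooth_on f W \<Longrightarrow> smooth_on g W \<Longrightarrow> (\<And>u. u \<in> W \<Longrightarrow> g u \<noteq> 0) \<Longrightarrow> smooth_on (\<lambda>u. f u / (g u :: real)) W"
  unfolding divide_inverse by (intro smooth_on_mult smooth_on_inverse)

lemma smooth_on_dird_ee: "smooth_on f W \<Longrightarrow> smooth_on (dird (ee i) f) W"
  unfolding smooth_on_def by (metis Ck_on.simps(2))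

lemma smooth_on_differentiable: "smooth_on f W \<Longrightarrow> open W \<Longrightarrow> u \<in> W \<Longrightarrow> f differentiable (at u)"
  unfolding smooth_on_def using Ck_diff by blast

lemma smooth_on_cong: "open W \<Longrightarrow> smooth_on f W \<Longrightarrow> (\<And>u. u \<in> W \<Longrightarrow> f u = g u) \<Longrightarrow> smooth_on g W"
  unfolding smooth_on_def using Ck_cong by blast

lemma smooth_on_dird:
  assumes "open W" "smooth_on f W" shows "smooth_on (dird X f) W"
proof -
  have "smooth_on (\<lambda>u. (X $ 1) *\<^sub>R dird (ee 1) f u + (X $ 2) *\<^sub>R dird (ee 2) f u) W"
    using assms by (intro smooth_on_add smooth_on_scaleR smooth_on_const smooth_on_dird_ee)
  then show ?thesis
    by (rule smooth_on_cong[OF assms(1)]) (metis dird_expand smooth_on_differentiable assms)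
qed

lemma smooth_on_compose:
  fixes \<tau> :: "real^2 \<Rightarrow> real^2"
  assumes "open W" "open W'" "\<tau> ` W \<subseteq> W'" "smooth_on \<tau> W" "smooth_on f W'"
  shows "smooth_on (\<lambda>u. f (\<tau> u)) W"
  using Ck_compose[OF assms(1-3)] assms(4,5) unfolding smooth_on_def by blast

lemma smooth_on_subset: "smooth_on f W \<Longrightarrow> W' \<subseteq> W \<Longrightarrow> smooth_on f W'"
  unfolding smooth_on_def using Ck_subset by blast

lemma smooth_on_continuous: "smooth_on f W \<Longrightarrow> continuous_on W f"
  unfolding smooth_on_def by (metis Ck_on.simps(1))

text \<open>Both mixed derivatives at \<open>u\<close> are limits of the second difference quotient.\<close>

lemma mixed_difference:
  fixes f :: "real^2 \<Rightarrow> real"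
  assumes W: "open W" and u: "ball u r \<subseteq> W" and f: "smooth_on f W"
    and h: "0 < h" "2 * h < r"
  obtains w where "dist w u \<le> 2 * h"
    "f (u + h *\<^sub>R ee i + h *\<^sub>R ee j) - f (u + h *\<^sub>R ee i) - f (u + h *\<^sub>R ee j) + f u
      = h * h * dird (ee j) (dird (ee i) f) w"
proof -
  have inW: "u + a *\<^sub>R ee i + b *\<^sub>R ee j \<in> W" if "0 \<le> a" "a \<le> h" "0 \<le> b" "b \<le> h" for a b
  proof -
    have "norm (a *\<^sub>R ee i + b *\<^sub>R ee j) \<le> \<bar>a\<bar> + \<bar>b\<bar>"
      using norm_triangle_ineq[of "a *\<^sub>R ee i" "b *\<^sub>R ee j"] by simp
    then have "norm (a *\<^sub>R ee i + b *\<^sub>R ee j) < r" using that h by linarith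
    then have "u + (a *\<^sub>R ee i + b *\<^sub>R ee j) \<in> ball u r" by (metis dist_commute dist_norm add_diff_cancel_left' mem_ball)
    then show ?thesis using u add.assoc by (metis subsetD)
  qed
  have line: "((\<lambda>t. g (p + t *\<^sub>R e)) has_derivative (\<lambda>y. y * dird e g (p + t *\<^sub>R e))) (at t within S)"
    if "g differentiable (at (p + t *\<^sub>R e))" for g :: "real^2 \<Rightarrow> real" and p e t S
  proof -
    have "((\<lambda>t. p + t *\<^sub>R e) has_derivative (\<lambda>y. y *\<^sub>R e)) (at t within S)"
      by (auto intro!: derivative_eq_intros)
    from has_derivative_compose[OF this has_derivative_dird[OF that]] show ?thesis
      using linear_scale[OF linear_dird[OF that]] by simp
  qed
  \<comment> \<open>The second difference is the increment of \<open>\<phi>\<close> over [0, h]. The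
    mean value theorem is applied to \<open>\<phi>\<close> in direction \<open>i\<close>, and then
    to the resulting derivative \<open>\<psi>\<close> in direction \<open>j\<close>.\<close>
  define \<phi> where "\<phi> t = f ((u + h *\<^sub>R ee j) + t *\<^sub>R ee i) - f (u + t *\<^sub>R ee i)" for t
  have d\<phi>: "(\<phi> has_derivative (\<lambda>y. y * dird (ee i) f ((u + h *\<^sub>R ee j) + t *\<^sub>R ee i) - y * dird (ee i) f (u + t *\<^sub>R ee i)))
      (at t within {0..h})" if "0 \<le> t" "t \<le> h" for t
    unfolding \<phi>_def[abs_def]
    by (intro has_derivative_diff line smooth_on_differentiable[OF f W])
      (use inW[of t h] inW[of t 0] that h in \<open>auto simp: algebra_simps\<close>)
  obtain t where t: "t \<in> {0<..<h}" and e1: "\<phi> h - \<phi> 0 =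
      (h - 0) * dird (ee i) f ((u + h *\<^sub>R ee j) + t *\<^sub>R ee i) - (h - 0) * dird (ee i) f (u + t *\<^sub>R ee i)"
    using mvt_simple[OF h(1) d\<phi>] by auto
  define \<psi> where "\<psi> r = dird (ee i) f ((u + t *\<^sub>R ee i) + r *\<^sub>R ee j)" for r
  have d\<psi>: "(\<psi> has_derivative (\<lambda>y. y * dird (ee j) (dird (ee i) f) ((u + t *\<^sub>R ee i) + r *\<^sub>R ee j)))
      (at r within {0..h})" if "0 \<le> r" "r \<le> h" for r
    unfolding \<psi>_def[abs_def]
    by (intro line smooth_on_differentiable[OF smooth_on_dird_ee[OF f] W] inW) (use t that in auto)
  obtain r where r: "r \<in> {0<..<h}" and e2: "\<psi> h - \<psi> 0 = (h - 0) * dird (ee j) (dird (ee i) f) ((u + t *\<^sub>R ee i) + r *\<^sub>R ee j)"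
    using mvt_simple[OF h(1) d\<psi>] by auto
  have "f (u + h *\<^sub>R ee i + h *\<^sub>R ee j) - f (u + h *\<^sub>R ee i) - f (u + h *\<^sub>R ee j) + f u = \<phi> h - \<phi> 0"
    unfolding \<phi>_def by (simp add: add_ac)
  also have "\<dots> = h * (\<psi> h - \<psi> 0)" unfolding e1 \<psi>_def by (simp add: algebra_simps)
  also have "\<dots> = h * h * dird (ee j) (dird (ee i) f) ((u + t *\<^sub>R ee i) + r *\<^sub>R ee j)" using e2 by simp
  finally have E: "f (u + h *\<^sub>R ee i + h *\<^sub>R ee j) - f (u + h *\<^sub>R ee i) - f (u + h *\<^sub>R ee j) + f u
     = h * h * dird (ee j) (dird (ee i) f) ((u + t *\<^sub>R ee i) + r *\<^sub>R ee j)" .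
  have "dist ((u + t *\<^sub>R ee i) + r *\<^sub>R ee j) u = norm (t *\<^sub>R ee i + r *\<^sub>R ee j)"
    by (simp add: dist_norm add.assoc)
  also have "\<dots> \<le> \<bar>t\<bar> + \<bar>r\<bar>" using norm_triangle_ineq[of "t *\<^sub>R ee i" "r *\<^sub>R ee j"] by simp
  also have "\<dots> \<le> 2 * h" using t r by simp
  finally show ?thesis using that E by blast
qed

lemma mixed_derivatives_real:
  fixes f :: "real^2 \<Rightarrow> real"
  assumes W: "open W" and u: "u \<in> W" and f: "smooth_on f W"
  shows "dird (ee j) (dird (ee i) f) u = dird (ee i) (dird (ee j) f) u"
proof -
  let ?a = "dird (ee j) (dird (ee i) f)" and ?b = "dird (ee i) (dird (ee j) f)"
  obtain r where r: "r > 0" "ball u r \<subseteq> W" using W u openE by blast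
  have "\<bar>?a u - ?b u\<bar> < e" if "e > 0" for e
  proof -
    have "isCont ?a u" "isCont ?b u"
      using smooth_on_continuous[OF smooth_on_dird_ee[OF smooth_on_dird_ee[OF f]]] W u
      by (simp_all add: continuous_on_eq_continuous_at)
    then have "\<exists>d>0. \<forall>w. dist w u < d \<longrightarrow> dist (?a w) (?a u) < e / 2"
      "\<exists>d>0. \<forall>w. dist w u < d \<longrightarrow> dist (?b w) (?b u) < e / 2"
      using that unfolding continuous_at_eps_delta by (simp_all del: less_divide_eq_numeral1)
    then obtain d1 d2 where d: "d1 > 0" "d2 > 0" "\<And>w. dist w u < d1 \<Longrightarrow> dist (?a w) (?a u) < e / 2"
        "\<And>w. dist w u < d2 \<Longrightarrow> dist (?b w) (?b u) < e / 2"
      by blast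
    \<comment> \<open>Twice the step must stay below all three radii, since the intermediate points
      are only known to lie within \<open>2 * h\<close> of \<open>u\<close>.\<close>
    define h where "h = min r (min d1 d2) / 4"
    have h: "0 < h" "2 * h < r" "2 * h < d1" "2 * h < d2" using d r by (auto simp: h_def)
    obtain w where w: "dist w u \<le> 2 * h" 
      "f (u + h *\<^sub>R ee i + h *\<^sub>R ee j) - f (u + h *\<^sub>R ee i) - f (u + h *\<^sub>R ee j) + f u = h * h * ?a w"
      using mixed_difference[OF W r(2) f h(1,2)] by blast
    obtain v where v: "dist v u \<le> 2 * h" 
      "f (u + h *\<^sub>R ee j + h *\<^sub>R ee i) - f (u + h *\<^sub>R ee j) - f (u + h *\<^sub>R ee i) + f u = h * h * ?b v"
      using mixed_difference[OF W r(2) f h(1,2)] by blast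
    have "u + h *\<^sub>R ee j + h *\<^sub>R ee i = u + h *\<^sub>R ee i + h *\<^sub>R ee j" by simp
    then have "h * h * ?a w = h * h * ?b v" using w(2) v(2) by (smt (verit))
    then have "?a w = ?b v" using h by simp
    moreover have "dist (?a w) (?a u) < e / 2" "dist (?b v) (?b u) < e / 2"
      using d(3)[of w] d(4)[of v] w(1) v(1) h by auto
    ultimately show ?thesis unfolding dist_real_def by linarith
  qed
  from this[of "\<bar>?a u - ?b u\<bar>"] show ?thesis by auto
qed

lemma mixed_derivatives:
  fixes f :: "real^2 \<Rightarrow> 'b::euclidean_space"
  assumes W: "open W" and u: "u \<in> W" and f: "smooth_on f W"
  shows "dird (ee j) (dird (ee i) f) u = dird (ee i) (dird (ee j) f) u"
proof (rule euclidean_eqI)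
  fix b :: 'b assume "b \<in> Basis"
  have *: "dird (ee k) (dird (ee l) f) u \<bullet> b = dird (ee k) (dird (ee l) (\<lambda>w. f w \<bullet> b)) u" for k l
  proof -
    have "dird (ee k) (dird (ee l) (\<lambda>w. f w \<bullet> b)) u = dird (ee k) (\<lambda>w. dird (ee l) f w \<bullet> b) u"
      by (rule dird_cong[OF W u]) (rule dird_bounded_linear[OF bounded_linear_inner_left smooth_on_differentiable[OF f W]])
    then show ?thesis
      using dird_bounded_linear[OF bounded_linear_inner_left smooth_on_differentiable[OF smooth_on_dird_ee[OF f] W u]] by simp
  qed
  show "dird (ee j) (dird (ee i) f) u \<bullet> b = dird (ee i) (dird (ee j) f) u \<bullet> b"
    unfolding * by (rule mixed_derivatives_real[OF W u smooth_on_linear[OF bounded_linear_inner_left W f]])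
qed

section \<open>Lorentzian algebra\<close>

lemma bounded_bilinear_lor: "bounded_bilinear (lor :: 'm::finite lorentz \<Rightarrow> _)"
proof -
  have a: "bounded_bilinear (\<lambda>(v :: 'm lorentz) (w :: 'm lorentz). fst v \<bullet> fst w)"
    by (rule bounded_bilinear.comp[OF bounded_bilinear_inner bounded_linear_fst bounded_linear_fst])
  have b: "bounded_bilinear (\<lambda>(v :: 'm lorentz) (w :: 'm lorentz). snd v * snd w)"
    by (rule bounded_bilinear.comp[OF bounded_bilinear_mult bounded_linear_snd bounded_linear_snd])
  obtain K where K: "\<And>(v :: 'm lorentz) (w :: 'm lorentz). norm (fst v \<bullet> fst w) \<le> norm v * norm w * K"
    using bounded_bilinear.bounded[OF a] by metis
  obtain L where L: "\<And>(v :: 'm lorentz) (w :: 'm lorentz). norm (snd v * snd w) \<le> norm v * norm w * L"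
    using bounded_bilinear.bounded[OF b] by metis
  show ?thesis
  proof
    show "\<exists>K. \<forall>(v :: 'm lorentz) (w :: 'm lorentz). norm (lor v w) \<le> norm v * norm w * K"
    proof (intro exI allI)
      fix v w :: "'m lorentz"
      show "norm (lor v w) \<le> norm v * norm w * (K + L)"
        using norm_triangle_ineq4[of "fst v \<bullet> fst w" "snd v * snd w"] K[of v w] L[of v w]
        by (simp add: lor_def distrib_left)
    qed
  qed (auto simp: lor_def algebra_simps inner_simps)
qed

lemma lor_sym: "lor v w = lor w v"
  by (simp add: lor_def inner_commute mult.commute)

lemmas lor_add_left = bounded_bilinear.add_left[OF bounded_bilinear_lor]
lemmas lor_add_right = bounded_bilinear.add_right[OF bounded_bilinear_lor]
lemmas lor_diff_left = bounded_bilinear.diff_left[OF bounded_bilinear_lor]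
lemmas lor_diff_right = bounded_bilinear.diff_right[OF bounded_bilinear_lor]
lemmas lor_minus_left = bounded_bilinear.minus_left[OF bounded_bilinear_lor]
lemmas lor_minus_right = bounded_bilinear.minus_right[OF bounded_bilinear_lor]
lemmas lor_zero_left = bounded_bilinear.zero_left[OF bounded_bilinear_lor]
lemmas lor_zero_right = bounded_bilinear.zero_right[OF bounded_bilinear_lor]
lemma lor_scaleR_left: "lor (r *\<^sub>R v) w = r * lor v w"
  using bounded_bilinear.scaleR_left[OF bounded_bilinear_lor] by simp
lemma lor_scaleR_right: "lor v (r *\<^sub>R w) = r * lor v w"
  using bounded_bilinear.scaleR_right[OF bounded_bilinear_lor] by simp

lemmas lor_simps = lor_add_left lor_add_right lor_diff_left lor_diff_right lor_minus_left
  lor_minus_right lor_zero_left lor_zero_right lor_scaleR_left lor_scaleR_right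

lemma lor_eqI:
  assumes "\<And>x. lor v x = lor w x" shows "v = w"
proof -
  \<comment> \<open>Changing the sign of the second component of the test vector turns
    \<open>lor\<close> into the Euclidean inner product, which is definite.\<close>
  have "lor (v - w) (fst (v - w), - snd (v - w)) = 0"
    by (simp add: lor_diff_left assms)
  then have "(fst v - fst w) \<bullet> (fst v - fst w) + (snd v - snd w) * (snd v - snd w) = 0"
    by (simp add: lor_def algebra_simps)
  then have "fst v - fst w = 0 \<and> snd v - snd w = 0"
    using inner_ge_zero[of "fst v - fst w"] inner_eq_zero_iff[of "fst v - fst w"]
      zero_le_square[of "snd v - snd w"] by (simp add: add_nonneg_eq_0_iff)
  then show ?thesis by (simp add: prod_eq_iff)
qed

lemmas dird_lor = dird_bilinear[OF bounded_bilinear_lor]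
lemmas smooth_on_lor = smooth_on_bilinear[OF bounded_bilinear_lor]

text \<open>Cauchy-Schwarz for the first components: \<open>norm (fst s) = snd s\<close> and
  orthogonality to \<open>s\<close> force \<open>\<bar>snd v\<bar> \<le> norm (fst v)\<close>, and
  equality makes \<open>v\<close> proportional to \<open>s\<close>. This turns injectivity of
  d\<sigma> modulo \<Lambda> into definiteness of the induced metric.\<close>

lemma null_perp_nonneg:
  assumes "lor s s = 0" "snd s > 0" "lor s v = 0"
  shows "lor v v \<ge> 0" and "lor v v = 0 \<Longrightarrow> v \<in> span {s}"
proof -
  have n: "norm (fst s) = snd s"
    using assms(1,2) by (simp add: lor_def power2_norm_eq_inner[symmetric] flip: power2_eq_square)
  have e: "fst s \<bullet> fst v = snd s * snd v" using assms(3) by (simp add: lor_def)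
  have "\<bar>snd s * snd v\<bar> \<le> snd s * norm (fst v)"
    using Cauchy_Schwarz_ineq2[of "fst s" "fst v"] by (simp add: e n)
  then have le: "\<bar>snd v\<bar> \<le> norm (fst v)" using assms(2) by (simp add: abs_mult)
  have lv: "lor v v = (norm (fst v))\<^sup>2 - (snd v)\<^sup>2"
    unfolding power2_norm_eq_inner by (simp add: lor_def power2_eq_square)
  show "lor v v \<ge> 0" unfolding lv using abs_le_square_iff[of "snd v" "norm (fst v)"] le by simp
  assume "lor v v = 0"
  then have nv: "norm (fst v) = \<bar>snd v\<bar>"
    unfolding lv by (metis abs_norm_cancel eq_iff_diff_eq_0 power2_eq_iff_nonneg abs_ge_zero norm_ge_zero power2_abs)
  \<comment> \<open>The only possible factor of proportionality, read off from the second
    components.\<close>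
  define c where "c = snd v / snd s"
  have "(norm (fst v - c *\<^sub>R fst s))\<^sup>2 = fst v \<bullet> fst v - 2 * c * (fst s \<bullet> fst v) + c\<^sup>2 * (fst s \<bullet> fst s)"
    unfolding power2_norm_eq_inner by (simp add: inner_simps inner_commute power2_eq_square algebra_simps)
  also have "\<dots> = (snd v)\<^sup>2 - 2 * c * (snd s * snd v) + c\<^sup>2 * (snd s)\<^sup>2"
    unfolding e using nv n power2_norm_eq_inner[of "fst v"] power2_norm_eq_inner[of "fst s"] by simp
  also have "\<dots> = 0" using assms(2) by (simp add: c_def field_simps power2_eq_square)
  finally have "fst v = c *\<^sub>R fst s" by simp
  moreover have "snd v = c * snd s" using assms(2) by (simp add: c_def)
  ultimately have "v = c *\<^sub>R s" by (simp add: prod_eq_iff)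
  then show "v \<in> span {s}" by (simp add: span_scale span_base)
qed

lemma in_span4:
  "x \<in> span {a, b, c, d} \<longleftrightarrow> (\<exists>p q r t. x = p *\<^sub>R a + q *\<^sub>R b + r *\<^sub>R c + t *\<^sub>R (d::'b::real_vector))"
  (is "?L \<longleftrightarrow> ?R")
proof
  assume ?L
  then show ?R
    by (auto simp: span_insert algebra_simps)
next
  assume ?R
  then show ?L by (elim exE) (simp add: span_add span_scale span_base)
qed

text \<open>The last premise is nondegeneracy of \<open>E\<close>; it gives the uniqueness that the
  definite description in \<open>lproj\<close> asks for.\<close>

lemma lproj_eqI:
  assumes "w \<in> E" "v - w \<in> lperp E" "subspace E" "\<And>x. x \<in> E \<Longrightarrow> x \<in> lperp E \<Longrightarrow> x = 0"
  shows "lproj E v = w"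
  unfolding lproj_def
proof (rule the_equality)
  fix w' assume w': "w' \<in> E \<and> v - w' \<in> lperp E"
  have "w' - w \<in> E" using w' assms subspace_diff by blast
  moreover have "w' - w \<in> lperp E"
  proof -
    have "w' - w = (v - w) - (v - w')" by simp
    then show ?thesis using w' assms(2) by (simp only: lperp_def mem_Collect_eq lor_diff_left) auto
  qed
  ultimately show "w' = w" using assms(4)[of "w' - w"] by simp
qed (use assms in simp)

lemma subspace_lperp: "subspace (lperp E)"
  by (auto simp: subspace_def lperp_def lor_simps)

text \<open>A product rule for linear maps whose dependence on the point is controlled only at each
  fixed vector. Expanding the argument in a basis reduces it to scalar coefficients and avoids
  differentiating in a space of endomorphisms.\<close>

lemma dird_apply:
  fixes \<alpha> :: "real^2 \<Rightarrow> 'b::euclidean_space \<Rightarrow> 'c::real_normed_vector"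
  assumes W: "open W" "u \<in> W" and lin: "\<And>w. w \<in> W \<Longrightarrow> linear (\<alpha> w)"
    and d: "\<And>v. (\<lambda>w. \<alpha> w v) differentiable (at u)" and f: "f differentiable (at u)"
  shows "dird X (\<lambda>w. \<alpha> w (f w)) u = dird X (\<lambda>w. \<alpha> w (f u)) u + \<alpha> u (dird X f u)"
    and "(\<lambda>w. \<alpha> w (f w)) differentiable (at u)"
    and "linear (\<lambda>v. dird X (\<lambda>w. \<alpha> w v) u)"
proof -
  have fb: "(\<lambda>w. f w \<bullet> b) differentiable (at u)" for b
    using f by (intro differentiable_inner) auto
  have sd: "(\<lambda>w. (f w \<bullet> b) *\<^sub>R \<alpha> w b) differentiable (at u)" for b
    by (intro differentiable_scaleR fb d)
  have ex: "\<alpha> w v = (\<Sum>b\<in>Basis. (v \<bullet> b) *\<^sub>R \<alpha> w b)" if "w \<in> W" for w v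
    by (subst euclidean_representation[symmetric, of v])
      (simp only: linear_sum[OF lin[OF that]] linear_scale[OF lin[OF that]])
  have D: "dird X (\<lambda>w. \<alpha> w v) u = (\<Sum>b\<in>Basis. (v \<bullet> b) *\<^sub>R dird X (\<lambda>w. \<alpha> w b) u)" for v
  proof -
    have "dird X (\<lambda>w. \<alpha> w v) u = dird X (\<lambda>w. \<Sum>b\<in>Basis. (v \<bullet> b) *\<^sub>R \<alpha> w b) u"
      by (rule dird_cong[OF W ex])
    also have "\<dots> = (\<Sum>b\<in>Basis. dird X (\<lambda>w. (v \<bullet> b) *\<^sub>R \<alpha> w b) u)"
      by (rule dird_sum) (auto intro!: differentiable_scaleR d)
    finally show ?thesis by (simp add: dird_scaleR_const[OF d])
  qed
  have "dird X (\<lambda>w. \<alpha> w (f w)) u = dird X (\<lambda>w. \<Sum>b\<in>Basis. (f w \<bullet> b) *\<^sub>R \<alpha> w b) u"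
    by (rule dird_cong[OF W ex])
  also have "\<dots> = (\<Sum>b\<in>Basis. (dird X f u \<bullet> b) *\<^sub>R \<alpha> u b + (f u \<bullet> b) *\<^sub>R dird X (\<lambda>w. \<alpha> w b) u)"
  proof -
    have "dird X (\<lambda>w. \<Sum>b\<in>Basis. (f w \<bullet> b) *\<^sub>R \<alpha> w b) u = (\<Sum>b\<in>Basis. dird X (\<lambda>w. (f w \<bullet> b) *\<^sub>R \<alpha> w b) u)"
      by (rule dird_sum[OF finite_Basis sd])
    then show ?thesis
      by (simp add: dird_scaleR[OF fb d] dird_bounded_linear[OF bounded_linear_inner_left f])
  qed
  also have "\<dots> = dird X (\<lambda>w. \<alpha> w (f u)) u + \<alpha> u (dird X f u)"
    by (simp only: sum.distrib D[of "f u"] ex[OF W(2), of "dird X f u"] add.commute)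
  finally show "dird X (\<lambda>w. \<alpha> w (f w)) u = dird X (\<lambda>w. \<alpha> w (f u)) u + \<alpha> u (dird X f u)" .
  have "(\<lambda>w. \<Sum>b\<in>Basis. (f w \<bullet> b) *\<^sub>R \<alpha> w b) differentiable (at u)"
    by (intro differentiable_sum ballI sd finite_Basis)
  then show "(\<lambda>w. \<alpha> w (f w)) differentiable (at u)"
    by (rule differentiable_cong_open[OF W, rotated]) (simp only: ex[symmetric])
  have "linear (\<lambda>v. \<Sum>b\<in>Basis. (v \<bullet> b) *\<^sub>R dird X (\<lambda>w. \<alpha> w b) u)"
    by (rule linearI) (simp_all only: inner_add_left inner_scaleR_left scaleR_left_distrib sum.distrib scaleR_sum_right scaleR_scaleR)
  then show "linear (\<lambda>v. dird X (\<lambda>w. \<alpha> w v) u)" unfolding linear_iff D[symmetric] .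
qed

section \<open>Null immersions and adapted frames\<close>

lemma matrix_inv_2:
  fixes M :: "real^2^2"
  assumes "M $ 2 $ 1 = M $ 1 $ 2" "det M \<noteq> 0"
  shows "matrix_inv M $ 1 $ 1 = M $ 2 $ 2 / det M" "matrix_inv M $ 1 $ 2 = - M $ 1 $ 2 / det M"
    "matrix_inv M $ 2 $ 1 = - M $ 1 $ 2 / det M" "matrix_inv M $ 2 $ 2 = M $ 1 $ 1 / det M"
proof -
  let ?N = "\<chi> i j. (if i = 1 then (if j = 1 then M $ 2 $ 2 else - M $ 1 $ 2)
    else (if j = 1 then - M $ 1 $ 2 else M $ 1 $ 1)) / det M :: real^2^2"
  define d where "d = det M"
  have d: "M $ 1 $ 1 * M $ 2 $ 2 = d + M $ 1 $ 2 * M $ 1 $ 2" "d \<noteq> 0"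
    using assms by (simp_all add: d_def det_2)
  have NM: "?N ** M = mat 1" "M ** ?N = mat 1"
    unfolding d_def[symmetric] using assms(1) d
    by (simp_all add: vec_eq_iff forall_2 matrix_matrix_mult_def mat_def sum_2 field_simps)
  have "matrix_inv M = ?N"
    unfolding matrix_inv_def
  proof (rule some_equality)
    fix B assume "M ** B = mat 1 \<and> B ** M = mat 1"
    then have "B ** (M ** ?N) = ?N" by (simp only: matrix_mul_assoc matrix_mul_lid)
    then show "B = ?N" by (simp only: NM matrix_mul_rid)
  qed (use NM in simp)
  then show "matrix_inv M $ 1 $ 1 = M $ 2 $ 2 / det M" "matrix_inv M $ 1 $ 2 = - M $ 1 $ 2 / det M"
    "matrix_inv M $ 2 $ 1 = - M $ 1 $ 2 / det M" "matrix_inv M $ 2 $ 2 = M $ 1 $ 1 / det M"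
    by simp_all
qed

text \<open>The domain is an arbitrary open set because the locale is used not only on whole charts
  but also on overlaps of charts and on neighbourhoods where a given section stays transverse to the
  complement of \<open>s\<close>.\<close>

locale null_immersion =
  fixes W :: "(real^2) set" and s :: "real^2 \<Rightarrow> ('m::finite) lorentz"
  assumes W: "open W" and smooth_s: "smooth_on s W"
    and null_s: "\<And>w. w \<in> W \<Longrightarrow> lor (s w) (s w) = 0"
    and pos: "\<And>w X. w \<in> W \<Longrightarrow> X \<noteq> 0 \<Longrightarrow> metric s w X X > 0"
begin

abbreviation S :: "2 \<Rightarrow> real^2 \<Rightarrow> 'm lorentz" where "S i \<equiv> dird (ee i) s"

definition gg :: "2 \<Rightarrow> 2 \<Rightarrow> real^2 \<Rightarrow> real" where "gg i j w = lor (S i w) (S j w)"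

definition dg :: "real^2 \<Rightarrow> real" where "dg w = gg 1 1 w * gg 2 2 w - gg 1 2 w * gg 1 2 w"

text \<open>Raising an index: \<open>up k w a b\<close> is the \<open>k\<close>-th component of the vector dual to the \<open>1\<close>-form \<open>(a, b)\<close>.\<close>

definition up :: "2 \<Rightarrow> real^2 \<Rightarrow> real \<Rightarrow> real \<Rightarrow> real" where
  "up k w a b = (if k = 1 then gg 2 2 w * a - gg 1 2 w * b else gg 1 1 w * b - gg 1 2 w * a) / dg w"

lemma gg_sym: "gg 2 1 w = gg 1 2 w"
  by (simp add: gg_def lor_sym)

lemmas smooth_ops = smooth_on_add[OF W] smooth_on_diff[OF W] smooth_on_scaleR[OF W] smooth_on_mult[OF W]
  smooth_on_const[OF W] smooth_on_lor[OF W] smooth_on_dird[OF W] smooth_on_divide[OF W] smooth_on_minus[OF W]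
  smooth_s

lemmas diffI = smooth_on_differentiable[OF _ W]

lemma smooth_gg: "smooth_on (gg i j) W"
  unfolding gg_def[abs_def] by (intro smooth_ops)

lemma dird_const_on:
  assumes "u \<in> W" "\<And>w. w \<in> W \<Longrightarrow> f w = c" shows "dird X f u = 0"
  using dird_cong[where X = X, OF W assms] by simp

lemma perp_s:
  assumes "u \<in> W" shows "lor (s u) (S i u) = 0"
proof -
  have "dird (ee i) (\<lambda>w. lor (s w) (s w)) u = 0"
    using assms null_s by (rule dird_const_on)
  then show ?thesis
    using dird_lor[OF diffI[OF smooth_s assms] diffI[OF smooth_s assms], of "ee i"] by (simp add: lor_sym)
qed

lemma metric_ee: "metric s w (ee i) (ee j) = gg i j w"
  by (simp add: metric_def gg_def)

lemma metric_expand: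
  assumes "u \<in> W"
  shows "metric s u X Y = X $ 1 * Y $ 1 * gg 1 1 u + (X $ 1 * Y $ 2 + X $ 2 * Y $ 1) * gg 1 2 u + X $ 2 * Y $ 2 * gg 2 2 u"
  unfolding metric_def dird_expand[OF diffI[OF smooth_s assms], of X] dird_expand[OF diffI[OF smooth_s assms], of Y]
  by (simp add: lor_simps gg_def lor_sym[of "S 2 u" "S 1 u"] algebra_simps)

lemma gg11_pos: "u \<in> W \<Longrightarrow> gg 1 1 u > 0"
  using pos[of u "ee 1"] by (simp add: metric_ee)

lemma dg_pos:
  assumes "u \<in> W" shows "dg u > 0"
proof -
  \<comment> \<open>A vector orthogonal to the first coordinate field; its square is
    \<open>gg 1 1 u * dg u\<close>.\<close>
  let ?X = "vector [- gg 1 2 u, gg 1 1 u] :: real^2"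
  have "?X \<noteq> 0" using gg11_pos[OF assms] by (auto simp: vec_eq_iff forall_2)
  from pos[OF assms this] have "gg 1 1 u * dg u > 0"
    unfolding metric_expand[OF assms] dg_def by (simp add: algebra_simps)
  then show ?thesis using gg11_pos[OF assms] by (simp add: zero_less_mult_iff)
qed

lemma dg_nz: "u \<in> W \<Longrightarrow> dg u \<noteq> 0" using dg_pos by force

lemma smooth_dg: "smooth_on dg W"
  unfolding dg_def[abs_def] by (intro smooth_ops smooth_gg)

lemma smooth_up: "smooth_on f W \<Longrightarrow> smooth_on g W \<Longrightarrow> smooth_on (\<lambda>w. up k w (f w) (g w)) W"
  unfolding up_def by (cases "k = 1") (auto intro!: smooth_ops smooth_gg smooth_dg dg_nz)

lemma det_gmat: "det (gmat s w) = dg w"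
  by (simp add: det_2 gmat_def metric_ee dg_def gg_sym)

lemma ginv_comp:
  assumes "u \<in> W"
  shows "ginv s u $ 1 $ 1 = gg 2 2 u / dg u" "ginv s u $ 1 $ 2 = - gg 1 2 u / dg u"
    "ginv s u $ 2 $ 1 = - gg 1 2 u / dg u" "ginv s u $ 2 $ 2 = gg 1 1 u / dg u"
proof -
  have "gmat s u $ 2 $ 1 = gmat s u $ 1 $ 2" "det (gmat s u) \<noteq> 0"
    using dg_nz[OF assms] by (simp_all add: det_gmat) (simp add: gmat_def metric_ee gg_sym)
  note m = matrix_inv_2[OF this]
  show "ginv s u $ 1 $ 1 = gg 2 2 u / dg u" "ginv s u $ 1 $ 2 = - gg 1 2 u / dg u"
    "ginv s u $ 2 $ 1 = - gg 1 2 u / dg u" "ginv s u $ 2 $ 2 = gg 1 1 u / dg u"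
    unfolding ginv_def m det_gmat by (simp_all add: gmat_def metric_ee)
qed

lemma up_lower:
  assumes "u \<in> W"
  shows "up 1 u a b * gg 1 1 u + up 2 u a b * gg 1 2 u = a"
    "up 1 u a b * gg 1 2 u + up 2 u a b * gg 2 2 u = b"
proof -
  show "up 1 u a b * gg 1 1 u + up 2 u a b * gg 1 2 u = a"
    "up 1 u a b * gg 1 2 u + up 2 u a b * gg 2 2 u = b"
    using dg_nz[OF assms] by (simp_all add: up_def field_simps) (simp_all add: dg_def algebra_simps)
qed

lemma up_of_lower:
  assumes "u \<in> W"
  shows "up 1 u (a * gg 1 1 u + b * gg 1 2 u) (a * gg 1 2 u + b * gg 2 2 u) = a"
    "up 2 u (a * gg 1 1 u + b * gg 1 2 u) (a * gg 1 2 u + b * gg 2 2 u) = b"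
  using dg_nz[OF assms] by (simp_all add: up_def field_simps) (simp_all add: dg_def algebra_simps)

lemma up_linear: "up k w (a + a') (b + b') = up k w a b + up k w a' b'"
  "up k w (c * a) (c * b) = c * up k w a b" "up k w 0 0 = 0"
  "up k w (- a) (- b) = - up k w a b" "up k w (a - a') (b - b') = up k w a b - up k w a' b'"
  by (simp_all add: up_def algebra_simps add_divide_distrib diff_divide_distrib)

lemma smooth_S: "smooth_on (S i) W" by (intro smooth_ops)

lemma dS_sym: "u \<in> W \<Longrightarrow> dird (ee i) (S j) u = dird (ee j) (S i) u"
  using mixed_derivatives[OF W _ smooth_s] .

text \<open>The derivative of the relation \<open>lor (S j) s = 0\<close>. It is the reason why the
  \<open>z\<close> component of the second derivatives of \<open>s\<close> is the metric.\<close>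

lemma dS_s:
  assumes "u \<in> W" shows "lor (dird (ee i) (S j) u) (s u) = - gg i j u"
proof -
  have "dird (ee i) (\<lambda>w. lor (S j w) (s w)) u = 0"
    by (rule dird_const_on[OF assms]) (simp add: perp_s lor_sym[of "S j _"])
  then show ?thesis
    using dird_lor[OF diffI[OF smooth_S[of j] assms] diffI[OF smooth_s assms], of "ee i"] 
    by (simp add: gg_def lor_sym[of "S i u"])
qed

end

section \<open>Orthogonal projection onto a congruence\<close>

text \<open>A congruence enters the local computations through such a frame, since
  \<open>lproj\<close> is a definite description and carries no smoothness by itself.\<close>

locale adapted_frame = null_immersion W s
  for W and s :: "real^2 \<Rightarrow> ('m::finite) lorentz" +
  fixes z :: "real^2 \<Rightarrow> 'm lorentz" and V :: "real^2 \<Rightarrow> 'm lorentz set"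
  assumes smooth_z: "smooth_on z W"
    and null_z: "\<And>w. w \<in> W \<Longrightarrow> lor (z w) (z w) = 0"
    and sz: "\<And>w. w \<in> W \<Longrightarrow> lor (s w) (z w) = - 1"
    and perp_z: "\<And>w i. w \<in> W \<Longrightarrow> lor (z w) (dird (ee i) s w) = 0"
    and V_span: "\<And>w. w \<in> W \<Longrightarrow> V w = span {s w, dird (ee 1) s w, dird (ee 2) s w, z w}"
begin

lemmas smooth_intros = smooth_ops smooth_z

text \<open>The projection expanded in the frame; \<open>s\<close> and \<open>z\<close> appear
  crosswise and with a minus sign because they are null with product -1.\<close>

definition PV :: "real^2 \<Rightarrow> 'm lorentz \<Rightarrow> 'm lorentz" where
  "PV w v = up 1 w (lor v (S 1 w)) (lor v (S 2 w)) *\<^sub>R S 1 w + up 2 w (lor v (S 1 w)) (lor v (S 2 w)) *\<^sub>R S 2 w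
     - lor v (z w) *\<^sub>R s w - lor v (s w) *\<^sub>R z w"

lemma frame_lor:
  assumes "u \<in> W"
  shows "lor (s u) (s u) = 0" "lor (z u) (z u) = 0" "lor (s u) (z u) = -1" "lor (z u) (s u) = -1"
    "lor (s u) (S i u) = 0" "lor (S i u) (s u) = 0" "lor (z u) (S i u) = 0" "lor (S i u) (z u) = 0"
    "lor (S i u) (S j u) = gg i j u"
  using null_s[OF assms] null_z[OF assms] sz[OF assms] perp_s[OF assms] perp_z[OF assms]
    lor_sym[of "z u" "s u"] lor_sym[of "S i u" "s u"] lor_sym[of "S i u" "z u"] by (simp_all add: gg_def)

lemma linear_PV: "linear (PV w)"
  by (rule linearI) (simp_all add: PV_def lor_simps up_linear algebra_simps)

lemmas PV_lin = linear_add[OF linear_PV] linear_diff[OF linear_PV] linear_scale[OF linear_PV]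
  linear_neg[OF linear_PV] linear_0[OF linear_PV]

lemma lor_PV_frame:
  assumes "u \<in> W"
  shows "lor (PV u v) (s u) = lor v (s u)" "lor (PV u v) (z u) = lor v (z u)" "lor (PV u v) (S i u) = lor v (S i u)"
proof -
  show "lor (PV u v) (s u) = lor v (s u)" "lor (PV u v) (z u) = lor v (z u)"
    by (simp_all add: PV_def lor_simps frame_lor[OF assms])
  show "lor (PV u v) (S i u) = lor v (S i u)"
    using exhaust_2[of i] by (auto simp: PV_def lor_simps frame_lor[OF assms] gg_sym up_lower[OF assms])
qed

lemma PV_frame:
  assumes "u \<in> W" shows "PV u (s u) = s u" "PV u (z u) = z u" "PV u (S i u) = S i u"
proof -
  show "PV u (s u) = s u" "PV u (z u) = z u"
    by (simp_all add: PV_def frame_lor[OF assms] up_linear)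
  show "PV u (S i u) = S i u"
    using exhaust_2[of i] up_of_lower[OF assms, of 1 0] up_of_lower[OF assms, of 0 1]
    by (auto simp: PV_def frame_lor[OF assms] gg_sym)
qed

lemma PV_self_adjoint: "lor (PV u v) x = lor v (PV u x)"
  by (simp add: PV_def lor_simps lor_sym[of _ x] up_def diff_divide_distrib algebra_simps)

lemma PV_idem:
  assumes "u \<in> W" shows "PV u (PV u v) = PV u v"
  by (subst (2) PV_def) (simp add: PV_lin PV_frame[OF assms], simp add: PV_def)

lemma in_V_iff:
  assumes "u \<in> W" shows "v \<in> V u \<longleftrightarrow> PV u v = v"
proof
  assume "v \<in> V u"
  then obtain p q r t where "v = p *\<^sub>R s u + q *\<^sub>R S 1 u + r *\<^sub>R S 2 u + t *\<^sub>R z u"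
    unfolding V_span[OF assms] in_span4 by blast
  then show "PV u v = v"
    by (simp add: PV_lin PV_frame[OF assms])
next
  assume "PV u v = v"
  moreover have "PV u v = (- lor v (z u)) *\<^sub>R s u + up 1 u (lor v (S 1 u)) (lor v (S 2 u)) *\<^sub>R S 1 u
    + up 2 u (lor v (S 1 u)) (lor v (S 2 u)) *\<^sub>R S 2 u + (- lor v (s u)) *\<^sub>R z u"
    by (simp add: PV_def)
  ultimately show "v \<in> V u" unfolding V_span[OF assms] in_span4 by metis
qed

lemma in_lperp_iff:
  assumes "u \<in> W" shows "v \<in> lperp (V u) \<longleftrightarrow> PV u v = 0"
proof
  assume "v \<in> lperp (V u)"
  then have "lor v x = 0" if "PV u x = x" for x
    using that by (simp add: lperp_def in_V_iff[OF assms])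
  then show "PV u v = 0" using PV_self_adjoint PV_idem[OF assms]
    by (intro lor_eqI) (simp add: lor_simps)
next
  assume "PV u v = 0"
  then show "v \<in> lperp (V u)"
    unfolding lperp_def by (auto simp: in_V_iff[OF assms]) (metis PV_self_adjoint lor_zero_left)
qed

lemma perp_frame_iff:
  assumes "u \<in> W"
  shows "PV u v = 0 \<longleftrightarrow> lor v (s u) = 0 \<and> lor v (z u) = 0 \<and> lor v (S 1 u) = 0 \<and> lor v (S 2 u) = 0"
proof
  assume "PV u v = 0"
  then show "lor v (s u) = 0 \<and> lor v (z u) = 0 \<and> lor v (S 1 u) = 0 \<and> lor v (S 2 u) = 0"
    using lor_PV_frame[OF assms, of v] by (simp add: lor_zero_left)
qed (simp add: PV_def up_linear)

lemma lproj_V: assumes "u \<in> W" shows "lproj (V u) v = PV u v"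
proof (rule lproj_eqI)
  show "subspace (V u)" by (simp add: V_span[OF assms])
qed (simp_all add: in_V_iff in_lperp_iff assms PV_idem PV_lin)

lemma lproj_perp: assumes "u \<in> W" shows "lproj (lperp (V u)) v = v - PV u v"
proof (rule lproj_eqI)
  show "v - PV u v \<in> lperp (V u)"
    by (simp_all add: in_lperp_iff assms PV_idem PV_lin)
  show "v - (v - PV u v) \<in> lperp (lperp (V u))"
    by (auto simp: lperp_def[of "lperp _"] in_lperp_iff[OF assms] PV_self_adjoint lor_zero_right)
  show "x = 0" if x: "x \<in> lperp (V u)" "x \<in> lperp (lperp (V u))" for x
  proof (rule lor_eqI)
    fix y
    have "y - PV u y \<in> lperp (V u)"
      by (simp_all add: in_lperp_iff assms PV_idem PV_lin)
    then have "lor x (y - PV u y) = 0" using x(2) by (simp add: lperp_def[of "lperp _"])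
    moreover have "lor x (PV u y) = 0"
      using x(1) by (simp add: in_lperp_iff[OF assms] PV_self_adjoint[symmetric] lor_zero_left)
    ultimately show "lor x y = lor 0 y" by (simp add: lor_simps)
  qed
qed (rule subspace_lperp)

lemma smooth_PV: "smooth_on (\<lambda>w. PV w v) W"
  unfolding PV_def by (intro smooth_intros smooth_up)

section \<open>The derivative of the projection and the form \<N>\<close>

definition DP :: "real^2 \<Rightarrow> real^2 \<Rightarrow> 'm lorentz \<Rightarrow> 'm lorentz" where
  "DP X u v = dird X (\<lambda>w. PV w v) u"

lemma dird_PV:
  assumes "u \<in> W" "f differentiable (at u)"
  shows "dird X (\<lambda>w. PV w (f w)) u = DP X u (f u) + PV u (dird X f u)"
    "(\<lambda>w. PV w (f w)) differentiable (at u)" "linear (DP X u)"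
  using dird_apply[OF W assms(1) linear_PV diffI[OF smooth_PV assms(1)] assms(2)]
  by (simp_all add: DP_def[abs_def])

text \<open>The derivative of P P = P. It says that dP interchanges \<open>V\<close> and its
  complement, and it serves to move \<open>PV\<close> past \<open>DP\<close>.\<close>

lemma DP_idem:
  assumes "u \<in> W" shows "DP X u v = DP X u (PV u v) + PV u (DP X u v)"
proof -
  have "DP X u v = dird X (\<lambda>w. PV w (PV w v)) u"
    unfolding DP_def by (rule dird_cong[OF W assms]) (simp add: PV_idem)
  then show ?thesis
    using dird_PV(1)[OF assms diffI[OF smooth_PV assms], of X v] by (simp add: DP_def)
qed

lemma PV_DP_PV: assumes "u \<in> W" shows "PV u (DP X u (PV u v)) = 0"
  using DP_idem[OF assms, of X "PV u v"]
  by (simp add: PV_idem[OF assms])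

text \<open>Projecting the derivatives of P f and (1 - P) f and adding gives d - (dP - 2 P dP), so
  the correction term is \<N>. The nested definite descriptions in \<open>split_conn\<close> are
  thereby replaced by a differentiable expression.\<close>

lemma split_conn_eq:
  assumes u: "u \<in> W" and f: "f differentiable (at u)"
  shows "split_conn V X f u = dird X f u - (DP X u (f u) - 2 *\<^sub>R PV u (DP X u (f u)))"
proof -
  have "dird X (\<lambda>w. lproj (V w) (f w)) u = dird X (\<lambda>w. PV w (f w)) u"
    by (rule dird_cong[OF W u]) (simp add: lproj_V)
  moreover have "dird X (\<lambda>w. lproj (lperp (V w)) (f w)) u = dird X (\<lambda>w. f w - PV w (f w)) u"
    by (rule dird_cong[OF W u]) (simp add: lproj_perp)
  ultimately show ?thesis
    unfolding split_conn_def ind_conn_def comp_def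
    by (simp add: dird_diff[OF f dird_PV(2)[OF u f]] lproj_V[OF u] lproj_perp[OF u] dird_PV(1)[OF u f]
      PV_lin PV_idem[OF u] scaleR_2)
qed

lemma NV_eq: "u \<in> W \<Longrightarrow> NV V u X v = DP X u v - 2 *\<^sub>R PV u (DP X u v)"
  unfolding NV_def by (simp add: split_conn_eq)

lemma split_conn_NV:
  "u \<in> W \<Longrightarrow> f differentiable (at u) \<Longrightarrow> split_conn V X f u = dird X f u - NV V u X (f u)"
  by (simp add: split_conn_eq NV_eq)

lemma linear_NV: "u \<in> W \<Longrightarrow> linear (NV V u X)"
  using linear_PV[of u] dird_PV(3)[of u "\<lambda>_. 0" X]
  by (intro linearI) (simp_all add: NV_eq linear_add linear_scale algebra_simps)

lemma NV_expand: "u \<in> W \<Longrightarrow> NV V u X v = (X $ 1) *\<^sub>R NV V u (ee 1) v + (X $ 2) *\<^sub>R NV V u (ee 2) v"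
  unfolding NV_eq DP_def by (subst (1 2) dird_expand[OF diffI[OF smooth_PV]])
    (simp_all add: PV_lin algebra_simps)

text \<open>For a section of \<open>V\<close> differentiating P f = f gives dP f = (1 - P) df. So
  \<N>, although defined on constant sections, takes the normal part of the derivative.\<close>

lemma NV_V_section:
  assumes u: "u \<in> W" and f: "f differentiable (at u)" and "\<And>w. w \<in> W \<Longrightarrow> PV w (f w) = f w"
  shows "NV V u X (f u) = dird X f u - PV u (dird X f u)"
proof -
  have "dird X f u = DP X u (f u) + PV u (dird X f u)"
    using dird_cong[OF W u, where f = "\<lambda>w. PV w (f w)" and g = f and X = X] assms(3) dird_PV(1)[OF u f, of X] by simp
  then have "DP X u (f u) = dird X f u - PV u (dird X f u)" by (simp add: algebra_simps)
  then show ?thesis by (simp add: NV_eq[OF u] PV_lin PV_idem[OF u])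
qed

lemma NV_perp_section:
  assumes u: "u \<in> W" and f: "f differentiable (at u)" and "\<And>w. w \<in> W \<Longrightarrow> PV w (f w) = 0"
  shows "NV V u X (f u) = PV u (dird X f u)"
proof -
  have "0 = DP X u (f u) + PV u (dird X f u)"
    using dird_const_on[where X = X, OF u assms(3)] dird_PV(1)[OF u f, of X] by simp
  then have "DP X u (f u) = - PV u (dird X f u)" by (simp add: eq_neg_iff_add_eq_0)
  then show ?thesis by (simp add: NV_eq[OF u] PV_lin PV_idem[OF u] scaleR_2)
qed

lemma NV_maps:
  assumes u: "u \<in> W"
  shows "PV u v = v \<Longrightarrow> PV u (NV V u X v) = 0" "PV u v = 0 \<Longrightarrow> PV u (NV V u X v) = NV V u X v"
proof -
  assume "PV u v = v"
  then show "PV u (NV V u X v) = 0"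
    using PV_DP_PV[OF u, of X v] by (simp add: NV_eq[OF u] PV_lin PV_idem[OF u] PV_lin)
next
  assume v: "PV u v = 0"
  have "PV u (DP X u v) = DP X u v"
    using DP_idem[OF u, of X v] by (simp add: v linear_0[OF dird_PV(3)[OF u differentiable_const]])
  then show "PV u (NV V u X v) = NV V u X v"
    by (simp add: NV_eq[OF u] PV_lin PV_idem[OF u])
qed

text \<open>By \<open>DP_idem\<close>, \<N> is the commutator dP P - P dP of two self-adjoint
  maps.\<close>

lemma NV_skew:
  assumes u: "u \<in> W" shows "lor (NV V u X v) x + lor v (NV V u X x) = 0"
proof -
  have DPs: "lor (DP X u v) x = lor v (DP X u x)" for v x
  proof -
    have "dird X (\<lambda>w. lor (PV w v) x) u = dird X (\<lambda>w. lor v (PV w x)) u"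
      by (simp only: PV_self_adjoint)
    then show ?thesis
      using dird_lor[OF diffI[OF smooth_PV u] differentiable_const, of X v x]
        dird_lor[OF differentiable_const diffI[OF smooth_PV u], of X v x] by (simp add: DP_def lor_simps)
  qed
  have "lor (PV u (DP X u v)) x = lor v (DP X u x) - lor v (PV u (DP X u x))"
  proof -
    have "lor (PV u (DP X u v)) x = lor v (DP X u (PV u x))" by (simp add: PV_self_adjoint DPs)
    also have "DP X u (PV u x) = DP X u x - PV u (DP X u x)" using DP_idem[OF u, of X x] by (simp add: algebra_simps)
    finally show ?thesis by (simp add: lor_simps)
  qed
  then show ?thesis by (simp add: NV_eq[OF u] lor_simps DPs)
qed

lemma smooth_NV: "smooth_on (\<lambda>w. NV V w X v) W"
proof (rule smooth_on_cong[OF W])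
  have d: "smooth_on (\<lambda>w. DP X w v) W" unfolding DP_def[abs_def] by (intro smooth_on_dird[OF W] smooth_PV)
  show "smooth_on (\<lambda>w. DP X w v - 2 *\<^sub>R PV w (DP X w v)) W"
    unfolding PV_def by (intro smooth_intros smooth_up d)
qed (simp add: NV_eq)

text \<open>With \<open>R = 2P - 1\<close>, the reflection in \<open>V\<close>, one has \<open>\<N> = - R dR / 2\<close> and \<open>R dR = - dR R\<close>; this gives
  \<open>d\<N> = [\<N> \<and> \<N>]\<close>, which says that \<open>\<N>\<close> is closed for \<open>d - \<N>\<close>.\<close>

lemma dNV:
  assumes u: "u \<in> W" and XY: "X = ee i" "Y = ee j"
  shows "dird X (\<lambda>w. NV V w Y v) u - dird Y (\<lambda>w. NV V w X v) u
    = 2 *\<^sub>R (NV V u X (NV V u Y v) - NV V u Y (NV V u X v))"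
proof -
  have ld: "linear (DP X u)" for X using dird_PV(3)[OF u differentiable_const] .
  have sd: "smooth_on (\<lambda>w. DP X w v) W" for X v
    unfolding DP_def[abs_def] by (intro smooth_on_dird[OF W] smooth_PV)
  have D: "dird X (\<lambda>w. NV V w Y v) u = dird X (\<lambda>w. DP Y w v) u - 2 *\<^sub>R (DP X u (DP Y u v) + PV u (dird X (\<lambda>w. DP Y w v) u))" for X Y
  proof -
    have "dird X (\<lambda>w. NV V w Y v) u = dird X (\<lambda>w. DP Y w v - 2 *\<^sub>R PV w (DP Y w v)) u"
      by (rule dird_cong[OF W u]) (simp add: NV_eq)
    also have "\<dots> = dird X (\<lambda>w. DP Y w v) u - 2 *\<^sub>R (DP X u (DP Y u v) + PV u (dird X (\<lambda>w. DP Y w v) u))"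
      by (simp add: dird_diff dird_scaleR_const differentiable_scaleR diffI[OF sd u] dird_PV[OF u diffI[OF sd u]])
    finally show ?thesis .
  qed
  have sym: "dird X (\<lambda>w. DP Y w v) u = dird Y (\<lambda>w. DP X w v) u"
    unfolding DP_def XY using mixed_derivatives[OF W u smooth_PV] .
  have NN: "NV V u X (NV V u Y v) = - DP X u (DP Y u v)" for X Y
  proof -
    have c: "DP X u (v - 2 *\<^sub>R PV u v) = - (DP X u v - 2 *\<^sub>R PV u (DP X u v))" for v
    proof -
      have "DP X u (v - 2 *\<^sub>R PV u v) = DP X u v - 2 *\<^sub>R DP X u (PV u v)"
        by (simp add: linear_diff[OF ld] linear_scale[OF ld])
      also have "DP X u (PV u v) = DP X u v - PV u (DP X u v)" using DP_idem[OF u, of X v] by (simp add: algebra_simps)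
      finally show ?thesis by (simp add: scaleR_2 algebra_simps)
    qed
    show ?thesis unfolding NV_eq[OF u] c
      by (simp add: PV_lin PV_idem[OF u] algebra_simps scaleR_2)
  qed
  show ?thesis unfolding D NN sym by (simp add: algebra_simps)
qed

end

section \<open>Structure and Codazzi equations\<close>

lemma dird_sqrt:
  assumes "f differentiable (at u)" "f u > 0"
  shows "dird X (\<lambda>w. sqrt (f w)) u = dird X f u / (2 * sqrt (f u))" "(\<lambda>w. sqrt (f w)) differentiable (at u)"
proof -
  have "((\<lambda>w. sqrt (f w)) has_derivative (\<lambda>X. dird X f u * (inverse (sqrt (f u)) / 2))) (at u)"
    using has_derivative_compose[OF has_derivative_dird[OF assms(1)]
        DERIV_real_sqrt[OF assms(2), unfolded has_field_derivative_def]]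
    by (simp add: mult.commute)
  then show "dird X (\<lambda>w. sqrt (f w)) u = dird X f u / (2 * sqrt (f u))" "(\<lambda>w. sqrt (f w)) differentiable (at u)"
    by (auto simp: dird_eq[of _ _ u] field_simps differentiable_def)
qed

text \<open>The trace commutes with covariant differentiation. Here \<open>e, f, g\<close> are the
  metric coefficients, \<open>a, b, c, d\<close> the Christoffel symbols of one direction, and
  \<open>x\<close>, \<open>y\<close> a symmetric form and its coordinate derivative. The first three
  premises are metric compatibility. The trace is scaled by the determinant, whose logarithmic
  derivative 2 (a + d) is the multiplier in the proof.\<close>

lemma trace_derivative:
  fixes e f g :: real
  assumes "e' = 2 * (a * e + b * f)" "f' = a * f + b * g + c * e + d * f" "g' = 2 * (c * f + d * g)"
    and "g * x11 - 2 * f * x12 + e * x22 = 0"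
    and "g' * x11 + g * y11 - 2 * (f' * x12 + f * y12) + e' * x22 + e * y22 = 0"
  shows "g * (y11 - 2 * (a * x11 + b * x12)) - 2 * f * (y12 - (a * x12 + b * x22) - (c * x11 + d * x12))
    + e * (y22 - 2 * (c * x12 + d * x22)) = 0"
proof -
  have "g * (y11 - 2 * (a * x11 + b * x12)) - 2 * f * (y12 - (a * x12 + b * x22) - (c * x11 + d * x12))
    + e * (y22 - 2 * (c * x12 + d * x22)) =
    (g' * x11 + g * y11 - 2 * (f' * x12 + f * y12) + e' * x22 + e * y22)
    - 2 * (a + d) * (g * x11 - 2 * f * x12 + e * x22)"
    unfolding assms(1-3) by (simp add: algebra_simps)
  then show ?thesis using assms(4,5) by simp
qed

context adapted_frame
begin

text \<open>The structure equations are \<open>\<partial>\<^sub>i s\<^sub>j = \<Gamma>\<^sup>k\<^sub>i\<^sub>j s\<^sub>k + g\<^sub>i\<^sub>j z - \<rho>\<^sub>i\<^sub>j s - II\<^sub>i\<^sub>j\<close> and \<open>\<partial>\<^sub>i z = - \<rho>\<^sub>i\<^sup>k s\<^sub>k + \<nu>\<^sub>i\<close>, and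
  \<open>BB\<close> is \<open>II\<close> in coordinates.  If \<open>II\<close> is tracefree, then \<open>\<nu> = - div II\<close> by the Codazzi equation and \<open>\<rho>\<close> is \<open>r\<^sub>0\<close>
  up to a trace.\<close>

definition \<rho> :: "2 \<Rightarrow> 2 \<Rightarrow> real^2 \<Rightarrow> real" where "\<rho> i j u = lor (dird (ee i) (S j) u) (z u)"
definition BB :: "2 \<Rightarrow> 2 \<Rightarrow> real^2 \<Rightarrow> 'm lorentz" where
  "BB i j u = PV u (dird (ee i) (S j) u) - dird (ee i) (S j) u"
definition \<nu> :: "2 \<Rightarrow> real^2 \<Rightarrow> 'm lorentz" where "\<nu> i u = dird (ee i) z u - PV u (dird (ee i) z u)"

abbreviation \<Gamma> :: "2 \<Rightarrow> 2 \<Rightarrow> 2 \<Rightarrow> real^2 \<Rightarrow> real" where "\<Gamma> k i j u \<equiv> christoffel s u k i j"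

abbreviation nab :: "'m lorentz connection" where "nab \<equiv> ind_conn (lperp \<circ> V)"

lemma nab_eq: "u \<in> W \<Longrightarrow> nab X f u = dird X f u - PV u (dird X f u)"
  by (simp add: ind_conn_def lproj_perp)

lemma dgg:
  assumes "u \<in> W"
  shows "dird (ee i) (gg j l) u = lor (dird (ee i) (S j) u) (S l u) + lor (dird (ee i) (S l) u) (S j u)"
proof -
  have "dird (ee i) (\<lambda>w. lor (S j w) (S l w)) u = lor (dird (ee i) (S j) u) (S l u) + lor (S j u) (dird (ee i) (S l) u)"
    by (rule dird_lor[OF diffI[OF smooth_S assms] diffI[OF smooth_S assms]])
  then show ?thesis by (simp add: gg_def[abs_def] lor_sym[of "S j u"])
qed

text \<open>The Koszul formula: for a metric induced from a constant bilinear form, its three terms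
  add up to twice the product of a second derivative of \<open>s\<close> with a first one.\<close>

lemma christoffel_eq:
  assumes u: "u \<in> W"
  shows "\<Gamma> k i j u = up k u (lor (dird (ee i) (S j) u) (S 1 u)) (lor (dird (ee i) (S j) u) (S 2 u))"
proof -
  have t: "dird (ee i) (\<lambda>w. metric s w (ee j) (ee l)) u + dird (ee j) (\<lambda>w. metric s w (ee i) (ee l)) u
      - dird (ee l) (\<lambda>w. metric s w (ee i) (ee j)) u = 2 * lor (dird (ee i) (S j) u) (S l u)" for l
    unfolding metric_ee using dgg[OF u] dS_sym[OF u, of l] dS_sym[OF u, of j i] by simp
  have "\<Gamma> k i j u = (\<Sum>l\<in>UNIV. ginv s u $ k $ l * lor (dird (ee i) (S j) u) (S l u))"
    unfolding christoffel_def t by (simp add: sum_2)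
  then show ?thesis
    using exhaust_2[of k] by (auto simp: sum_2 ginv_comp[OF u] up_def diff_divide_distrib)
qed

lemma \<Gamma>_sym: "u \<in> W \<Longrightarrow> \<Gamma> k i j u = \<Gamma> k j i u"
  by (simp add: christoffel_eq dS_sym[of u i])

lemma PV_dS:
  assumes u: "u \<in> W"
  shows "PV u (dird (ee i) (S j) u) = \<Gamma> 1 i j u *\<^sub>R S 1 u + \<Gamma> 2 i j u *\<^sub>R S 2 u + gg i j u *\<^sub>R z u - \<rho> i j u *\<^sub>R s u"
  unfolding PV_def christoffel_eq[OF u] dS_s[OF u] \<rho>_def by simp

lemma dS:
  "u \<in> W \<Longrightarrow> dird (ee i) (S j) u =
     \<Gamma> 1 i j u *\<^sub>R S 1 u + \<Gamma> 2 i j u *\<^sub>R S 2 u + gg i j u *\<^sub>R z u - \<rho> i j u *\<^sub>R s u - BB i j u"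
  unfolding BB_def PV_dS by (simp add: PV_dS)

lemma dS_S:
  assumes u: "u \<in> W"
  shows "lor (dird (ee i) (S j) u) (S l u) = \<Gamma> 1 i j u * gg 1 l u + \<Gamma> 2 i j u * gg 2 l u"
  using lor_PV_frame(3)[OF u, of "dird (ee i) (S j) u" l] unfolding PV_dS[OF u] by (simp add: lor_simps frame_lor[OF u])

lemma dgg_\<Gamma>:
  assumes u: "u \<in> W"
  shows "dird (ee i) (gg 1 1) u = 2 * (\<Gamma> 1 i 1 u * gg 1 1 u + \<Gamma> 2 i 1 u * gg 1 2 u)"
    "dird (ee i) (gg 1 2) u = \<Gamma> 1 i 1 u * gg 1 2 u + \<Gamma> 2 i 1 u * gg 2 2 u + \<Gamma> 1 i 2 u * gg 1 1 u + \<Gamma> 2 i 2 u * gg 1 2 u"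
    "dird (ee i) (gg 2 2) u = 2 * (\<Gamma> 1 i 2 u * gg 1 2 u + \<Gamma> 2 i 2 u * gg 2 2 u)"
  by (simp_all add: dgg[OF u] dS_S[OF u] gg_sym)

lemma ddg:
  assumes u: "u \<in> W" shows "dird (ee i) dg u = 2 * (\<Gamma> 1 i 1 u + \<Gamma> 2 i 2 u) * dg u"
proof -
  note d = diffI[OF smooth_gg u]
  have "dird (ee i) dg u = dird (ee i) (gg 1 1) u * gg 2 2 u + gg 1 1 u * dird (ee i) (gg 2 2) u
      - 2 * gg 1 2 u * dird (ee i) (gg 1 2) u"
    unfolding dg_def[abs_def] by (simp add: dird_diff dird_mult d)
  then show ?thesis unfolding dgg_\<Gamma>[OF u] by (simp add: dg_def algebra_simps)
qed

lemma \<rho>_sym: "u \<in> W \<Longrightarrow> \<rho> i j u = \<rho> j i u"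
  by (simp add: \<rho>_def dS_sym[of u i])

lemma BB_sym: "u \<in> W \<Longrightarrow> BB i j u = BB j i u"
  by (simp add: BB_def dS_sym[of u i])

lemma PV_BB: "u \<in> W \<Longrightarrow> PV u (BB i j u) = 0"
  by (simp add: BB_def PV_lin PV_idem)

lemma PV_\<nu>: "u \<in> W \<Longrightarrow> PV u (\<nu> i u) = 0"
  by (simp add: \<nu>_def PV_lin PV_idem)

lemma PV_dz:
  assumes u: "u \<in> W"
  shows "PV u (dird (ee i) z u) = - (up 1 u (\<rho> i 1 u) (\<rho> i 2 u) *\<^sub>R S 1 u) - up 2 u (\<rho> i 1 u) (\<rho> i 2 u) *\<^sub>R S 2 u"
proof -
  note dz = diffI[OF smooth_z u] and ds = diffI[OF smooth_s u] and dS = diffI[OF smooth_S u]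
  have "dird (ee i) (\<lambda>w. lor (z w) (z w)) u = 0"
    by (rule dird_const_on[OF u null_z])
  then have 1: "lor (dird (ee i) z u) (z u) = 0"
    using dird_lor[OF dz dz, of "ee i"] by (simp add: lor_sym)
  have "dird (ee i) (\<lambda>w. lor (z w) (s w)) u = 0"
    by (rule dird_const_on[OF u]) (simp add: frame_lor)
  then have 2: "lor (dird (ee i) z u) (s u) = 0"
    using dird_lor[OF dz ds, of "ee i"] by (simp add: frame_lor[OF u])
  have 3: "lor (dird (ee i) z u) (S j u) = - \<rho> i j u" for j
  proof -
    have "dird (ee i) (\<lambda>w. lor (z w) (S j w)) u = 0"
      by (rule dird_const_on[OF u]) (simp add: frame_lor)
    then show ?thesis
      using dird_lor[OF dz dS[of j], of "ee i"] by (simp add: \<rho>_def lor_sym[of "z u"])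
  qed
  show ?thesis unfolding PV_def 1 2 3 by (simp add: up_linear)
qed

lemma NV_frame:
  assumes u: "u \<in> W"
  shows "NV V u (ee i) (s u) = 0" "NV V u (ee i) (S j u) = - BB i j u" "NV V u (ee i) (z u) = \<nu> i u"
  using NV_V_section[OF u diffI[OF smooth_s u], of "ee i"] NV_V_section[OF u diffI[OF smooth_S[of j] u], of "ee i"]
    NV_V_section[OF u diffI[OF smooth_z u], of "ee i"]
  by (simp_all add: PV_frame BB_def \<nu>_def u)

lemma II_ee: "u \<in> W \<Longrightarrow> II V s u (ee i) (ee j) = BB i j u"
  by (simp add: II_def NV_frame)

lemma smooth_BB: "smooth_on (BB i j) W"
  unfolding BB_def[abs_def] PV_def by (intro smooth_intros smooth_up smooth_S)

lemma smooth_\<nu>: "smooth_on (\<nu> i) W"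
  unfolding \<nu>_def[abs_def] PV_def by (intro smooth_intros smooth_up smooth_S)

section \<open>The Codazzi equation\<close>

text \<open>The bracket contains the third derivatives of \<open>s\<close> and is symmetric in
  \<open>i\<close> and \<open>j\<close>. The other terms are \<N> applied to the \<open>V\<close>
  part of the second derivative, so they alone survive skew-symmetrization.\<close>

lemma nab_BB:
  assumes u: "u \<in> W"
  shows "nab (ee i) (BB j k) u = (PV u (dird (ee i) (dird (ee j) (S k)) u) - dird (ee i) (dird (ee j) (S k)) u)
    + gg j k u *\<^sub>R \<nu> i u - \<Gamma> 1 j k u *\<^sub>R BB i 1 u - \<Gamma> 2 j k u *\<^sub>R BB i 2 u"
proof -
  let ?T = "dird (ee j) (S k)"
  have sT: "smooth_on ?T W" by (intro smooth_intros smooth_S)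
  have E: "dird (ee i) (BB j k) u = DP (ee i) u (?T u) + PV u (dird (ee i) ?T u) - dird (ee i) ?T u"
    unfolding BB_def[abs_def] using dird_PV[OF u diffI[OF sT u]] diffI[OF sT u] by (simp add: dird_diff)
  have "nab (ee i) (BB j k) u = (DP (ee i) u (?T u) - PV u (DP (ee i) u (?T u)))
      + (PV u (dird (ee i) ?T u) - dird (ee i) ?T u)"
    unfolding nab_eq[OF u] E by (simp add: PV_lin PV_idem[OF u])
  moreover have "DP (ee i) u (?T u) - PV u (DP (ee i) u (?T u)) = NV V u (ee i) (PV u (?T u))"
    using DP_idem[OF u, of "ee i" "?T u"] PV_DP_PV[OF u, of "ee i" "?T u"] by (simp add: NV_eq[OF u]) (metis add_diff_cancel_right')
  moreover have "\<dots> = gg j k u *\<^sub>R \<nu> i u - \<Gamma> 1 j k u *\<^sub>R BB i 1 u - \<Gamma> 2 j k u *\<^sub>R BB i 2 u"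
    unfolding PV_dS[OF u] using linear_NV[OF u, of "ee i"]
    by (simp add: linear_add linear_diff linear_scale NV_frame[OF u])
  ultimately show ?thesis by simp
qed

definition cB :: "2 \<Rightarrow> 2 \<Rightarrow> 2 \<Rightarrow> real^2 \<Rightarrow> 'm lorentz" where
  "cB k i j u = cov2 s nab (II V s) u k i j"

lemma cB_eq:
  assumes u: "u \<in> W"
  shows "cB k i j u = nab (ee k) (BB i j) u
    - (\<Gamma> 1 k i u *\<^sub>R BB 1 j u + \<Gamma> 2 k i u *\<^sub>R BB 2 j u) - (\<Gamma> 1 k j u *\<^sub>R BB i 1 u + \<Gamma> 2 k j u *\<^sub>R BB i 2 u)"
proof -
  have "nab (ee k) (\<lambda>w. II V s w (ee i) (ee j)) u = nab (ee k) (BB i j) u"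
    unfolding ind_conn_def using dird_cong[OF W u, of "\<lambda>w. II V s w (ee i) (ee j)" "BB i j"] by (simp add: II_ee)
  then show ?thesis by (simp add: cB_def cov2_def sum_2 II_ee[OF u])
qed

lemma nab_BB_sym: "u \<in> W \<Longrightarrow> nab X (BB i j) u = nab X (BB j i) u"
  unfolding ind_conn_def using dird_cong[where X = X and f = "BB i j" and g = "BB j i", OF W _ BB_sym] by simp

lemma cB_sym: "u \<in> W \<Longrightarrow> cB k i j u = cB k j i u"
  by (simp add: cB_eq nab_BB_sym[of u _ i j] BB_sym[of u _ i] BB_sym[of u _ j])

text \<open>Third derivatives of \<open>s\<close> commute, and the Christoffel terms of the two
  covariant derivatives cancel. The right-hand side comes from the \<open>z\<close> component
  \<open>gg j k\<close> of the second derivatives, on which \<N> takes the value \<nu>.\<close>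

lemma codazzi:
  assumes u: "u \<in> W"
  shows "cB 1 2 k u - cB 2 1 k u = gg 2 k u *\<^sub>R \<nu> 1 u - gg 1 k u *\<^sub>R \<nu> 2 u"
proof -
  have "dird (ee 1) (dird (ee 2) (S k)) u = dird (ee 2) (dird (ee 1) (S k)) u"
    by (rule mixed_derivatives[OF W u smooth_S])
  then show ?thesis unfolding cB_eq[OF u] nab_BB[OF u]
    by (simp add: \<Gamma>_sym[OF u, of _ 2 1])
qed

section \<open>The Hodge star in coordinates\<close>

text \<open>The metric divided by its volume density: the representative of determinant one, which
  depends only on the conformal class and whose entries are, up to sign, the matrix of the Hodge
  star.\<close>

definition hh :: "2 \<Rightarrow> 2 \<Rightarrow> real^2 \<Rightarrow> real" where "hh i j w = gg i j w / sqrt (dg w)"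

lemma hh_det: "u \<in> W \<Longrightarrow> hh 1 1 u * hh 2 2 u - hh 1 2 u * hh 1 2 u = 1"
  using dg_pos[of u] by (simp add: hh_def field_simps) (simp add: dg_def)

lemma hodge_ee:
  assumes u: "u \<in> W"
  shows "hodge s u \<alpha> (ee 1) = hh 1 2 u *\<^sub>R \<alpha> (ee 1) - hh 1 1 u *\<^sub>R \<alpha> (ee 2)"
    "hodge s u \<alpha> (ee 2) = hh 2 2 u *\<^sub>R \<alpha> (ee 1) - hh 1 2 u *\<^sub>R \<alpha> (ee 2)"
    "hodge s u \<alpha> X = (X $ 1) *\<^sub>R hodge s u \<alpha> (ee 1) + (X $ 2) *\<^sub>R hodge s u \<alpha> (ee 2)"
proof -
  have r: "sqrt (dg u) / dg u = 1 / sqrt (dg u)" 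
    using dg_pos[OF u] by (simp add: field_simps)
  have r': "x * sqrt (dg u) / dg u = x / sqrt (dg u)" for x
    using r by (metis times_divide_eq_right mult.right_neutral)
  show "hodge s u \<alpha> (ee 1) = hh 1 2 u *\<^sub>R \<alpha> (ee 1) - hh 1 1 u *\<^sub>R \<alpha> (ee 2)"
    "hodge s u \<alpha> (ee 2) = hh 2 2 u *\<^sub>R \<alpha> (ee 1) - hh 1 2 u *\<^sub>R \<alpha> (ee 2)"
    by (simp_all add: hodge_def sum_2 vol_def det_gmat ginv_comp[OF u] axis_def hh_def r')
  show "hodge s u \<alpha> X = (X $ 1) *\<^sub>R hodge s u \<alpha> (ee 1) + (X $ 2) *\<^sub>R hodge s u \<alpha> (ee 2)"
    by (simp add: hodge_def sum_2 vol_def axis_def algebra_simps)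
qed

lemma diff_hh: "u \<in> W \<Longrightarrow> hh i j differentiable (at u)"
  unfolding hh_def[abs_def] using dird_sqrt(2)[OF diffI[OF smooth_dg]] dg_pos[of u] diffI[OF smooth_gg]
  by (intro differentiable_divide) auto

text \<open>Metric compatibility with the derivative of the volume density subtracted: half the
  logarithmic derivative of \<open>dg\<close> is
  \<open>\<Gamma> 1 i 1 + \<Gamma> 2 i 2\<close>.\<close>

lemma dhh:
  assumes u: "u \<in> W"
  shows "dird (ee i) (hh 1 1) u = (\<Gamma> 1 i 1 u - \<Gamma> 2 i 2 u) * hh 1 1 u + 2 * \<Gamma> 2 i 1 u * hh 1 2 u"
    "dird (ee i) (hh 1 2) u = \<Gamma> 2 i 1 u * hh 2 2 u + \<Gamma> 1 i 2 u * hh 1 1 u"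
    "dird (ee i) (hh 2 2) u = (\<Gamma> 2 i 2 u - \<Gamma> 1 i 1 u) * hh 2 2 u + 2 * \<Gamma> 1 i 2 u * hh 1 2 u"
proof -
  note p = dg_pos[OF u]
  note ds = dird_sqrt[OF diffI[OF smooth_dg u] p]
  have r: "dird (ee i) (\<lambda>w. inverse (sqrt (dg w))) u = - (\<Gamma> 1 i 1 u + \<Gamma> 2 i 2 u) / sqrt (dg u)"
    using p by (subst dird_inverse[OF ds(2)]) (auto simp: ds(1) ddg[OF u] field_simps)
  have "(\<lambda>w. inverse (sqrt (dg w))) differentiable (at u)"
    using p by (intro differentiable_inverse ds(2)) simp
  then have h: "dird (ee i) (hh j k) u = dird (ee i) (gg j k) u / sqrt (dg u) - gg j k u * (\<Gamma> 1 i 1 u + \<Gamma> 2 i 2 u) / sqrt (dg u)" for j k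
    unfolding hh_def[abs_def] divide_inverse by (subst dird_mult) (simp_all add: r diffI[OF smooth_gg u], simp_all add: divide_inverse algebra_simps)
  show "dird (ee i) (hh 1 1) u = (\<Gamma> 1 i 1 u - \<Gamma> 2 i 2 u) * hh 1 1 u + 2 * \<Gamma> 2 i 1 u * hh 1 2 u"
    "dird (ee i) (hh 1 2) u = \<Gamma> 2 i 1 u * hh 2 2 u + \<Gamma> 1 i 2 u * hh 1 1 u"
    "dird (ee i) (hh 2 2) u = (\<Gamma> 2 i 2 u - \<Gamma> 1 i 1 u) * hh 2 2 u + 2 * \<Gamma> 1 i 2 u * hh 1 2 u"
    unfolding h dgg_\<Gamma>[OF u] by (simp_all add: hh_def divide_inverse algebra_simps)
qed

end

section \<open>Tracefree second fundamental form and the Willmore operator\<close>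

lemma ee_nth: "ee 1 $ 1 = 1" "ee 1 $ 2 = 0" "ee 2 $ 1 = 0" "ee 2 $ 2 = 1"
  by (simp_all add: axis_def)

text \<open>The assumption \<open>tf\<close> is the trace of II with the denominator
  \<open>dg\<close> cleared.\<close>

locale central_frame = adapted_frame W s z V
  for W and s z :: "real^2 \<Rightarrow> ('m::finite) lorentz" and V +
  assumes tf: "\<And>w. w \<in> W \<Longrightarrow> gg 2 2 w *\<^sub>R BB 1 1 w - (2 * gg 1 2 w) *\<^sub>R BB 1 2 w + gg 1 1 w *\<^sub>R BB 2 2 w = 0"
begin

lemma nab_lor: "u \<in> W \<Longrightarrow> lor (nab X f u) x = lor (dird X f u) (x - PV u x)"
  by (simp add: nab_eq lor_simps PV_self_adjoint)

lemma perp_lor: "PV u v = 0 \<Longrightarrow> lor v x = lor v (x - PV u x)"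
  by (simp add: lor_simps PV_self_adjoint[symmetric])

text \<open>The trace of II vanishes identically and the metric is parallel, so the covariant
  derivative is tracefree as well. Pairing with a vector reduces this to the scalar identity
  \<open>trace_derivative\<close>.\<close>

lemma cB_trace:
  assumes u: "u \<in> W"
  shows "gg 2 2 u *\<^sub>R cB k 1 1 u - (2 * gg 1 2 u) *\<^sub>R cB k 1 2 u + gg 1 1 u *\<^sub>R cB k 2 2 u = 0"
proof (rule lor_eqI)
  fix x
  note dgi = diffI[OF smooth_gg u] and dB = diffI[OF smooth_BB u]
  have d2: "dird (ee k) (\<lambda>w. 2 * gg 1 2 w) u = 2 * dird (ee k) (gg 1 2) u" "(\<lambda>w. 2 * gg 1 2 w) differentiable (at u)"
    using dird_mult[OF differentiable_const dgi, of "ee k" 2] dgi by auto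
  have "dird (ee k) (\<lambda>w. gg 2 2 w *\<^sub>R BB 1 1 w - (2 * gg 1 2 w) *\<^sub>R BB 1 2 w + gg 1 1 w *\<^sub>R BB 2 2 w) u = 0"
    by (rule dird_const_on[OF u tf])
  moreover have "dird (ee k) (\<lambda>w. gg 2 2 w *\<^sub>R BB 1 1 w - (2 * gg 1 2 w) *\<^sub>R BB 1 2 w + gg 1 1 w *\<^sub>R BB 2 2 w) u =
      dird (ee k) (gg 2 2) u *\<^sub>R BB 1 1 u + gg 2 2 u *\<^sub>R dird (ee k) (BB 1 1) u
      - (2 *\<^sub>R (dird (ee k) (gg 1 2) u *\<^sub>R BB 1 2 u + gg 1 2 u *\<^sub>R dird (ee k) (BB 1 2) u))
      + (dird (ee k) (gg 1 1) u *\<^sub>R BB 2 2 u + gg 1 1 u *\<^sub>R dird (ee k) (BB 2 2) u)"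
    by (simp add: dird_add dird_diff dird_scaleR d2 differentiable_scaleR differentiable_diff dgi dB scaleR_right_distrib)
  ultimately have D: "dird (ee k) (gg 2 2) u *\<^sub>R BB 1 1 u + gg 2 2 u *\<^sub>R dird (ee k) (BB 1 1) u
      - (2 *\<^sub>R (dird (ee k) (gg 1 2) u *\<^sub>R BB 1 2 u + gg 1 2 u *\<^sub>R dird (ee k) (BB 1 2) u))
      + (dird (ee k) (gg 1 1) u *\<^sub>R BB 2 2 u + gg 1 1 u *\<^sub>R dird (ee k) (BB 2 2) u) = 0" by simp
  \<comment> \<open>Against the normal part of \<open>x\<close> the projected derivative
    \<open>nab\<close> and the plain derivative have the same product.\<close>
  let ?x = "x - PV u x"
  have 1: "gg 2 2 u * lor (BB 1 1 u) ?x - 2 * gg 1 2 u * lor (BB 1 2 u) ?x + gg 1 1 u * lor (BB 2 2 u) ?x = 0"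
    using arg_cong[OF tf[OF u], of "\<lambda>v. lor v ?x"] by (simp add: lor_simps(1,3,5,7,9))
  have 2: "dird (ee k) (gg 2 2) u * lor (BB 1 1 u) ?x + gg 2 2 u * lor (dird (ee k) (BB 1 1) u) ?x
      - 2 * (dird (ee k) (gg 1 2) u * lor (BB 1 2 u) ?x + gg 1 2 u * lor (dird (ee k) (BB 1 2) u) ?x)
      + dird (ee k) (gg 1 1) u * lor (BB 2 2 u) ?x + gg 1 1 u * lor (dird (ee k) (BB 2 2) u) ?x = 0"
    using arg_cong[OF D, of "\<lambda>v. lor v ?x"] by (simp add: lor_simps(1,3,5,7,9))
  show "lor (gg 2 2 u *\<^sub>R cB k 1 1 u - (2 * gg 1 2 u) *\<^sub>R cB k 1 2 u + gg 1 1 u *\<^sub>R cB k 2 2 u) x = lor 0 x"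
    using trace_derivative[OF dgg_\<Gamma>[OF u] 1 2]
    by (simp add: cB_eq[OF u] lor_simps(1,3,5,7,9) nab_lor[OF u] perp_lor[OF PV_BB[OF u], of _ _ x]
        BB_sym[OF u, of 2 1] del: lor_diff_right) (simp add: algebra_simps)
qed

text \<open>Contract the Codazzi equation with the metric. The trace term is zero by
  \<open>cB_trace\<close>, and the right-hand side contributes \<nu> - 2 \<nu>, where 2 is the
  dimension of the surface.\<close>

lemma div_cB:
  assumes u: "u \<in> W"
  shows "gg 2 2 u *\<^sub>R cB 1 1 k u - gg 1 2 u *\<^sub>R cB 1 2 k u - gg 1 2 u *\<^sub>R cB 2 1 k u + gg 1 1 u *\<^sub>R cB 2 2 k u
    = - (dg u *\<^sub>R \<nu> k u)"
proof -
  have c1: "cB 1 2 1 u = cB 2 1 1 u + (gg 1 2 u *\<^sub>R \<nu> 1 u - gg 1 1 u *\<^sub>R \<nu> 2 u)"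
    using codazzi[OF u, of 1] by (simp add: gg_sym algebra_simps)
  have c2: "cB 1 2 2 u = cB 2 1 2 u + (gg 2 2 u *\<^sub>R \<nu> 1 u - gg 1 2 u *\<^sub>R \<nu> 2 u)"
    using codazzi[OF u, of 2] by (simp add: gg_sym algebra_simps)
  have s: "cB 1 1 2 u = cB 1 2 1 u" "cB 2 2 1 u = cB 2 1 2 u" using cB_sym[OF u] by auto
  have t1: "gg 2 2 u *\<^sub>R cB 1 1 1 u = (2 * gg 1 2 u) *\<^sub>R cB 1 2 1 u - gg 1 1 u *\<^sub>R cB 1 2 2 u"
    using cB_trace[OF u, of 1] s by (simp add: algebra_simps eq_neg_iff_add_eq_0)
  have t2: "gg 1 1 u *\<^sub>R cB 2 2 2 u = (2 * gg 1 2 u) *\<^sub>R cB 2 1 2 u - gg 2 2 u *\<^sub>R cB 2 1 1 u"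
    using cB_trace[OF u, of 2] s by (simp add: algebra_simps eq_neg_iff_add_eq_0)
  show ?thesis
    using exhaust_2[of k]
  proof
    assume "k = 1"
    then show ?thesis by (simp add: t1 s c1 c2 dg_def) (simp add: algebra_simps, simp only: mult_2 scaleR_left_distrib add_ac)
  next
    assume "k = 2"
    then show ?thesis by (simp add: t2 s c1 c2 dg_def) (simp add: algebra_simps, simp only: mult_2 scaleR_left_distrib add_ac)
  qed
qed

lemma div2_II:
  assumes u: "u \<in> W" shows "div2 s nab (II V s) u (ee k) = - \<nu> k u"
proof -
  have "div2 s nab (II V s) u (ee k) = (1 / dg u) *\<^sub>R (gg 2 2 u *\<^sub>R cB 1 1 k u - gg 1 2 u *\<^sub>R cB 1 2 k u - gg 1 2 u *\<^sub>R cB 2 1 k u + gg 1 1 u *\<^sub>R cB 2 2 k u)"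
    using exhaust_2[of k] unfolding div2_def cB_def[symmetric]
    by (auto simp: sum_2 ee_nth ginv_comp[OF u] algebra_simps)
  then show ?thesis unfolding div_cB[OF u] using dg_nz[OF u] by simp
qed

definition c\<nu> :: "2 \<Rightarrow> 2 \<Rightarrow> real^2 \<Rightarrow> 'm lorentz" where
  "c\<nu> k j u = nab (ee k) (\<nu> j) u - (\<Gamma> 1 k j u *\<^sub>R \<nu> 1 u + \<Gamma> 2 k j u *\<^sub>R \<nu> 2 u)"

lemma div1_div2_II:
  assumes u: "u \<in> W"
  shows "dg u *\<^sub>R div1 s nab (div2 s nab (II V s)) u
    = - (gg 2 2 u *\<^sub>R c\<nu> 1 1 u - gg 1 2 u *\<^sub>R c\<nu> 1 2 u - gg 1 2 u *\<^sub>R c\<nu> 2 1 u + gg 1 1 u *\<^sub>R c\<nu> 2 2 u)"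
proof -
  have "nab (ee k) (\<lambda>w. div2 s nab (II V s) w (ee j)) u = - nab (ee k) (\<nu> j) u" for k j
  proof -
    have "dird (ee k) (\<lambda>w. div2 s nab (II V s) w (ee j)) u = dird (ee k) (\<lambda>w. - \<nu> j w) u"
      by (rule dird_cong[OF W u]) (rule div2_II)
    then show ?thesis using dird_minus[OF diffI[OF smooth_\<nu> u]]
      by (simp add: nab_eq[OF u] PV_lin)
  qed
  then have "cov1 s nab (div2 s nab (II V s)) u k j = - c\<nu> k j u" for k j
    unfolding cov1_def c\<nu>_def by (simp add: sum_2 div2_II[OF u])
  then have "div1 s nab (div2 s nab (II V s)) u = (1 / dg u) *\<^sub>R
    (- (gg 2 2 u *\<^sub>R c\<nu> 1 1 u - gg 1 2 u *\<^sub>R c\<nu> 1 2 u - gg 1 2 u *\<^sub>R c\<nu> 2 1 u + gg 1 1 u *\<^sub>R c\<nu> 2 2 u))"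
    unfolding div1_def by (simp add: sum_2 ginv_comp[OF u] algebra_simps)
  then show ?thesis using dg_nz[OF u] by simp
qed

text \<open>On a surface the exterior derivative of a starred 1-form is its divergence times the
  volume density; by \<open>div2_II\<close> the divergence of \<nu> is minus the double divergence
  of II.\<close>

lemma curl_star_\<nu>:
  assumes u: "u \<in> W"
  shows "nab (ee 1) (\<lambda>w. hh 2 2 w *\<^sub>R \<nu> 1 w - hh 1 2 w *\<^sub>R \<nu> 2 w) u - nab (ee 2) (\<lambda>w. hh 1 2 w *\<^sub>R \<nu> 1 w - hh 1 1 w *\<^sub>R \<nu> 2 w) u
    = - (sqrt (dg u) *\<^sub>R div1 s nab (div2 s nab (II V s)) u)"
proof -
  have p: "sqrt (dg u) \<noteq> 0" "dg u = sqrt (dg u) * sqrt (dg u)" using dg_pos[OF u] by simp_all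
  have n: "nab (ee k) (\<lambda>w. hh i j w *\<^sub>R \<nu> 1 w - hh l m w *\<^sub>R \<nu> 2 w) u
     = dird (ee k) (hh i j) u *\<^sub>R \<nu> 1 u + hh i j u *\<^sub>R nab (ee k) (\<nu> 1) u
       - dird (ee k) (hh l m) u *\<^sub>R \<nu> 2 u - hh l m u *\<^sub>R nab (ee k) (\<nu> 2) u" for k i j l m
    by (simp add: nab_eq[OF u] dird_diff dird_scaleR differentiable_scaleR diff_hh[OF u] diffI[OF smooth_\<nu> u]
       PV_lin PV_\<nu>[OF u] algebra_simps)
  have "nab (ee 1) (\<lambda>w. hh 2 2 w *\<^sub>R \<nu> 1 w - hh 1 2 w *\<^sub>R \<nu> 2 w) u - nab (ee 2) (\<lambda>w. hh 1 2 w *\<^sub>R \<nu> 1 w - hh 1 1 w *\<^sub>R \<nu> 2 w) u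
    = hh 2 2 u *\<^sub>R c\<nu> 1 1 u - hh 1 2 u *\<^sub>R c\<nu> 1 2 u - hh 1 2 u *\<^sub>R c\<nu> 2 1 u + hh 1 1 u *\<^sub>R c\<nu> 2 2 u"
    unfolding n dhh[OF u] c\<nu>_def \<Gamma>_sym[OF u, of _ 2 1] by (simp add: algebra_simps, simp only: mult_2 scaleR_left_distrib add_ac)
  also have "\<dots> = (1 / sqrt (dg u)) *\<^sub>R (gg 2 2 u *\<^sub>R c\<nu> 1 1 u - gg 1 2 u *\<^sub>R c\<nu> 1 2 u - gg 1 2 u *\<^sub>R c\<nu> 2 1 u + gg 1 1 u *\<^sub>R c\<nu> 2 2 u)"
    by (simp add: hh_def algebra_simps)
  also have "\<dots> = - ((dg u / sqrt (dg u)) *\<^sub>R div1 s nab (div2 s nab (II V s)) u)"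
  proof -
    have "(dg u / sqrt (dg u)) *\<^sub>R div1 s nab (div2 s nab (II V s)) u = (1 / sqrt (dg u)) *\<^sub>R (dg u *\<^sub>R div1 s nab (div2 s nab (II V s)) u)"
      by simp
    then show ?thesis by (simp only: div1_div2_II[OF u] scaleR_minus_right minus_minus)
  qed
  finally show ?thesis using p by (simp add: real_div_sqrt dg_pos[OF u, THEN less_imp_le])
qed

text \<open>The Hessian of \<open>s\<close> is g z - \<rho> s - II. Its \<open>z\<close> term is a
  pure trace and II is normal, so what the tracefree part leaves in \<open>V\<close> is the
  tracefree part of \<rho>.\<close>

lemma r0_eq:
  assumes u: "u \<in> W"
  shows "r0 V s u (ee i) (ee j) = \<rho> i j u - ((gg 2 2 u * \<rho> 1 1 u - 2 * gg 1 2 u * \<rho> 1 2 u + gg 1 1 u * \<rho> 2 2 u) / dg u / 2) * gg i j u"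
proof -
  define t where "t = (gg 2 2 u * \<rho> 1 1 u - 2 * gg 1 2 u * \<rho> 1 2 u + gg 1 1 u * \<rho> 2 2 u) / dg u"
  have h: "hess s u (ee i) (ee j) = gg i j u *\<^sub>R z u - \<rho> i j u *\<^sub>R s u - BB i j u" for i j
    using exhaust_2[of i] exhaust_2[of j]
    by (auto simp: hess_def sum_2 ee_nth cov1_def dS[OF u])
  have dgd: "gg 1 1 u * gg 2 2 u / dg u - gg 1 2 u * gg 1 2 u / dg u = 1"
    using dg_nz[OF u] by (simp add: diff_divide_distrib[symmetric]) (simp add: dg_def)
  have "gtrace s u (hess s u) = (2 * (gg 1 1 u * gg 2 2 u / dg u - gg 1 2 u * gg 1 2 u / dg u)) *\<^sub>R z u - ((gg 2 2 u * \<rho> 1 1 u - 2 * gg 1 2 u * \<rho> 1 2 u + gg 1 1 u * \<rho> 2 2 u) / dg u) *\<^sub>R s u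
     - (1 / dg u) *\<^sub>R (gg 2 2 u *\<^sub>R BB 1 1 u - (2 * gg 1 2 u) *\<^sub>R BB 1 2 u + gg 1 1 u *\<^sub>R BB 2 2 u)"
    unfolding gtrace_def sum_2 h ginv_comp[OF u]
    by (simp add: gg_sym \<rho>_sym[OF u, of 2 1] BB_sym[OF u, of 2 1] algebra_simps add_divide_distrib diff_divide_distrib scaleR_2,
        simp only: mult_2 scaleR_left_distrib add_divide_distrib add_ac)
  then have gt: "gtrace s u (hess s u) = 2 *\<^sub>R z u - t *\<^sub>R s u"
    unfolding dgd tf[OF u] t_def by simp
  have sy: "gg j i u = gg i j u" "\<rho> j i u = \<rho> i j u" "BB j i u = BB i j u"
    using \<rho>_sym[OF u] BB_sym[OF u] by (auto simp: gg_def lor_sym[of "S j u"])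
  have "sym0 s u (hess s u) (ee i) (ee j) = (gg i j u *\<^sub>R z u - \<rho> i j u *\<^sub>R s u - BB i j u) - (gg i j u / 2) *\<^sub>R (2 *\<^sub>R z u - t *\<^sub>R s u)"
    unfolding sym0_def h gt metric_ee sy by (simp add: scaleR_2[symmetric])
  then have "lproj (V u) (sym0 s u (hess s u) (ee i) (ee j)) = - ((\<rho> i j u - t / 2 * gg i j u) *\<^sub>R s u)"
    by (simp add: lproj_V[OF u] PV_lin PV_frame[OF u] PV_BB[OF u] scaleR_left_diff_distrib scaleR_right_diff_distrib mult.commute)
  moreover have "s u \<noteq> 0" using frame_lor(3)[OF u] by (auto simp: lor_zero_left)
  ultimately show ?thesis unfolding r0_def t_def[symmetric] by simp
qed

text \<open>The left side is what results from inserting the vectors dual to \<open>a\<close> into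
  the star of II and skew-symmetrizing. It arises twice: with \<rho> from the derivative of
  \<open>z\<close>, and with \<open>q\<close> from the bracket with \<xi>.\<close>

lemma contract_BB:
  assumes u: "u \<in> W"
  shows "up 1 u (a (ee 1) (ee 1)) (a (ee 1) (ee 2)) *\<^sub>R (hh 2 2 u *\<^sub>R BB 1 1 u - hh 1 2 u *\<^sub>R BB 2 1 u)
    + up 2 u (a (ee 1) (ee 1)) (a (ee 1) (ee 2)) *\<^sub>R (hh 2 2 u *\<^sub>R BB 1 2 u - hh 1 2 u *\<^sub>R BB 2 2 u)
    - up 1 u (a (ee 2) (ee 1)) (a (ee 2) (ee 2)) *\<^sub>R (hh 1 2 u *\<^sub>R BB 1 1 u - hh 1 1 u *\<^sub>R BB 2 1 u)
    - up 2 u (a (ee 2) (ee 1)) (a (ee 2) (ee 2)) *\<^sub>R (hh 1 2 u *\<^sub>R BB 1 2 u - hh 1 1 u *\<^sub>R BB 2 2 u)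
    = sqrt (dg u) *\<^sub>R contract s u a (II V s u)"
proof -
  have h: "hh i j u = sqrt (dg u) * (gg i j u / dg u)" for i j
    using dg_pos[OF u] by (simp add: hh_def real_div_sqrt field_simps)
  show ?thesis
    unfolding contract_def sum_2 II_ee[OF u] ginv_comp[OF u] h
    by (simp add: up_def algebra_simps add_divide_distrib diff_divide_distrib)
qed

text \<open>A pure trace does not see the tracefree II. Hence the tracefree \<open>r0\<close> in the
  Willmore operator may be replaced by \<rho>, the form that occurs in the derivative of
  \<open>z\<close>.\<close>

lemma contract_metric: "u \<in> W \<Longrightarrow> contract s u (\<lambda>X Y. c * metric s u X Y) (II V s u) = 0"
proof -
  assume u: "u \<in> W"
  have "contract s u (\<lambda>X Y. c * metric s u X Y) (II V s u) = (c / dg u) *\<^sub>R (gg 2 2 u *\<^sub>R BB 1 1 u - (2 * gg 1 2 u) *\<^sub>R BB 1 2 u + gg 1 1 u *\<^sub>R BB 2 2 u)"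
  proof (rule lor_eqI)
    fix x
    have d: "gg 1 1 u * gg 2 2 u = dg u + gg 1 2 u * gg 1 2 u" by (simp add: dg_def)
    show "lor (contract s u (\<lambda>X Y. c * metric s u X Y) (II V s u)) x = lor ((c / dg u) *\<^sub>R (gg 2 2 u *\<^sub>R BB 1 1 u - (2 * gg 1 2 u) *\<^sub>R BB 1 2 u + gg 1 1 u *\<^sub>R BB 2 2 u)) x"
      using dg_nz[OF u]
      unfolding contract_def sum_2 II_ee[OF u] ginv_comp[OF u] metric_ee gg_sym BB_sym[OF u, of 2 1]
      apply (simp add: lor_simps field_simps)
      using d by algebra
  qed
  then show ?thesis by (simp add: tf[OF u])
qed

lemma contract_linear:
  "contract s u (\<lambda>X Y. a X Y - b X Y) \<Psi> = contract s u a \<Psi> - contract s u b \<Psi>"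
  by (simp add: contract_def sum_subtractf[symmetric] algebra_simps)

definition rform :: "real^2 \<Rightarrow> real^2 \<Rightarrow> real^2 \<Rightarrow> real" where
  "rform u X Y = (\<Sum>i\<in>UNIV. \<Sum>j\<in>UNIV. X $ i * Y $ j * \<rho> i j u)"

lemma rform_ee: "rform u (ee i) (ee j) = \<rho> i j u"
  using exhaust_2[of i] exhaust_2[of j] by (auto simp: rform_def sum_2 ee_nth)

lemma Hstar_eq:
  assumes u: "u \<in> W"
  shows "Hstar V s (II V s) u = div1 s nab (div2 s nab (II V s)) u + contract s u (rform u) (II V s u)"
proof -
  let ?c = "(gg 2 2 u * \<rho> 1 1 u - 2 * gg 1 2 u * \<rho> 1 2 u + gg 1 1 u * \<rho> 2 2 u) / dg u / 2"
  have "contract s u (r0 V s u) (II V s u) = contract s u (\<lambda>X Y. rform u X Y - ?c * metric s u X Y) (II V s u)"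
    unfolding contract_def r0_eq[OF u] rform_ee metric_ee ..
  also have "\<dots> = contract s u (rform u) (II V s u)"
    unfolding contract_linear contract_metric[OF u] by simp
  finally show ?thesis by (simp add: Hstar_def Let_def)
qed

end

section \<open>Curvature of the family of connections\<close>

lemma so_lorD: "T \<in> so_lor \<Longrightarrow> linear T" "T \<in> so_lor \<Longrightarrow> lor (T v) x = - lor v (T x)"
  by (simp_all add: so_lor_def eq_neg_iff_add_eq_0 del: split_paired_All)

lemma differentiable_lor:
  "f differentiable (at u) \<Longrightarrow> g differentiable (at u) \<Longrightarrow> (\<lambda>w. lor (f w) (g w)) differentiable (at u)"
  unfolding differentiable_def using bounded_bilinear.FDERIV[OF bounded_bilinear_lor] by blast

lemma so_lorI: "linear T \<Longrightarrow> (\<And>v x. lor (T v) x + lor v (T x) = 0) \<Longrightarrow> T \<in> so_lor"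
  by (simp add: so_lor_def)

lemma so_lor_scaleR_add:
  assumes "T \<in> so_lor" "T' \<in> so_lor"
  shows "(\<lambda>v. a *\<^sub>R T v + b *\<^sub>R T' v) \<in> so_lor"
proof (rule so_lorI)
  show "linear (\<lambda>v. a *\<^sub>R T v + b *\<^sub>R T' v)"
    by (rule linearI) (simp_all add: linear_add[OF so_lorD(1)] linear_scale[OF so_lorD(1)] assms algebra_simps)
qed (simp add: lor_simps so_lorD(2)[OF assms(1)] so_lorD(2)[OF assms(2)])

text \<open>The bracket of 1-forms on the coordinate fields, [\<alpha>_1, \<beta>_2] -
  [\<alpha>_2, \<beta>_1]. It is symmetric in \<alpha> and \<beta>, and
  \<open>br \<alpha> \<alpha>\<close> is twice a commutator.\<close>

definition br :: "(real^2 \<Rightarrow> 'b \<Rightarrow> 'b) \<Rightarrow> (real^2 \<Rightarrow> 'b \<Rightarrow> 'b) \<Rightarrow> 'b \<Rightarrow> 'b::real_vector" where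
  "br \<alpha> \<beta> v = \<alpha> (ee 1) (\<beta> (ee 2) v) - \<beta> (ee 2) (\<alpha> (ee 1) v) - \<alpha> (ee 2) (\<beta> (ee 1) v) + \<beta> (ee 1) (\<alpha> (ee 2) v)"

text \<open>A 2-form on a surface is determined by its value on the coordinate fields; this reduces
  conditions on all \<open>X\<close> and \<open>Y\<close> to one component.\<close>

lemma alternating_expand:
  fixes e :: "real^2 \<Rightarrow> real^2 \<Rightarrow> 'b::real_vector"
  assumes "\<And>Y. linear (\<lambda>X. e X Y)" "\<And>X. linear (\<lambda>Y. e X Y)"
  shows "e X Y - e Y X = (X $ 1 * Y $ 2 - X $ 2 * Y $ 1) *\<^sub>R (e (ee 1) (ee 2) - e (ee 2) (ee 1))"
proof -
  have "e X Y = (X $ 1) *\<^sub>R ((Y $ 1) *\<^sub>R e (ee 1) (ee 1) + (Y $ 2) *\<^sub>R e (ee 1) (ee 2))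
      + (X $ 2) *\<^sub>R ((Y $ 1) *\<^sub>R e (ee 2) (ee 1) + (Y $ 2) *\<^sub>R e (ee 2) (ee 2))" for X Y
    using linear_expand2[OF assms(1), of X Y] linear_expand2[OF assms(2), of "ee 1" Y]
      linear_expand2[OF assms(2), of "ee 2" Y] by simp
  from this[of X Y] this[of Y X] show ?thesis by (simp add: algebra_simps)
qed

context adapted_frame
begin

text \<open>Differentiability is the regularity that a single exterior derivative uses, and it
  passes directly to the Hodge star, whose coefficients involve the square root of
  \<open>dg\<close>.\<close>

definition so_form :: "(real^2 \<Rightarrow> real^2 \<Rightarrow> 'm lorentz \<Rightarrow> 'm lorentz) \<Rightarrow> bool" where
  "so_form \<alpha> \<longleftrightarrow> (\<forall>w\<in>W. (\<forall>X. \<alpha> w X \<in> so_lor) \<and> (\<forall>v. linear (\<lambda>X. \<alpha> w X v)) \<and>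
     (\<forall>X v. (\<lambda>w. \<alpha> w X v) differentiable (at w)))"

lemma so_formD:
  assumes "so_form \<alpha>" "u \<in> W"
  shows "\<alpha> u X \<in> so_lor" "linear (\<alpha> u X)" "linear (\<lambda>X. \<alpha> u X v)" "(\<lambda>w. \<alpha> w X v) differentiable (at u)"
    "lor (\<alpha> u X v) x = - lor v (\<alpha> u X x)"
proof -
  show 1: "\<alpha> u X \<in> so_lor" for X using assms unfolding so_form_def by blast
  show "linear (\<alpha> u X)" "lor (\<alpha> u X v) x = - lor v (\<alpha> u X x)" using so_lorD[OF 1] by blast+
  show "linear (\<lambda>X. \<alpha> u X v)" "(\<lambda>w. \<alpha> w X v) differentiable (at u)" using assms unfolding so_form_def by blast+
qed

lemma dird_form:
  assumes "so_form \<alpha>" "u \<in> W" "f differentiable (at u)"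
  shows "dird Y (\<lambda>w. \<alpha> w X (f w)) u = dird Y (\<lambda>w. \<alpha> w X (f u)) u + \<alpha> u X (dird Y f u)"
    "(\<lambda>w. \<alpha> w X (f w)) differentiable (at u)"
  using dird_apply[OF W assms(2) so_formD(2)[OF assms(1)] so_formD(4)[OF assms(1,2)] assms(3)] by blast+

lemma hodge_endo_ee:
  assumes u: "u \<in> W"
  shows "hodge_endo s \<alpha> u (ee 1) v = hh 1 2 u *\<^sub>R \<alpha> u (ee 1) v - hh 1 1 u *\<^sub>R \<alpha> u (ee 2) v"
    "hodge_endo s \<alpha> u (ee 2) v = hh 2 2 u *\<^sub>R \<alpha> u (ee 1) v - hh 1 2 u *\<^sub>R \<alpha> u (ee 2) v"
    "hodge_endo s \<alpha> u X v = (X $ 1) *\<^sub>R hodge_endo s \<alpha> u (ee 1) v + (X $ 2) *\<^sub>R hodge_endo s \<alpha> u (ee 2) v"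
  unfolding hodge_endo_def by (rule hodge_ee[OF u])+

lemma so_form_of_components:
  assumes "\<And>u v X. u \<in> W \<Longrightarrow> \<beta> u X v = (X $ 1) *\<^sub>R \<beta>1 u v + (X $ 2) *\<^sub>R \<beta>2 u v"
    and "\<And>u. u \<in> W \<Longrightarrow> \<beta>1 u \<in> so_lor" "\<And>u. u \<in> W \<Longrightarrow> \<beta>2 u \<in> so_lor"
    and "\<And>u v. u \<in> W \<Longrightarrow> (\<lambda>w. \<beta>1 w v) differentiable (at u)" "\<And>u v. u \<in> W \<Longrightarrow> (\<lambda>w. \<beta>2 w v) differentiable (at u)"
  shows "so_form \<beta>"
  unfolding so_form_def
proof (intro ballI conjI allI)
  fix u X v assume u: "u \<in> W"
  have "\<beta> u X = (\<lambda>v. (X $ 1) *\<^sub>R \<beta>1 u v + (X $ 2) *\<^sub>R \<beta>2 u v)" using assms(1)[OF u] by blast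
  then show "\<beta> u X \<in> so_lor" using so_lor_scaleR_add[OF assms(2,3)[OF u]] by simp
  have "linear (\<lambda>X. (X $ 1) *\<^sub>R \<beta>1 u v + (X $ 2) *\<^sub>R \<beta>2 u v)" by (rule linearI) (simp_all add: algebra_simps)
  then show "linear (\<lambda>X. \<beta> u X v)" by (simp add: assms(1)[OF u])
  show "(\<lambda>w. \<beta> w X v) differentiable (at u)"
  proof (rule differentiable_cong_open[OF W u])
    show "(X $ 1) *\<^sub>R \<beta>1 w v + (X $ 2) *\<^sub>R \<beta>2 w v = \<beta> w X v" if "w \<in> W" for w
      using assms(1)[OF that] by simp
    show "(\<lambda>w. (X $ 1) *\<^sub>R \<beta>1 w v + (X $ 2) *\<^sub>R \<beta>2 w v) differentiable (at u)"
      by (intro differentiable_add differentiable_scaleR differentiable_const assms(4,5) u)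
  qed
qed

lemma so_form_hodge:
  assumes a: "so_form \<alpha>" shows "so_form (hodge_endo s \<alpha>)"
proof (rule so_form_of_components)
  fix u :: "real^2" and v assume u: "u \<in> W"
  have "(\<lambda>v. hh 1 2 u *\<^sub>R \<alpha> u (ee 1) v + (- hh 1 1 u) *\<^sub>R \<alpha> u (ee 2) v) \<in> so_lor"
    "(\<lambda>v. hh 2 2 u *\<^sub>R \<alpha> u (ee 1) v + (- hh 1 2 u) *\<^sub>R \<alpha> u (ee 2) v) \<in> so_lor"
    by (intro so_lor_scaleR_add so_formD[OF a u])+
  then show "hodge_endo s \<alpha> u (ee 1) \<in> so_lor" "hodge_endo s \<alpha> u (ee 2) \<in> so_lor"
    by (simp_all add: hodge_endo_ee(1,2)[OF u, abs_def])
  show "(\<lambda>w. hodge_endo s \<alpha> w (ee 1) v) differentiable (at u)"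
    by (rule differentiable_cong_open[OF W u hodge_endo_ee(1)[symmetric]], assumption)
      (auto intro!: differentiable_diff differentiable_scaleR diff_hh so_formD[OF a] u)
  show "(\<lambda>w. hodge_endo s \<alpha> w (ee 2) v) differentiable (at u)"
    by (rule differentiable_cong_open[OF W u hodge_endo_ee(2)[symmetric]], assumption)
      (auto intro!: differentiable_diff differentiable_scaleR diff_hh so_formD[OF a] u)
qed (rule hodge_endo_ee(3))

lemma so_form_NV: "so_form (NV V)"
proof (rule so_form_of_components)
  fix u :: "real^2" and v X assume u: "u \<in> W"
  show "NV V u X v = (X $ 1) *\<^sub>R NV V u (ee 1) v + (X $ 2) *\<^sub>R NV V u (ee 2) v" by (rule NV_expand[OF u])
  show "NV V u (ee 1) \<in> so_lor" "NV V u (ee 2) \<in> so_lor"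
    by (intro so_lorI linear_NV NV_skew u)+
  show "(\<lambda>w. NV V w (ee 1) v) differentiable (at u)" "(\<lambda>w. NV V w (ee 2) v) differentiable (at u)"
    by (rule diffI[OF smooth_NV u])+
qed

section \<open>The exterior derivative coupled to the direct sum connection\<close>

text \<open>The coupling is to \<open>split_conn\<close> and not to \<open>Dh\<close>; the effect of
  the form Q is computed separately as a bracket.\<close>

definition dsp :: "(real^2 \<Rightarrow> real^2 \<Rightarrow> 'm lorentz \<Rightarrow> 'm lorentz) \<Rightarrow> real^2 \<Rightarrow> 'm lorentz \<Rightarrow> 'm lorentz" where
  "dsp \<alpha> u v = ext_cov (split_conn V) \<alpha> u (ee 1) (ee 2) v"

lemma split_const: "u \<in> W \<Longrightarrow> split_conn V X (\<lambda>_. v) u = - NV V u X v"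
  by (simp add: split_conn_NV)

lemma dsp_eq:
  assumes a: "so_form \<alpha>" and u: "u \<in> W"
  shows "dsp \<alpha> u v = dird (ee 1) (\<lambda>w. \<alpha> w (ee 2) v) u - dird (ee 2) (\<lambda>w. \<alpha> w (ee 1) v) u - br (NV V u) (\<alpha> u) v"
  unfolding dsp_def ext_cov_def br_def split_const[OF u]
  by (simp add: split_conn_NV[OF u so_formD(4)[OF a u]] linear_neg[OF so_formD(2)[OF a u]])

text \<open>Tensoriality. The definition uses constant sections, but the computations evaluate on
  the frame sections and on normal sections, whose derivatives under the connection are
  known.\<close>

lemma dsp_section:
  assumes a: "so_form \<alpha>" and u: "u \<in> W" and f: "f differentiable (at u)"
  shows "dsp \<alpha> u (f u) = split_conn V (ee 1) (\<lambda>w. \<alpha> w (ee 2) (f w)) u - \<alpha> u (ee 2) (split_conn V (ee 1) f u)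
     - (split_conn V (ee 2) (\<lambda>w. \<alpha> w (ee 1) (f w)) u - \<alpha> u (ee 1) (split_conn V (ee 2) f u))"
  unfolding dsp_eq[OF a u] br_def split_conn_NV[OF u f] split_conn_NV[OF u dird_form(2)[OF a u f]] dird_form(1)[OF a u f]
  by (simp add: linear_diff[OF so_formD(2)[OF a u]])

text \<open>The connection is metric, so the derivative of a form with values in the orthogonal
  algebra stays there; this makes \<open>so_zero\<close> applicable.\<close>

lemma dsp_skew:
  assumes a: "so_form \<alpha>" and u: "u \<in> W"
  shows "lor (dsp \<alpha> u v) x = - lor v (dsp \<alpha> u x)"
proof -
  have d: "lor (dird Y (\<lambda>w. \<alpha> w X v) u) x = - lor v (dird Y (\<lambda>w. \<alpha> w X x) u)" for X Y
  proof -
    have "dird Y (\<lambda>w. lor (\<alpha> w X v) x) u = dird Y (\<lambda>w. - lor v (\<alpha> w X x)) u"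
      by (rule dird_cong[OF W u]) (rule so_formD(5)[OF a])
    moreover have "(\<lambda>w. lor v (\<alpha> w X x)) differentiable (at u)"
      by (intro differentiable_lor differentiable_const so_formD(4)[OF a u])
    ultimately show ?thesis
      using dird_lor[OF so_formD(4)[OF a u] differentiable_const, of Y X v x]
        dird_lor[OF differentiable_const so_formD(4)[OF a u], of Y v X x] by (simp add: lor_simps dird_minus)
  qed
  have n: "lor (NV V u X v) x = - lor v (NV V u X x)" for X v x
    by (rule so_formD(5)[OF so_form_NV u])
  show ?thesis unfolding dsp_eq[OF a u] br_def
    by (simp add: lor_simps d n so_formD(5)[OF a u])
qed

lemma ext_cov_minus:
  assumes a: "so_form \<alpha>" and u: "u \<in> W"
  shows "ext_cov (\<lambda>X f w. split_conn V X f w - \<beta> w X (f w)) \<alpha> u (ee 1) (ee 2) v = dsp \<alpha> u v - br (\<beta> u) (\<alpha> u) v"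
  unfolding dsp_def ext_cov_def br_def
  by (simp add: linear_diff[OF so_formD(2)[OF a u]])

lemma linear_dird_form:
  assumes a: "so_form \<alpha>" and u: "u \<in> W"
  shows "linear (\<lambda>Y. dird X (\<lambda>w. \<alpha> w Y v) u)"
proof (rule linearI)
  fix Y Y' and c :: real
  have "dird X (\<lambda>w. \<alpha> w (Y + Y') v) u = dird X (\<lambda>w. \<alpha> w Y v + \<alpha> w Y' v) u"
    by (rule dird_cong[OF W u]) (rule linear_add[OF so_formD(3)[OF a]])
  then show "dird X (\<lambda>w. \<alpha> w (Y + Y') v) u = dird X (\<lambda>w. \<alpha> w Y v) u + dird X (\<lambda>w. \<alpha> w Y' v) u"
    by (simp add: dird_add so_formD(4)[OF a u])
  have "dird X (\<lambda>w. \<alpha> w (c *\<^sub>R Y) v) u = dird X (\<lambda>w. c *\<^sub>R \<alpha> w Y v) u"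
    by (rule dird_cong[OF W u]) (rule linear_scale[OF so_formD(3)[OF a]])
  then show "dird X (\<lambda>w. \<alpha> w (c *\<^sub>R Y) v) u = c *\<^sub>R dird X (\<lambda>w. \<alpha> w Y v) u"
    by (simp add: dird_scaleR_const so_formD(4)[OF a u])
qed

lemma ext_cov_alternating:
  assumes a: "so_form \<alpha>" and u: "u \<in> W" and \<beta>: "\<And>v. linear (\<lambda>X. \<beta> u X v)" "\<And>X. linear (\<beta> u X)"
  defines "nb \<equiv> \<lambda>X f w. split_conn V X f w - \<beta> w X (f w)"
  shows "ext_cov nb \<alpha> u X Y v = (X $ 1 * Y $ 2 - X $ 2 * Y $ 1) *\<^sub>R ext_cov nb \<alpha> u (ee 1) (ee 2) v"
proof -
  note la = so_formD(2)[OF a u] and lb = so_formD(3)[OF a u]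
  note n3 = so_formD(3)[OF so_form_NV u]
  define e where "e X Y = nb X (\<lambda>w. \<alpha> w Y v) u - \<alpha> u Y (nb X (\<lambda>_. v) u)" for X Y
  have e: "e X Y = dird X (\<lambda>w. \<alpha> w Y v) u - NV V u X (\<alpha> u Y v) - \<beta> u X (\<alpha> u Y v) + \<alpha> u Y (NV V u X v) + \<alpha> u Y (\<beta> u X v)" for X Y
    unfolding e_def nb_def split_const[OF u]
    by (simp add: split_conn_NV[OF u so_formD(4)[OF a u]] linear_diff[OF la] linear_neg[OF la])
  have 1: "linear (\<lambda>X. e X Y)" for Y
    unfolding e by (rule linearI)
      (simp_all add: linear_add[OF linear_dird[OF so_formD(4)[OF a u]]] linear_scale[OF linear_dird[OF so_formD(4)[OF a u]]]
        linear_add[OF n3] linear_scale[OF n3] linear_add[OF \<beta>(1)] linear_scale[OF \<beta>(1)] linear_add[OF la] linear_scale[OF la] algebra_simps)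
  note d = linear_dird_form[OF a u]
  note ln = linear_NV[OF u]
  have 2: "linear (\<lambda>Y. e X Y)" for X
    unfolding e by (rule linearI)
      (simp_all add: linear_add[OF d] linear_scale[OF d] linear_add[OF lb] linear_scale[OF lb]
        linear_add[OF ln] linear_scale[OF ln] linear_add[OF \<beta>(2)] linear_scale[OF \<beta>(2)] algebra_simps)
  show ?thesis using alternating_expand[OF 1 2, of X Y] unfolding ext_cov_def e_def .
qed

section \<open>Curvature and flatness\<close>

definition curv :: "(real^2 \<Rightarrow> real^2 \<Rightarrow> 'm lorentz \<Rightarrow> 'm lorentz) \<Rightarrow> real^2 \<Rightarrow> real^2 \<Rightarrow> real^2 \<Rightarrow> 'm lorentz \<Rightarrow> 'm lorentz" where
  "curv B u X Y v = (dird X (\<lambda>w. B w Y v) u + B u X (B u Y v)) - (dird Y (\<lambda>w. B w X v) u + B u Y (B u X v))"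

lemma curv_alternating:
  assumes b: "so_form B" and u: "u \<in> W"
  shows "curv B u X Y v = (X $ 1 * Y $ 2 - X $ 2 * Y $ 1) *\<^sub>R curv B u (ee 1) (ee 2) v"
proof -
  note l = so_formD(2)[OF b u] and l' = so_formD(3)[OF b u] and d = linear_dird_form[OF b u]
  note d' = linear_dird[OF so_formD(4)[OF b u]]
  show ?thesis unfolding curv_def
    by (rule alternating_expand; rule linearI)
      (simp_all add: linear_add[OF d] linear_scale[OF d] linear_add[OF l] linear_scale[OF l]
        linear_add[OF l'] linear_scale[OF l'] linear_add[OF d'] linear_scale[OF d'] algebra_simps)
qed

lemma mixed_dird:
  assumes u: "u \<in> W" and f: "smooth_on f W"
  shows "dird X (dird Y f) u = dird Y (dird X (f :: real^2 \<Rightarrow> 'm lorentz)) u"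
proof -
  note df = diffI[OF smooth_on_dird[OF W f] u]
  have e: "dird X (dird Y f) u = (Y $ 1) *\<^sub>R ((X $ 1) *\<^sub>R dird (ee 1) (dird (ee 1) f) u + (X $ 2) *\<^sub>R dird (ee 2) (dird (ee 1) f) u)
     + (Y $ 2) *\<^sub>R ((X $ 1) *\<^sub>R dird (ee 1) (dird (ee 2) f) u + (X $ 2) *\<^sub>R dird (ee 2) (dird (ee 2) f) u)" for X Y
  proof -
    have "dird X (dird Y f) u = dird X (\<lambda>w. (Y $ 1) *\<^sub>R dird (ee 1) f w + (Y $ 2) *\<^sub>R dird (ee 2) f w) u"
      by (rule dird_cong[OF W u]) (rule dird_expand[OF diffI[OF f]])
    also have "\<dots> = (Y $ 1) *\<^sub>R dird X (dird (ee 1) f) u + (Y $ 2) *\<^sub>R dird X (dird (ee 2) f) u"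
      by (simp add: dird_add dird_scaleR_const df differentiable_scaleR)
    finally show ?thesis by (simp only: dird_expand[OF df, of X])
  qed
  show ?thesis unfolding e[of X Y] e[of Y X] mixed_derivatives[OF W u f, of 2 1] by (simp add: algebra_simps)
qed

lemma curvature:
  assumes b: "so_form B" and u: "u \<in> W" and f: "smooth_on f W"
    and nb: "\<And>X f w. w \<in> W \<Longrightarrow> nb X f w = dird X f w + B w X (f w)"
  shows "nb X (nb Y f) u - nb Y (nb X f) u = curv B u X Y (f u)"
proof -
  note d = diffI[OF f u] and dd = diffI[OF smooth_on_dird[OF W f] u]
  have "nb X (nb Y f) u = dird X (dird Y f) u + dird X (\<lambda>w. B w Y (f u)) u + B u Y (dird X f u) + B u X (dird Y f u) + B u X (B u Y (f u))" for X Y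
  proof -
    have "dird X (nb Y f) u = dird X (\<lambda>w. dird Y f w + B w Y (f w)) u"
      by (rule dird_cong[OF W u]) (rule nb)
    then show ?thesis
      by (simp add: nb[OF u] dird_add dird_form[OF b u d] dd linear_add[OF so_formD(2)[OF b u]])
  qed
  then show ?thesis by (simp add: curv_def mixed_dird[OF u f, of X Y])
qed

text \<open>Constant sections detect the curvature in one direction; in the other it is tensorial
  and alternating, so the component on the coordinate fields decides.\<close>

lemma flat_iff:
  assumes b: "so_form B" and nb: "\<And>X f w. w \<in> W \<Longrightarrow> nb X f w = dird X f w + B w X (f w)"
  shows "flat_on W nb \<longleftrightarrow> (\<forall>u\<in>W. \<forall>v. curv B u (ee 1) (ee 2) v = 0)"
proof
  assume fl: "flat_on W nb"
  show "\<forall>u\<in>W. \<forall>v. curv B u (ee 1) (ee 2) v = 0"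
  proof (intro ballI allI)
    fix u :: "real^2" and v :: "'m lorentz" assume u: "u \<in> W"
    have "nb (ee 1) (nb (ee 2) (\<lambda>_. v)) u - nb (ee 2) (nb (ee 1) (\<lambda>_. v)) u = 0"
      using fl u smooth_on_const[OF W] unfolding flat_on_def by blast
    then show "curv B u (ee 1) (ee 2) v = 0"
      using curvature[OF b u smooth_on_const[OF W] nb, of "ee 1" "ee 2" v] by simp
  qed
next
  assume *: "\<forall>u\<in>W. \<forall>v. curv B u (ee 1) (ee 2) v = 0"
  show "flat_on W nb"
    unfolding flat_on_def
  proof (intro allI impI ballI)
    fix f :: "real^2 \<Rightarrow> 'm lorentz" and X Y u assume f: "smooth_on f W" and u: "u \<in> W"
    have "curv B u (ee 1) (ee 2) (f u) = 0" using * u by blast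
    then have "curv B u X Y (f u) = 0" unfolding curv_alternating[OF b u, of X Y] by simp
    then show "nb X (nb Y f) u - nb Y (nb X f) u = 0"
      using curvature[OF b u f nb, of X Y] by simp
  qed
qed

text \<open>On the two-dimensional cotangent space the star has determinant one and trace zero.
  Starring both factors of an alternating product multiplies it by the determinant; starring one
  factor at a time and adding multiplies it by the trace.\<close>

lemma hodge_brackets:
  assumes u: "u \<in> W" and a: "so_form \<alpha>" and b: "so_form \<beta>"
  shows "br (hodge_endo s \<alpha> u) (hodge_endo s \<beta> u) v = br (\<alpha> u) (\<beta> u) v"
    "br (\<alpha> u) (hodge_endo s \<beta> u) v = - br (hodge_endo s \<alpha> u) (\<beta> u) v"
proof -
  note la = so_formD(2)[OF a u] and lb = so_formD(2)[OF b u]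
  note l = linear_diff[OF la] linear_scale[OF la] linear_diff[OF lb] linear_scale[OF lb]
  show "br (\<alpha> u) (hodge_endo s \<beta> u) v = - br (hodge_endo s \<alpha> u) (\<beta> u) v"
    unfolding br_def hodge_endo_ee(1,2)[OF u] by (simp add: l algebra_simps)
  have "br (hodge_endo s \<alpha> u) (hodge_endo s \<beta> u) v = (hh 1 1 u * hh 2 2 u - hh 1 2 u * hh 1 2 u) *\<^sub>R br (\<alpha> u) (\<beta> u) v"
    unfolding br_def hodge_endo_ee(1,2)[OF u] by (simp add: l algebra_simps)
  then show "br (hodge_endo s \<alpha> u) (hodge_endo s \<beta> u) v = br (\<alpha> u) (\<beta> u) v"
    using hh_det[OF u] by simp
qed

lemma br_sym: "br \<alpha> \<beta> v = br \<beta> \<alpha> v"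
  by (simp add: br_def)

definition famform :: "(real^2 \<Rightarrow> real^2 \<Rightarrow> 'm lorentz \<Rightarrow> 'm lorentz) \<Rightarrow> real \<Rightarrow> real^2 \<Rightarrow> real^2 \<Rightarrow> 'm lorentz \<Rightarrow> 'm lorentz" where
  "famform \<xi> t u X v = (cos t - 1) *\<^sub>R NV V u X v + sin t *\<^sub>R hodge_endo s (NV V) u X v
     + ((cos (2 * t) - 1) / 2) *\<^sub>R \<xi> u X v + (sin (2 * t) / 2) *\<^sub>R hodge_endo s \<xi> u X v"

lemma family_conn_eq: "family_conn V s \<xi> t X f u = dird X f u + famform \<xi> t u X (f u)"
  by (simp add: family_conn_def famform_def rot_endo_def algebra_simps diff_divide_distrib)

lemma so_form_lincomb:
  assumes a: "so_form \<alpha>" and b: "so_form \<beta>"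
  shows "so_form (\<lambda>u X v. c *\<^sub>R \<alpha> u X v + d *\<^sub>R \<beta> u X v)"
  unfolding so_form_def
proof (intro ballI conjI allI)
  fix u X v assume u: "u \<in> W"
  show "(\<lambda>v. c *\<^sub>R \<alpha> u X v + d *\<^sub>R \<beta> u X v) \<in> so_lor"
    by (intro so_lor_scaleR_add so_formD[OF a u] so_formD[OF b u])
  show "linear (\<lambda>X. c *\<^sub>R \<alpha> u X v + d *\<^sub>R \<beta> u X v)"
    by (rule linearI) (simp_all add: linear_add[OF so_formD(3)[OF a u]] linear_scale[OF so_formD(3)[OF a u]]
      linear_add[OF so_formD(3)[OF b u]] linear_scale[OF so_formD(3)[OF b u]] algebra_simps)
  show "(\<lambda>w. c *\<^sub>R \<alpha> w X v + d *\<^sub>R \<beta> w X v) differentiable (at u)"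
    by (intro differentiable_add differentiable_scaleR differentiable_const so_formD[OF a u] so_formD[OF b u])
qed

lemma so_form_famform: assumes "so_form \<xi>" shows "so_form (famform \<xi> t)"
proof -
  have "famform \<xi> t = (\<lambda>u X v. 1 *\<^sub>R ((cos t - 1) *\<^sub>R NV V u X v + sin t *\<^sub>R hodge_endo s (NV V) u X v)
     + 1 *\<^sub>R (((cos (2 * t) - 1) / 2) *\<^sub>R \<xi> u X v + (sin (2 * t) / 2) *\<^sub>R hodge_endo s \<xi> u X v))"
    by (simp add: famform_def fun_eq_iff)
  then show ?thesis
    by (simp only:) (intro so_form_lincomb so_form_hodge so_form_NV assms)
qed

lemma curv_famform:
  assumes u: "u \<in> W" and x: "so_form \<xi>" and comm: "\<And>v. br (\<xi> u) (\<xi> u) v = 0"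
  shows "curv (famform \<xi> t) u (ee 1) (ee 2) v =
     sin t *\<^sub>R (dsp (hodge_endo s (NV V)) u v - br (\<xi> u) (hodge_endo s (NV V) u) v)
     + ((cos (2 * t) - 1) / 2) *\<^sub>R dsp \<xi> u v + (sin (2 * t) / 2) *\<^sub>R dsp (hodge_endo s \<xi>) u v"
proof -
  let ?N = "NV V" let ?M = "hodge_endo s (NV V)" let ?X = "hodge_endo s \<xi>"
  define x y p r where c: "x = cos t - 1" "y = sin t" "p = (cos (2 * t) - 1) / 2" "r = sin (2 * t) / 2"
  note N = so_form_NV and M = so_form_hodge[OF so_form_NV] and X = so_form_hodge[OF x]
  note d = so_formD(4)[OF N u] so_formD(4)[OF M u] so_formD(4)[OF x u] so_formD(4)[OF X u]
  note l2 = so_formD(2)[OF N u] so_formD(2)[OF M u] so_formD(2)[OF x u] so_formD(2)[OF X u]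
  have D: "dird Y (\<lambda>w. famform \<xi> t w Z v) u = x *\<^sub>R dird Y (\<lambda>w. ?N w Z v) u + y *\<^sub>R dird Y (\<lambda>w. ?M w Z v) u
     + p *\<^sub>R dird Y (\<lambda>w. \<xi> w Z v) u + r *\<^sub>R dird Y (\<lambda>w. ?X w Z v) u" for Y Z
    unfolding famform_def c by (simp add: dird_add dird_scaleR_const d differentiable_add differentiable_scaleR)
  have DD: "dird (ee 1) (\<lambda>w. \<alpha> w (ee 2) v) u - dird (ee 2) (\<lambda>w. \<alpha> w (ee 1) v) u = dsp \<alpha> u v + br (?N u) (\<alpha> u) v"
    if "so_form \<alpha>" for \<alpha> using dsp_eq[OF that u] by simp
  have NN: "dird (ee 1) (\<lambda>w. ?N w (ee 2) v) u - dird (ee 2) (\<lambda>w. ?N w (ee 1) v) u = br (?N u) (?N u) v"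
    unfolding dNV[OF u refl refl] br_def by (simp add: scaleR_2)
  \<comment> \<open>The diagonal coefficients carry 1/2 because \<open>br\<close> of a form with
    itself counts the commutator twice.\<close>
  have quad: "famform \<xi> t u (ee 1) (famform \<xi> t u (ee 2) v) - famform \<xi> t u (ee 2) (famform \<xi> t u (ee 1) v)
    = (x * x / 2) *\<^sub>R br (?N u) (?N u) v + (y * y / 2) *\<^sub>R br (?M u) (?M u) v + (p * p / 2) *\<^sub>R br (\<xi> u) (\<xi> u) v
      + (r * r / 2) *\<^sub>R br (?X u) (?X u) v + (x * y) *\<^sub>R br (?N u) (?M u) v + (x * p) *\<^sub>R br (\<xi> u) (?N u) v
      + (x * r) *\<^sub>R br (?X u) (?N u) v + (y * p) *\<^sub>R br (\<xi> u) (?M u) v + (y * r) *\<^sub>R br (?X u) (?M u) v + (p * r) *\<^sub>R br (\<xi> u) (?X u) v"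
  proof -
    have 2: "(a / 2) *\<^sub>R br \<alpha> \<alpha> v = a *\<^sub>R (\<alpha> (ee 1) (\<alpha> (ee 2) v) - \<alpha> (ee 2) (\<alpha> (ee 1) v))" for a and \<alpha> :: "real^2 \<Rightarrow> 'm lorentz \<Rightarrow> 'm lorentz"
    proof -
      have "br \<alpha> \<alpha> v = 2 *\<^sub>R (\<alpha> (ee 1) (\<alpha> (ee 2) v) - \<alpha> (ee 2) (\<alpha> (ee 1) v))"
        unfolding br_def scaleR_2 by simp
      then show ?thesis by simp
    qed
    show ?thesis
      unfolding famform_def c[symmetric] 2 unfolding br_def
      by (simp add: linear_add[OF l2(1)] linear_scale[OF l2(1)] linear_add[OF l2(2)] linear_scale[OF l2(2)]
        linear_add[OF l2(3)] linear_scale[OF l2(3)] linear_add[OF l2(4)] linear_scale[OF l2(4)]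
        scaleR_add_right scaleR_diff_right mult.commute[of y x] mult.commute[of p x] mult.commute[of r x]
        mult.commute[of p y] mult.commute[of r y] mult.commute[of r p])
  qed
  \<comment> \<open>Symmetry of the bracket and the second rule of \<open>hodge_brackets\<close>
    make the bracket of a form with its own star equal to its negative.\<close>
  have neg: "y = 0" if "y = - y" for y :: "'m lorentz"
  proof -
    have "2 *\<^sub>R y = 0" using that by (metis add.right_inverse scaleR_2)
    then show ?thesis by simp
  qed
  have MM: "br (?M u) (?M u) v = br (?N u) (?N u) v" "br (?N u) (?M u) v = 0"
    "br (?X u) (?N u) v = - br (\<xi> u) (?M u) v" "br (?X u) (?M u) v = br (\<xi> u) (?N u) v"
    "br (?X u) (?X u) v = 0" "br (\<xi> u) (?X u) v = 0"
    using hodge_brackets[OF u N N, of v] hodge_brackets[OF u x N, of v] hodge_brackets[OF u x x, of v]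
      br_sym[of "?M u" "?N u" v] br_sym[of "?X u" "\<xi> u" v] comm
    by (auto intro!: neg)
  define nn a b where "nn = br (?N u) (?N u) v" "a = br (\<xi> u) (?N u) v" "b = br (\<xi> u) (?M u) v"
  \<comment> \<open>The coefficients of the three independent brackets \<open>nn\<close>,
    \<open>a\<close> and \<open>b\<close>. That the first two vanish and the third is - sin t is
    what the factor 1/2 and the double angle achieve.\<close>
  have k: "x + x * x / 2 + y * y / 2 = 0" "p + x * p + y * r = 0" "- r + y * p - x * r = - y"
  proof -
    have yy: "y * y = 1 - cos t * cos t" unfolding c using sin_cos_squared_add[of t] by (simp add: power2_eq_square)
    have p: "p = cos t * cos t - 1" and r: "r = y * cos t"
      unfolding c cos_double sin_double using yy[unfolded c] by (simp_all add: power2_eq_square)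
    have yyz: "y * (y * w) = (1 - cos t * cos t) * w" for w unfolding yy[symmetric] by simp
    show "x + x * x / 2 + y * y / 2 = 0" unfolding yy c(1) by (simp add: field_simps)
    show "p + x * p + y * r = 0" unfolding p r yyz c(1) by (simp add: algebra_simps)
    show "- r + y * p - x * r = - y" unfolding p r c(1) by (simp add: algebra_simps)
  qed
  have "curv (famform \<xi> t) u (ee 1) (ee 2) v =
      x *\<^sub>R nn + y *\<^sub>R dsp ?M u v + p *\<^sub>R (dsp \<xi> u v + a) + r *\<^sub>R (dsp ?X u v - b)
      + ((x * x / 2) *\<^sub>R nn + (y * y / 2) *\<^sub>R nn + (x * p) *\<^sub>R a - (x * r) *\<^sub>R b + (y * p) *\<^sub>R b + (y * r) *\<^sub>R a)"
  proof -
    have "curv (famform \<xi> t) u (ee 1) (ee 2) v =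
       x *\<^sub>R (dird (ee 1) (\<lambda>w. ?N w (ee 2) v) u - dird (ee 2) (\<lambda>w. ?N w (ee 1) v) u)
       + y *\<^sub>R (dird (ee 1) (\<lambda>w. ?M w (ee 2) v) u - dird (ee 2) (\<lambda>w. ?M w (ee 1) v) u)
       + p *\<^sub>R (dird (ee 1) (\<lambda>w. \<xi> w (ee 2) v) u - dird (ee 2) (\<lambda>w. \<xi> w (ee 1) v) u)
       + r *\<^sub>R (dird (ee 1) (\<lambda>w. ?X w (ee 2) v) u - dird (ee 2) (\<lambda>w. ?X w (ee 1) v) u)
       + (famform \<xi> t u (ee 1) (famform \<xi> t u (ee 2) v) - famform \<xi> t u (ee 2) (famform \<xi> t u (ee 1) v))"
      unfolding curv_def D by (simp add: scaleR_diff_right)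
    then show ?thesis
      unfolding NN DD[OF M] DD[OF x] DD[OF X] quad MM comm br_sym[of "?N u" "\<xi> u"] br_sym[of "?N u" "?X u"] nn_a_b_def[symmetric]
      by simp
  qed
  also have "\<dots> = y *\<^sub>R dsp ?M u v + p *\<^sub>R dsp \<xi> u v + r *\<^sub>R dsp ?X u v
     + (x + x * x / 2 + y * y / 2) *\<^sub>R nn + (p + x * p + y * r) *\<^sub>R a + (- r + y * p - x * r) *\<^sub>R b"
    by (simp add: algebra_simps)
  finally show ?thesis unfolding k unfolding c nn_a_b_def by (simp add: algebra_simps)
qed

lemma flat_family_iff:
  assumes x: "so_form \<xi>" and comm: "\<And>u v. u \<in> W \<Longrightarrow> br (\<xi> u) (\<xi> u) v = 0"
  shows "(\<forall>t. flat_on W (family_conn V s \<xi> t)) \<longleftrightarrow> (\<forall>u\<in>W. \<forall>v. dsp \<xi> u v = 0 \<and> dsp (hodge_endo s \<xi>) u v = 0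
     \<and> dsp (hodge_endo s (NV V)) u v - br (\<xi> u) (hodge_endo s (NV V) u) v = 0)"
proof -
  note fi = flat_iff[OF so_form_famform[OF x] family_conn_eq]
  have "(\<forall>t. flat_on W (family_conn V s \<xi> t)) \<longleftrightarrow> (\<forall>u\<in>W. \<forall>v. \<forall>t. curv (famform \<xi> t) u (ee 1) (ee 2) v = 0)"
    unfolding fi by blast
  also have "\<dots> \<longleftrightarrow> (\<forall>u\<in>W. \<forall>v. dsp \<xi> u v = 0 \<and> dsp (hodge_endo s \<xi>) u v = 0
     \<and> dsp (hodge_endo s (NV V)) u v - br (\<xi> u) (hodge_endo s (NV V) u) v = 0)"
  proof (intro ball_cong refl all_cong1)
    fix u :: "real^2" and v assume u: "u \<in> W"
    note cf = curv_famform[OF u x comm[OF u], of _ v]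
    let ?T = "dsp (hodge_endo s (NV V)) u v - br (\<xi> u) (hodge_endo s (NV V) u) v"
    show "(\<forall>t. curv (famform \<xi> t) u (ee 1) (ee 2) v = 0) \<longleftrightarrow> (dsp \<xi> u v = 0 \<and> dsp (hodge_endo s \<xi>) u v = 0 \<and> ?T = 0)"
    proof
      assume *: "\<forall>t. curv (famform \<xi> t) u (ee 1) (ee 2) v = 0"
      \<comment> \<open>At the angles pi/2 and -pi/2 the term in sin 2t drops out, and the two signs
        of sin t separate the other terms; pi/4 then isolates the derivative of *\<xi>.\<close>
      have "?T - dsp \<xi> u v = 0" "- ?T - dsp \<xi> u v = 0"
        using *[rule_format, of "pi / 2"] *[rule_format, of "- (pi / 2)"] unfolding cf by simp_all
      then have e: "?T = dsp \<xi> u v" "?T = - dsp \<xi> u v" by (simp_all add: algebra_simps eq_neg_iff_add_eq_0)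
      then have "2 *\<^sub>R dsp \<xi> u v = 0" by (metis scaleR_2 add.right_inverse)
      then have 1: "dsp \<xi> u v = 0" "?T = 0" using e by auto
      have "(sin (2 * (pi / 4)) / 2) *\<^sub>R dsp (hodge_endo s \<xi>) u v = 0"
        using *[rule_format, of "pi / 4"] unfolding cf 1 by simp
      then show "dsp \<xi> u v = 0 \<and> dsp (hodge_endo s \<xi>) u v = 0 \<and> ?T = 0" using 1 by simp
    qed (simp add: cf)
  qed
  finally show ?thesis .
qed

section \<open>The local equivalences\<close>

lemma s_nz: "u \<in> W \<Longrightarrow> s u \<noteq> 0"
  using frame_lor(3)[of u] by (auto simp: lor_zero_left)

text \<open>A skew map that kills \<open>s\<close> and \<open>ds\<close> has image orthogonal to
  them, and its value at \<open>z\<close> is orthogonal to \<open>z\<close>. The blocks left are the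
  normal part at \<open>z\<close> and the map of the normal bundle to itself, which are the last two
  premises.\<close>

lemma so_zero:
  assumes u: "u \<in> W" and skew: "\<And>v x. lor (T v) x = - lor v (T x)"
    and s: "T (s u) = 0" and S: "\<And>i. T (S i u) = 0"
    and z: "\<And>x. PV u x = 0 \<Longrightarrow> lor (T (z u)) x = 0"
    and p: "\<And>x y. PV u x = 0 \<Longrightarrow> PV u y = 0 \<Longrightarrow> lor (T x) y = 0"
  shows "T v = 0"
proof -
  have sS: "lor (T v) (s u) = 0" "lor (T v) (S i u) = 0" for v i
    by (simp_all add: skew s S lor_simps)
  have pp: "PV u (x - PV u x) = 0" for x by (simp add: PV_lin PV_idem[OF u])
  have split: "lor (T v) x = lor (T v) (x - PV u x)" if "PV u (T v) = 0" for v x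
    using that by (simp add: lor_simps PV_self_adjoint[symmetric])
  have "lor (T (z u)) (z u) = 0" using skew[of "z u" "z u"] by (simp add: lor_sym)
  then have pz: "PV u (T (z u)) = 0" by (simp add: perp_frame_iff[OF u] sS)
  have Tz: "T (z u) = 0"
  proof (rule lor_eqI)
    fix x show "lor (T (z u)) x = lor 0 x"
      using split[OF pz, of x] z[OF pp, of x] by (simp only: lor_zero_left)
  qed
  have P: "PV u (T v) = 0" for v
    by (simp add: perp_frame_iff[OF u] sS skew[of v "z u"] Tz lor_simps)
  show ?thesis
  proof (rule lor_eqI)
    fix x
    have "lor (T v) x = lor (T v) (x - PV u x)" by (rule split[OF P])
    also have "\<dots> = - lor (T (x - PV u x)) v" by (simp only: skew[of v] lor_sym[of v])
    also have "\<dots> = - lor (T (x - PV u x)) (v - PV u v)" by (rule arg_cong[OF split[OF P]])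
    also have "\<dots> = 0" by (simp add: p pp)
    finally show "lor (T v) x = lor 0 x" by (simp add: lor_zero_left)
  qed
qed

lemma split_cong:
  assumes "u \<in> W" "\<And>w. w \<in> W \<Longrightarrow> f w = g w"
  shows "split_conn V X f u = split_conn V X g u"
proof -
  have "dird X (\<lambda>w. lproj (V w) (f w)) u = dird X (\<lambda>w. lproj (V w) (g w)) u"
    "dird X (\<lambda>w. lproj (lperp (V w)) (f w)) u = dird X (\<lambda>w. lproj (lperp (V w)) (g w)) u"
    by (rule dird_cong[OF W assms(1)]; simp add: assms(2))+
  then show ?thesis by (simp add: split_conn_def ind_conn_def)
qed

lemma split_zero: "u \<in> W \<Longrightarrow> (\<And>w. w \<in> W \<Longrightarrow> f w = 0) \<Longrightarrow> split_conn V X f u = 0"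
  using split_cong[of u f "\<lambda>_. 0" X] split_const[of u X 0] linear_0[OF linear_NV, of u X] by simp

lemma split_perp:
  assumes u: "u \<in> W" and f: "f differentiable (at u)" and p: "\<And>w. w \<in> W \<Longrightarrow> PV w (f w) = 0"
  shows "split_conn V X f u = nab X f u" "PV u (split_conn V X f u) = 0"
proof -
  show 1: "split_conn V X f u = nab X f u"
    by (simp add: split_conn_NV[OF u f] NV_perp_section[OF u f p] nab_eq[OF u])
  show "PV u (split_conn V X f u) = 0"
    unfolding 1 nab_eq[OF u] by (simp add: PV_lin PV_idem[OF u])
qed

lemma split_V:
  assumes u: "u \<in> W" and f: "f differentiable (at u)" and p: "\<And>w. w \<in> W \<Longrightarrow> PV w (f w) = f w"
  shows "split_conn V X f u = PV u (dird X f u)" "PV u (split_conn V X f u) = split_conn V X f u"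
proof -
  show 1: "split_conn V X f u = PV u (dird X f u)"
    by (simp add: split_conn_NV[OF u f] NV_V_section[OF u f p])
  show "PV u (split_conn V X f u) = split_conn V X f u"
    unfolding 1 by (simp add: PV_idem[OF u])
qed

lemma split_s: "u \<in> W \<Longrightarrow> split_conn V (ee i) s u = S i u"
  using split_V(1)[OF _ diffI[OF smooth_s] PV_frame(1)] by (simp add: PV_frame)

lemma split_S: "u \<in> W \<Longrightarrow> split_conn V (ee i) (S j) u =
    \<Gamma> 1 i j u *\<^sub>R S 1 u + \<Gamma> 2 i j u *\<^sub>R S 2 u + gg i j u *\<^sub>R z u - \<rho> i j u *\<^sub>R s u"
  using split_V(1)[OF _ diffI[OF smooth_S] PV_frame(3)] by (simp add: PV_dS)

lemma split_z: "u \<in> W \<Longrightarrow> split_conn V (ee i) z u =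
    - (up 1 u (\<rho> i 1 u) (\<rho> i 2 u) *\<^sub>R S 1 u) - up 2 u (\<rho> i 1 u) (\<rho> i 2 u) *\<^sub>R S 2 u"
  using split_V(1)[OF _ diffI[OF smooth_z] PV_frame(2)] by (simp add: PV_dz)

section \<open>Closed forms with values in the nilpotent algebra\<close>

text \<open>The values on the normal bundle are left open: in (ii) they may be nonzero a priori, and
  their vanishing is derived from closedness.\<close>

definition null_form :: "(real^2 \<Rightarrow> real^2 \<Rightarrow> 'm lorentz \<Rightarrow> 'm lorentz) \<Rightarrow> (2 \<Rightarrow> 2 \<Rightarrow> real^2 \<Rightarrow> real) \<Rightarrow> bool" where
  "null_form \<alpha> a \<longleftrightarrow> so_form \<alpha> \<and> (\<forall>w\<in>W. \<forall>i. \<alpha> w (ee i) (s w) = 0 \<and> (\<forall>j. \<alpha> w (ee i) (S j w) = - (a i j w *\<^sub>R s w)))"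

lemma null_formD:
  assumes "null_form \<alpha> a"
  shows "so_form \<alpha>" "u \<in> W \<Longrightarrow> \<alpha> u (ee i) (s u) = 0" "u \<in> W \<Longrightarrow> \<alpha> u (ee i) (S j u) = - (a i j u *\<^sub>R s u)"
  using assms by (auto simp: null_form_def)

text \<open>The coefficient is recovered by pairing with \<open>z\<close>, because the product of
  \<open>s\<close> and \<open>z\<close> is -1.\<close>

lemma null_form_diff:
  assumes n: "null_form \<alpha> a" and u: "u \<in> W" shows "a i j differentiable (at u)"
proof (rule differentiable_cong_open[OF W u])
  show "lor (\<alpha> w (ee i) (S j w)) (z w) = a i j w" if w: "w \<in> W" for w
    by (simp add: null_formD(2,3)[OF n w] lor_simps frame_lor[OF w])
  show "(\<lambda>w. lor (\<alpha> w (ee i) (S j w)) (z w)) differentiable (at u)"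
    by (intro differentiable_lor dird_form(2)[OF null_formD(1)[OF n] u] diffI[OF smooth_S u] diffI[OF smooth_z u])
qed

lemma null_form_z:
  assumes n: "null_form \<alpha> a" and u: "u \<in> W"
  shows "PV u (\<alpha> u (ee i) (z u)) = - (up 1 u (a i 1 u) (a i 2 u) *\<^sub>R S 1 u) - up 2 u (a i 1 u) (a i 2 u) *\<^sub>R S 2 u"
    "lor (\<alpha> u (ee i) (z u)) (z u) = 0" "lor (\<alpha> u (ee i) (z u)) (s u) = 0" "lor (\<alpha> u (ee i) (z u)) (S j u) = - a i j u"
proof -
  note k = so_formD(5)[OF null_formD(1)[OF n] u]
  show 1: "lor (\<alpha> u (ee i) (z u)) (z u) = 0" using k[of "ee i" "z u" "z u"] by (simp add: lor_sym)
  show 2: "lor (\<alpha> u (ee i) (z u)) (s u) = 0" by (simp add: k[of _ "z u"] null_formD(2,3)[OF n u] lor_simps)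
  show 3: "lor (\<alpha> u (ee i) (z u)) (S j u) = - a i j u" for j
    by (simp add: k[of _ "z u"] null_formD(2,3)[OF n u] lor_simps frame_lor[OF u])
  show "PV u (\<alpha> u (ee i) (z u)) = - (up 1 u (a i 1 u) (a i 2 u) *\<^sub>R S 1 u) - up 2 u (a i 1 u) (a i 2 u) *\<^sub>R S 2 u"
    unfolding PV_def 1 2 3 by (simp add: up_linear)
qed

text \<open>The form kills \<open>s\<close>, and the derivative of \<open>s\<close> is
  \<open>ds\<close>; so at \<open>s\<close> only the skew part of the coefficients is seen.\<close>

lemma dsp_null_s:
  assumes n: "null_form \<alpha> a" and u: "u \<in> W"
  shows "dsp \<alpha> u (s u) = (a 2 1 u - a 1 2 u) *\<^sub>R s u"
  unfolding dsp_section[OF null_formD(1)[OF n] u diffI[OF smooth_s u]]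
  by (simp add: split_zero[OF u] null_formD(2,3)[OF n] u split_s algebra_simps)

text \<open>The component \<open>(d\<^sup>D a)\<^sub>1\<^sub>2\<^sub>k\<close> of a \<open>T\<^sup>*\<Sigma>\<close>-valued \<open>1\<close>-form \<open>a\<close>; the remaining Christoffel terms cancel by symmetry.\<close>

definition cu :: "(2 \<Rightarrow> 2 \<Rightarrow> real^2 \<Rightarrow> real) \<Rightarrow> 2 \<Rightarrow> real^2 \<Rightarrow> real" where
  "cu a k u = dird (ee 1) (a 2 k) u - (\<Gamma> 1 1 k u * a 2 1 u + \<Gamma> 2 1 k u * a 2 2 u)
    - (dird (ee 2) (a 1 k) u - (\<Gamma> 1 2 k u * a 1 1 u + \<Gamma> 2 2 k u * a 1 2 u))"

text \<open>The \<open>z\<close> component of the derivative of \<open>ds\<close> brings in \<alpha>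
  z, and through it the normal part of \<alpha> becomes visible.\<close>

lemma dsp_null_S:
  assumes n: "null_form \<alpha> a" and u: "u \<in> W"
  shows "dsp \<alpha> u (S k u) = a 1 k u *\<^sub>R S 2 u - cu a k u *\<^sub>R s u - a 2 k u *\<^sub>R S 1 u
     - gg 1 k u *\<^sub>R \<alpha> u (ee 2) (z u) + gg 2 k u *\<^sub>R \<alpha> u (ee 1) (z u)"
proof -
  note d = null_form_diff[OF n u] and ds = diffI[OF smooth_s u] and l = so_formD(2)[OF null_formD(1)[OF n] u]
  have m: "(\<lambda>w. - (a i k w *\<^sub>R s w)) differentiable (at u)" for i
    by (intro differentiable_minus differentiable_scaleR d ds)
  have "split_conn V (ee j) (\<lambda>w. \<alpha> w (ee i) (S k w)) u = - (dird (ee j) (a i k) u *\<^sub>R s u + a i k u *\<^sub>R S j u)" for i j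
  proof -
    have "split_conn V (ee j) (\<lambda>w. \<alpha> w (ee i) (S k w)) u = split_conn V (ee j) (\<lambda>w. - (a i k w *\<^sub>R s w)) u"
      by (rule split_cong[OF u]) (rule null_formD(3)[OF n])
    then show ?thesis
      unfolding split_conn_NV[OF u m]
      by (simp add: dird_minus differentiable_scaleR dird_scaleR d ds linear_neg[OF linear_NV[OF u]]
          linear_scale[OF linear_NV[OF u]] NV_frame[OF u])
  qed
  then show ?thesis
    unfolding dsp_section[OF null_formD(1)[OF n] u diffI[OF smooth_S u]] split_S[OF u]
    by (simp add: linear_add[OF l] linear_diff[OF l] linear_scale[OF l] null_formD(2,3)[OF n u] cu_def algebra_simps)
qed

text \<open>Each conclusion is one component of closedness: the value at \<open>s\<close> gives
  symmetry, and the value at \<open>S k\<close> gives \<open>cu\<close> when paired with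
  \<open>z\<close>, the trace when paired with a tangent vector, and the vanishing of the normal
  part of \<alpha> z in the normal direction.\<close>

lemma dsp_null_zero_imp:
  assumes n: "null_form \<alpha> a" and u: "u \<in> W" and zero: "\<And>v. dsp \<alpha> u v = 0"
  shows "a 2 1 u = a 1 2 u" "PV u (\<alpha> u (ee i) (z u)) = \<alpha> u (ee i) (z u)"
    "gg 2 2 u * a 1 1 u - 2 * gg 1 2 u * a 1 2 u + gg 1 1 u * a 2 2 u = 0" "cu a k u = 0"
proof -
  show sym: "a 2 1 u = a 1 2 u" using zero[of "s u"] s_nz[OF u] by (simp add: dsp_null_s[OF n u])
  let ?b = "\<lambda>i. \<alpha> u (ee i) (z u) - PV u (\<alpha> u (ee i) (z u))"
  have Z: "a 1 k u *\<^sub>R S 2 u - cu a k u *\<^sub>R s u - a 2 k u *\<^sub>R S 1 u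
     - gg 1 k u *\<^sub>R \<alpha> u (ee 2) (z u) + gg 2 k u *\<^sub>R \<alpha> u (ee 1) (z u) = 0" for k
    using zero[of "S k u"] unfolding dsp_null_S[OF n u] .
  have B: "gg 2 k u *\<^sub>R ?b 1 = gg 1 k u *\<^sub>R ?b 2" for k
    using arg_cong[OF Z[of k], of "\<lambda>v. v - PV u v"]
    by (simp add: PV_lin PV_frame[OF u] algebra_simps)
  have "dg u *\<^sub>R ?b 1 = gg 1 1 u *\<^sub>R (gg 2 2 u *\<^sub>R ?b 1) - gg 1 2 u *\<^sub>R (gg 2 1 u *\<^sub>R ?b 1)"
    by (simp add: dg_def gg_sym algebra_simps)
  \<comment> \<open>The two equations \<open>B\<close> are a homogeneous linear system for the
    normal parts, with determinant \<open>dg u\<close>.\<close>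
  also have "\<dots> = 0" unfolding B by (simp add: gg_sym mult.commute)
  finally have 1: "?b 1 = 0" using dg_nz[OF u] by simp
  then have "gg 1 1 u *\<^sub>R ?b 2 = 0" using B[of 1] by simp
  then have 2: "?b 2 = 0" using gg11_pos[OF u] by simp
  show "PV u (\<alpha> u (ee i) (z u)) = \<alpha> u (ee i) (z u)" using 1 2 exhaust_2[of i] by auto
  show "cu a k u = 0"
    using arg_cong[OF Z[of k], of "\<lambda>v. lor v (z u)"] by (simp add: lor_simps frame_lor[OF u] null_form_z[OF n u])
  show "gg 2 2 u * a 1 1 u - 2 * gg 1 2 u * a 1 2 u + gg 1 1 u * a 2 2 u = 0"
    using arg_cong[OF Z[of 1], of "\<lambda>v. lor v (S 2 u)"]
    by (simp add: lor_simps frame_lor[OF u] null_form_z[OF n u] sym gg_sym algebra_simps)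
qed

text \<open>By \<open>so_zero\<close> only \<open>s\<close>, \<open>ds\<close> and the normal bundle
  need checking. The connection preserves the normal bundle, which \<alpha> kills, so the derivative
  kills it too and skewness settles the value at \<open>z\<close>.\<close>

lemma dsp_null_zero:
  assumes n: "null_form \<alpha> a" and u: "u \<in> W"
    and p: "\<And>w i x. w \<in> W \<Longrightarrow> PV w x = 0 \<Longrightarrow> \<alpha> w (ee i) x = 0"
    and sym: "a 2 1 u = a 1 2 u"
    and tr: "gg 2 2 u * a 1 1 u - 2 * gg 1 2 u * a 1 2 u + gg 1 1 u * a 2 2 u = 0" and cu: "\<And>k. cu a k u = 0"
  shows "dsp \<alpha> u v = 0"
proof (rule so_zero[OF u, of "dsp \<alpha> u"])
  note so = null_formD(1)[OF n]
  show "lor (dsp \<alpha> u v) x = - lor v (dsp \<alpha> u x)" for v x by (rule dsp_skew[OF so u])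
  show "dsp \<alpha> u (s u) = 0" by (simp add: dsp_null_s[OF n u] sym)
  have pp: "PV w (x - PV w x) = 0" if "w \<in> W" for w x by (simp add: PV_lin PV_idem[OF that])
  have az: "PV u (\<alpha> u (ee i) (z u)) = \<alpha> u (ee i) (z u)" for i
  proof -
    have "\<alpha> u (ee i) (z u) - PV u (\<alpha> u (ee i) (z u)) = 0"
    proof (rule lor_eqI)
      fix x
      have "lor (\<alpha> u (ee i) (z u) - PV u (\<alpha> u (ee i) (z u))) x = lor (\<alpha> u (ee i) (z u)) (x - PV u x)"
        by (simp add: lor_simps PV_self_adjoint)
      also have "\<dots> = 0" unfolding so_formD(5)[OF so u, of _ "z u"] by (simp add: p[OF u] pp[OF u] lor_simps)
      finally show "lor (\<alpha> u (ee i) (z u) - PV u (\<alpha> u (ee i) (z u))) x = lor 0 x" by (simp add: lor_zero_left)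
    qed
    then show ?thesis by simp
  qed
  show "dsp \<alpha> u (S k u) = 0" for k
  proof -
    let ?x = "dsp \<alpha> u (S k u)"
    have "PV u ?x = ?x"
      unfolding dsp_null_S[OF n u]
      by (simp add: PV_lin PV_frame[OF u] az)
    moreover have "PV u ?x = 0"
      unfolding perp_frame_iff[OF u] dsp_null_S[OF n u] cu using exhaust_2[of k] tr
      by (auto simp: lor_simps frame_lor[OF u] null_form_z[OF n u] sym gg_sym algebra_simps)
    ultimately show ?thesis by simp
  qed
  have T: "dsp \<alpha> u x = 0" if x: "PV u x = 0" for x
  proof -
    \<comment> \<open>A normal vector is extended to a normal section, on which both the connection
      and \<alpha> are controlled.\<close>
    let ?f = "\<lambda>w. x - PV w x"
    have f: "?f differentiable (at u)" by (intro differentiable_diff differentiable_const diffI[OF smooth_PV u])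
    have "dsp \<alpha> u (?f u) = 0"
      unfolding dsp_section[OF so u f]
      by (simp add: split_zero[OF u] p pp u split_perp(2)[OF u f pp])
    then show ?thesis using x by simp
  qed
  show "lor (dsp \<alpha> u (z u)) x = 0" if "PV u x = 0" for x
    unfolding dsp_skew[OF so u, of "z u"] by (simp add: T[OF that] lor_simps)
  show "lor (dsp \<alpha> u x) y = 0" if "PV u x = 0" for x y
    by (simp add: T[OF that] lor_simps)
qed

section \<open>The abelian algebra attached to a null line\<close>

lemma stab_perpD:
  assumes "T \<in> stab_perp (span {s u})"
  shows "T \<in> so_lor" "T (s u) = 0" "\<And>v. lor v (s u) = 0 \<Longrightarrow> \<exists>c. T v = c *\<^sub>R s u"
proof -
  show "T \<in> so_lor" "T (s u) = 0" using assms by (auto simp: stab_perp_def span_base)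
  fix v assume "lor v (s u) = 0"
  then have "v \<in> lperp (span {s u})" by (auto simp: lperp_def span_singleton lor_simps)
  then have "T v \<in> span {s u}" using assms by (auto simp: stab_perp_def)
  then show "\<exists>c. T v = c *\<^sub>R s u" by (auto simp: span_singleton)
qed

text \<open>On the complement of \<open>s\<close> both products vanish, since one factor maps into
  the null line and the other kills it. On \<open>z\<close> both are multiples of \<open>s\<close>,
  and skewness turns the two coefficients into the same product of \<open>A z\<close> and
  \<open>B z\<close>.\<close>

lemma stab_perp_commute:
  assumes u: "u \<in> W" and A: "A \<in> stab_perp (span {s u})" and B: "B \<in> stab_perp (span {s u})"
  shows "A (B v) = B (A v)"
proof -
  note a = stab_perpD[OF A] and b = stab_perpD[OF B]
  have 0: "A' (B' x) = 0" if AB: "A' \<in> stab_perp (span {s u})" "B' \<in> stab_perp (span {s u})" "lor x (s u) = 0" for A' B' x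
  proof -
    obtain c where "B' x = c *\<^sub>R s u" using stab_perpD(3)[OF AB(2,3)] by blast
    then show ?thesis using stab_perpD(2)[OF AB(1)] linear_scale[OF so_lorD(1)[OF stab_perpD(1)[OF AB(1)]]] by simp
  qed
  have z: "A' (B' (z u)) = - lor (A' (B' (z u))) (z u) *\<^sub>R s u"
    if A': "A' \<in> stab_perp (span {s u})" and B': "B' \<in> stab_perp (span {s u})" for A' B'
  proof -
    have "lor (B' (z u)) (s u) = 0"
      unfolding so_lorD(2)[OF stab_perpD(1)[OF B']] by (simp add: stab_perpD(2)[OF B'] lor_simps)
    then obtain c where "A' (B' (z u)) = c *\<^sub>R s u" using stab_perpD(3)[OF A'] by blast
    then show ?thesis by (simp add: lor_simps frame_lor[OF u])
  qed
  have "lor (A (B (z u))) (z u) = lor (B (A (z u))) (z u)"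
    using so_lorD(2)[OF a(1), of "B (z u)" "z u"] so_lorD(2)[OF b(1), of "A (z u)" "z u"]
      lor_sym[of "A (z u)" "B (z u)"] by simp
  then have zz: "A (B (z u)) = B (A (z u))" using z[OF A B] z[OF B A] by simp
  define x where "x = v + lor v (s u) *\<^sub>R z u"
  have x: "lor x (s u) = 0" by (simp add: x_def lor_simps frame_lor[OF u])
  have "v = x - lor v (s u) *\<^sub>R z u" by (simp add: x_def)
  then have "A (B v) = A (B x) - lor v (s u) *\<^sub>R A (B (z u))" "B (A v) = B (A x) - lor v (s u) *\<^sub>R B (A (z u))"
    using linear_diff[OF so_lorD(1)[OF a(1)]] linear_diff[OF so_lorD(1)[OF b(1)]]
      linear_scale[OF so_lorD(1)[OF a(1)]] linear_scale[OF so_lorD(1)[OF b(1)]] by metis+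
  then show ?thesis by (simp add: zz 0[OF A B x] 0[OF B A x])
qed

lemma br_stab:
  assumes "u \<in> W" "\<And>X. \<alpha> X \<in> stab_perp (span {s u})" "\<And>X. \<beta> X \<in> stab_perp (span {s u})"
  shows "br \<alpha> \<beta> v = 0"
  unfolding br_def using stab_perp_commute[OF assms(1), of "\<alpha> _" "\<beta> _"] assms(2,3) by simp

lemma stab_null_form:
  assumes so: "so_form \<alpha>" and st: "\<And>w X. w \<in> W \<Longrightarrow> \<alpha> w X \<in> stab_perp (span {s w})"
  shows "null_form \<alpha> (\<lambda>i j w. lor (\<alpha> w (ee i) (S j w)) (z w))"
  unfolding null_form_def
proof (intro conjI so ballI allI)
  fix w i j assume w: "w \<in> W"
  show "\<alpha> w (ee i) (s w) = 0" by (rule stab_perpD(2)[OF st[OF w]])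
  obtain c where "\<alpha> w (ee i) (S j w) = c *\<^sub>R s w" using stab_perpD(3)[OF st[OF w]] frame_lor(6)[OF w] by blast
  then show "\<alpha> w (ee i) (S j w) = - (lor (\<alpha> w (ee i) (S j w)) (z w) *\<^sub>R s w)"
    by (simp add: lor_simps frame_lor[OF w])
qed

text \<open>The map is the bivector of \<open>s\<close> and \<open>w\<close>. It is the explicit
  witness for the definite description \<open>form_to_endo\<close> and for the form built from a
  quadratic differential.\<close>

lemma wedge_stab:
  assumes u: "u \<in> W" and w: "PV u w = w" "lor w (s u) = 0"
  shows "(\<lambda>v. lor v (s u) *\<^sub>R w - lor v w *\<^sub>R s u) \<in> stab_perp (span {s u}) \<inter> so_sub (V u)"
proof -
  let ?T = "\<lambda>v. lor v (s u) *\<^sub>R w - lor v w *\<^sub>R s u"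
  have so: "?T \<in> so_lor"
    by (rule so_lorI, rule linearI) (simp_all add: lor_simps lor_sym[of _ w] lor_sym[of _ "s u"] algebra_simps)
  moreover have "?T v = 0" if "v \<in> span {s u}" for v
    using that by (auto simp: span_singleton lor_simps frame_lor[OF u] lor_sym[of "s u" w] w)
  moreover have "?T v \<in> span {s u}" if "v \<in> lperp (span {s u})" for v
  proof -
    have "lor v (s u) = 0" using that by (auto simp: lperp_def span_base)
    then show ?thesis by (simp add: span_neg span_scale span_base)
  qed
  moreover have "?T v = 0" if "v \<in> lperp (V u)" for v
  proof -
    have p: "PV u v = 0" using that by (simp add: in_lperp_iff[OF u])
    have "lor v w = lor v (PV u w)" by (simp add: w)
    also have "\<dots> = 0" by (simp add: PV_self_adjoint[symmetric] p lor_simps)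
    finally show ?thesis using p by (simp add: perp_frame_iff[OF u])
  qed
  ultimately show ?thesis unfolding stab_perp_def so_sub_def by blast
qed

lemma so_sub_zero: "u \<in> W \<Longrightarrow> T \<in> so_sub (V u) \<Longrightarrow> PV u x = 0 \<Longrightarrow> T x = 0"
  by (auto simp: so_sub_def in_lperp_iff)

text \<open>Both maps kill \<open>s\<close> and the normal bundle, so they are determined by
  \<open>ds\<close>, and by skewness at \<open>z\<close>. The same fact later matches the local
  pieces of a form on overlaps of charts.\<close>

lemma stab_sub_unique:
  assumes u: "u \<in> W" and A: "A \<in> stab_perp (span {s u}) \<inter> so_sub (V u)" and B: "B \<in> stab_perp (span {s u}) \<inter> so_sub (V u)"
    and e: "\<And>i. A (S i u) = B (S i u)"
  shows "A = B"
proof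
  fix v
  have A': "A \<in> so_lor" "A (s u) = 0" "\<And>x. PV u x = 0 \<Longrightarrow> A x = 0"
    and B': "B \<in> so_lor" "B (s u) = 0" "\<And>x. PV u x = 0 \<Longrightarrow> B x = 0"
    using A B stab_perpD(1,2) so_sub_zero[OF u] by auto
  have "A v - B v = 0"
  proof (rule so_zero[OF u, of "\<lambda>v. A v - B v"])
    show k: "lor (A v - B v) x = - lor v (A x - B x)" for v x
      by (simp add: lor_simps so_lorD(2)[OF A'(1)] so_lorD(2)[OF B'(1)])
    show "lor (A (z u) - B (z u)) x = 0" if "PV u x = 0" for x
      unfolding k by (simp add: A'(3) B'(3) that lor_simps)
  qed (simp_all add: A' B' e lor_simps)
  then show "A v = B v" by simp
qed

lemma form_to_endo_eq:
  assumes u: "u \<in> W" and w: "PV u w = w" "lor w (s u) = 0" and b: "\<And>Y. b u X Y = lor w (dird Y s u)"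
  shows "form_to_endo V s b u X = (\<lambda>v. lor v (s u) *\<^sub>R w - lor v w *\<^sub>R s u)" (is "_ = ?T")
  unfolding form_to_endo_def
proof (rule the_equality)
  have ds: "lor (dird Y s u) (s u) = 0" for Y
    unfolding dird_expand[OF diffI[OF smooth_s u], of Y] by (simp add: lor_simps frame_lor[OF u])
  have T: "?T (dird Y s u) = - (b u X Y *\<^sub>R s u)" for Y by (simp add: ds b lor_sym[of "dird Y s u" w])
  then show "?T \<in> stab_perp (span {s u}) \<inter> so_sub (V u) \<and> (\<forall>Y. ?T (dird Y s u) = - (b u X Y *\<^sub>R s u))"
    using wedge_stab[OF u w] by blast
  fix T assume T': "T \<in> stab_perp (span {s u}) \<inter> so_sub (V u) \<and> (\<forall>Y. T (dird Y s u) = - (b u X Y *\<^sub>R s u))"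
  show "T = ?T"
  proof (rule stab_sub_unique[OF u _ wedge_stab[OF u w]])
    show "T \<in> stab_perp (span {s u}) \<inter> so_sub (V u)" using T' by blast
    show "T (S i u) = ?T (S i u)" for i using T T' by metis
  qed
qed

lemma Q_eq:
  assumes u: "u \<in> W"
  shows "form_to_endo V s (Qform V s) u X =
     (\<lambda>v. lor v (s u) *\<^sub>R ((1/4 * II_norm2 V s u) *\<^sub>R dird X s u) - lor v ((1/4 * II_norm2 V s u) *\<^sub>R dird X s u) *\<^sub>R s u)"
proof (rule form_to_endo_eq[OF u])
  note e = dird_expand[OF diffI[OF smooth_s u], of X]
  show "PV u ((1/4 * II_norm2 V s u) *\<^sub>R dird X s u) = (1/4 * II_norm2 V s u) *\<^sub>R dird X s u"
    unfolding e by (simp add: PV_lin PV_frame[OF u])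
  show "lor ((1/4 * II_norm2 V s u) *\<^sub>R dird X s u) (s u) = 0"
    unfolding e by (simp add: lor_simps frame_lor[OF u])
  show "Qform V s u X Y = lor ((1/4 * II_norm2 V s u) *\<^sub>R dird X s u) (dird Y s u)" for Y
    by (simp add: Qform_def metric_def lor_simps)
qed

lemma Q_stab:
  assumes u: "u \<in> W" shows "form_to_endo V s (Qform V s) u X \<in> stab_perp (span {s u})"
proof -
  note e = dird_expand[OF diffI[OF smooth_s u], of X]
  have "PV u ((1/4 * II_norm2 V s u) *\<^sub>R dird X s u) = (1/4 * II_norm2 V s u) *\<^sub>R dird X s u"
    "lor ((1/4 * II_norm2 V s u) *\<^sub>R dird X s u) (s u) = 0"
    unfolding e by (simp_all add: PV_lin PV_frame[OF u] lor_simps frame_lor[OF u])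
  from wedge_stab[OF u this] show ?thesis unfolding Q_eq[OF u] by blast
qed

lemma linear_Q:
  assumes u: "u \<in> W"
  shows "linear (\<lambda>X. form_to_endo V s (Qform V s) u X v)" "linear (form_to_endo V s (Qform V s) u X)"
proof -
  note l = linear_dird[OF diffI[OF smooth_s u]]
  show "linear (\<lambda>X. form_to_endo V s (Qform V s) u X v)"
    unfolding Q_eq[OF u] by (rule linearI) (simp_all add: linear_add[OF l] linear_scale[OF l] lor_simps algebra_simps)
  show "linear (form_to_endo V s (Qform V s) u X)"
    using so_lorD(1) stab_perpD(1)[OF Q_stab[OF u]] by blast
qed

end

section \<open>The star of \<N> and the Willmore operator\<close>

context central_frame
begin

abbreviation M :: "real^2 \<Rightarrow> real^2 \<Rightarrow> 'm lorentz \<Rightarrow> 'm lorentz" where "M \<equiv> hodge_endo s (NV V)"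

text \<open>The star acts on the form index \<open>i\<close> only; \<open>j\<close> is the index of
  the tangent vector to which the endomorphism is applied.\<close>

definition mB :: "2 \<Rightarrow> 2 \<Rightarrow> real^2 \<Rightarrow> 'm lorentz" where
  "mB i j w = (if i = 1 then hh 1 2 w *\<^sub>R BB 1 j w - hh 1 1 w *\<^sub>R BB 2 j w else hh 2 2 w *\<^sub>R BB 1 j w - hh 1 2 w *\<^sub>R BB 2 j w)"

definition m\<nu> :: "2 \<Rightarrow> real^2 \<Rightarrow> 'm lorentz" where
  "m\<nu> i w = (if i = 1 then hh 1 2 w *\<^sub>R \<nu> 1 w - hh 1 1 w *\<^sub>R \<nu> 2 w else hh 2 2 w *\<^sub>R \<nu> 1 w - hh 1 2 w *\<^sub>R \<nu> 2 w)"

lemma M_frame: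
  assumes u: "u \<in> W"
  shows "M u (ee i) (s u) = 0" "M u (ee i) (S j u) = - mB i j u" "M u (ee i) (z u) = m\<nu> i u"
  using exhaust_2[of i] by (auto simp: hodge_endo_ee(1,2)[OF u] NV_frame[OF u] mB_def m\<nu>_def algebra_simps)

lemma M_maps:
  assumes u: "u \<in> W"
  shows "PV u v = v \<Longrightarrow> PV u (M u (ee i) v) = 0" "PV u v = 0 \<Longrightarrow> PV u (M u (ee i) v) = M u (ee i) v"
  using exhaust_2[of i] NV_maps[OF u, of v]
  by (auto simp: hodge_endo_ee(1,2)[OF u] PV_lin)

lemma PV_mB: "u \<in> W \<Longrightarrow> PV u (mB i j u) = 0"
  by (simp add: mB_def PV_lin PV_BB)

lemma PV_m\<nu>: "u \<in> W \<Longrightarrow> PV u (m\<nu> i u) = 0"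
  by (simp add: m\<nu>_def PV_lin PV_\<nu>)

lemma diff_mB: "u \<in> W \<Longrightarrow> mB i j differentiable (at u)"
  unfolding mB_def[abs_def] using diffI[OF smooth_BB]
  by (cases "i = 1") (auto intro!: differentiable_diff differentiable_scaleR diff_hh)

lemma diff_m\<nu>: "u \<in> W \<Longrightarrow> m\<nu> i differentiable (at u)"
  unfolding m\<nu>_def[abs_def] using diffI[OF smooth_\<nu>]
  by (cases "i = 1") (auto intro!: differentiable_diff differentiable_scaleR diff_hh)

text \<open>The skew part of the star of a symmetric form is its trace, and II is tracefree.\<close>

lemma mB_sym:
  assumes u: "u \<in> W" shows "mB 2 1 u = mB 1 2 u"
proof -
  have "mB 2 1 u - mB 1 2 u = (1 / sqrt (dg u)) *\<^sub>R (gg 2 2 u *\<^sub>R BB 1 1 u - (2 * gg 1 2 u) *\<^sub>R BB 1 2 u + gg 1 1 u *\<^sub>R BB 2 2 u)"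
    by (simp add: mB_def hh_def BB_sym[OF u, of 2 1] algebra_simps, simp only: mult_2 scaleR_left_distrib add_divide_distrib)
  then show ?thesis by (simp add: tf[OF u])
qed

text \<open>As with \<nu>, the exterior derivative of the star is the divergence times the volume
  density, and the divergence of II is - \<nu> by \<open>div_cB\<close>.\<close>

lemma nab_mB:
  assumes u: "u \<in> W"
  shows "nab (ee 1) (mB 2 k) u - \<Gamma> 1 1 k u *\<^sub>R mB 2 1 u - \<Gamma> 2 1 k u *\<^sub>R mB 2 2 u
     - (nab (ee 2) (mB 1 k) u - \<Gamma> 1 2 k u *\<^sub>R mB 1 1 u - \<Gamma> 2 2 k u *\<^sub>R mB 1 2 u) = - (sqrt (dg u) *\<^sub>R \<nu> k u)"
proof -
  have n: "nab (ee l) (\<lambda>w. hh a b w *\<^sub>R BB 1 k w - hh c d w *\<^sub>R BB 2 k w) u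
     = dird (ee l) (hh a b) u *\<^sub>R BB 1 k u + hh a b u *\<^sub>R nab (ee l) (BB 1 k) u
       - dird (ee l) (hh c d) u *\<^sub>R BB 2 k u - hh c d u *\<^sub>R nab (ee l) (BB 2 k) u" for l a b c d
    by (simp add: nab_eq[OF u] dird_diff dird_scaleR differentiable_scaleR diff_hh[OF u] diffI[OF smooth_BB u]
       PV_lin PV_BB[OF u] algebra_simps)
  have c: "nab (ee l) (BB i k) u = cB l i k u
    + (\<Gamma> 1 l i u *\<^sub>R BB 1 k u + \<Gamma> 2 l i u *\<^sub>R BB 2 k u) + (\<Gamma> 1 l k u *\<^sub>R BB i 1 u + \<Gamma> 2 l k u *\<^sub>R BB i 2 u)" for l i
    by (simp add: cB_eq[OF u])
  have "nab (ee 1) (mB 2 k) u - \<Gamma> 1 1 k u *\<^sub>R mB 2 1 u - \<Gamma> 2 1 k u *\<^sub>R mB 2 2 u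
     - (nab (ee 2) (mB 1 k) u - \<Gamma> 1 2 k u *\<^sub>R mB 1 1 u - \<Gamma> 2 2 k u *\<^sub>R mB 1 2 u)
     = hh 2 2 u *\<^sub>R cB 1 1 k u - hh 1 2 u *\<^sub>R cB 1 2 k u - hh 1 2 u *\<^sub>R cB 2 1 k u + hh 1 1 u *\<^sub>R cB 2 2 k u"
    unfolding mB_def[abs_def] if_True if_False
    by (simp add: n c dhh[OF u] \<Gamma>_sym[OF u, of _ 2 1] algebra_simps, simp only: mult_2 scaleR_left_distrib add_ac)
  also have "\<dots> = (1 / sqrt (dg u)) *\<^sub>R (gg 2 2 u *\<^sub>R cB 1 1 k u - gg 1 2 u *\<^sub>R cB 1 2 k u - gg 1 2 u *\<^sub>R cB 2 1 k u + gg 1 1 u *\<^sub>R cB 2 2 k u)"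
    by (simp add: hh_def algebra_simps)
  also have "\<dots> = - (sqrt (dg u) *\<^sub>R \<nu> k u)"
    unfolding div_cB[OF u] using dg_pos[OF u] by (simp add: real_div_sqrt)
  finally show ?thesis .
qed

text \<open>This is the contribution of the \<open>z\<close> component of the derivative of
  \<open>ds\<close>. It cancels \<open>nab_mB\<close>, which is why the derivative of *\<N> vanishes
  on \<open>ds\<close>.\<close>

lemma m\<nu>_metric:
  assumes u: "u \<in> W"
  shows "gg 2 k u *\<^sub>R m\<nu> 1 u - gg 1 k u *\<^sub>R m\<nu> 2 u = - (sqrt (dg u) *\<^sub>R \<nu> k u)"
proof -
  have r: "sqrt (dg u) = (gg 1 1 u * gg 2 2 u - gg 1 2 u * gg 1 2 u) / sqrt (dg u)"
    using dg_pos[OF u] by (simp add: dg_def[symmetric] real_div_sqrt)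
  show ?thesis
    using exhaust_2[of k] by (subst r) (auto simp: m\<nu>_def hh_def gg_sym algebra_simps diff_divide_distrib)
qed

text \<open>At \<open>z\<close> two terms meet: the derivative of *\<nu> gives the double divergence
  of II, and the derivative of \<open>z\<close>, which is \<rho> with an index raised, gives the
  zeroth order term. The last claim is a parity argument: *\<N> interchanges \<open>V\<close> and
  its complement while the connection preserves both.\<close>

lemma dspM:
  assumes u: "u \<in> W"
  shows "dsp M u (s u) = 0" "dsp M u (S k u) = 0"
    "dsp M u (z u) = - (sqrt (dg u) *\<^sub>R Hstar V s (II V s) u)"
    "PV u x = 0 \<Longrightarrow> PV u (dsp M u x) = dsp M u x"
proof -
  note so = so_form_hodge[OF so_form_NV] and l = so_formD(2)[OF so_form_hodge[OF so_form_NV] u]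
  note ll = linear_add[OF l] linear_diff[OF l] linear_scale[OF l] linear_neg[OF l]
  show "dsp M u (s u) = 0"
    unfolding dsp_section[OF so u diffI[OF smooth_s u]]
    by (simp add: split_zero[OF u] M_frame split_s u mB_sym)
  have spB: "split_conn V (ee j) (\<lambda>w. M w (ee i) (S k w)) u = - nab (ee j) (mB i k) u" for i j
  proof -
    have d: "(\<lambda>w. - mB i k w) differentiable (at u)" by (intro differentiable_minus diff_mB u)
    have "split_conn V (ee j) (\<lambda>w. M w (ee i) (S k w)) u = split_conn V (ee j) (\<lambda>w. - mB i k w) u"
      by (rule split_cong[OF u]) (rule M_frame(2))
    also have "\<dots> = nab (ee j) (\<lambda>w. - mB i k w) u"
      by (rule split_perp(1)[OF u d]) (simp add: PV_lin PV_mB)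
    finally show ?thesis by (simp add: nab_eq[OF u] dird_minus diff_mB u PV_lin)
  qed
  have "dsp M u (S k u) = - (nab (ee 1) (mB 2 k) u - \<Gamma> 1 1 k u *\<^sub>R mB 2 1 u - \<Gamma> 2 1 k u *\<^sub>R mB 2 2 u
     - (nab (ee 2) (mB 1 k) u - \<Gamma> 1 2 k u *\<^sub>R mB 1 1 u - \<Gamma> 2 2 k u *\<^sub>R mB 1 2 u)) + (gg 2 k u *\<^sub>R m\<nu> 1 u - gg 1 k u *\<^sub>R m\<nu> 2 u)"
    unfolding dsp_section[OF so u diffI[OF smooth_S u]] spB split_S[OF u]
    by (simp add: ll M_frame[OF u])
  then show "dsp M u (S k u) = 0" unfolding nab_mB[OF u] m\<nu>_metric[OF u] by simp
  have spn: "split_conn V (ee j) (\<lambda>w. M w (ee i) (z w)) u = nab (ee j) (m\<nu> i) u" for i j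
  proof -
    have "split_conn V (ee j) (\<lambda>w. M w (ee i) (z w)) u = split_conn V (ee j) (m\<nu> i) u"
      by (rule split_cong[OF u]) (rule M_frame(3))
    then show ?thesis using split_perp(1)[OF u diff_m\<nu>[OF u] PV_m\<nu>] by simp
  qed
  have "dsp M u (z u) = nab (ee 1) (m\<nu> 2) u - nab (ee 2) (m\<nu> 1) u
     - (up 1 u (\<rho> 1 1 u) (\<rho> 1 2 u) *\<^sub>R mB 2 1 u + up 2 u (\<rho> 1 1 u) (\<rho> 1 2 u) *\<^sub>R mB 2 2 u
        - up 1 u (\<rho> 2 1 u) (\<rho> 2 2 u) *\<^sub>R mB 1 1 u - up 2 u (\<rho> 2 1 u) (\<rho> 2 2 u) *\<^sub>R mB 1 2 u)"
    unfolding dsp_section[OF so u diffI[OF smooth_z u]] spn split_z[OF u]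
    by (simp add: ll M_frame[OF u])
  also have "\<dots> = - (sqrt (dg u) *\<^sub>R div1 s nab (div2 s nab (II V s)) u) - sqrt (dg u) *\<^sub>R contract s u (rform u) (II V s u)"
    using curl_star_\<nu>[OF u] contract_BB[OF u, of "rform u"] unfolding rform_ee
    by (simp add: m\<nu>_def[abs_def] mB_def)
  also have "\<dots> = - (sqrt (dg u) *\<^sub>R Hstar V s (II V s) u)"
    unfolding Hstar_eq[OF u] by (simp add: algebra_simps)
  finally show "dsp M u (z u) = - (sqrt (dg u) *\<^sub>R Hstar V s (II V s) u)" .
  assume x: "PV u x = 0"
  let ?f = "\<lambda>w. x - PV w x"
  have f: "?f differentiable (at u)" by (intro differentiable_diff differentiable_const diffI[OF smooth_PV u])
  have pp: "PV w (x - PV w x) = 0" if "w \<in> W" for w by (simp add: PV_lin PV_idem[OF that])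
  have "PV u (dsp M u (?f u)) = dsp M u (?f u)"
    unfolding dsp_section[OF so u f]
    by (simp add: PV_lin M_maps(2)[OF u split_perp(2)[OF u f pp]]
      split_V(2)[OF u dird_form(2)[OF so u f] M_maps(2)[OF _ pp]])
  then show "PV u (dsp M u x) = dsp M u x" using x by simp
qed

text \<open>Parity again: \<xi> lives on \<open>V\<close> and *\<N> interchanges \<open>V\<close>
  with the normal bundle. On \<open>ds\<close> the products are killed one by one; at
  \<open>z\<close> only *\<N> applied to \<xi> z survives, and \<xi> z is minus the vector dual to
  the coefficients.\<close>

lemma brM:
  assumes n: "null_form \<xi> a" and u: "u \<in> W" and p: "\<And>i x. PV u x = 0 \<Longrightarrow> \<xi> u (ee i) x = 0"
  shows "br (\<xi> u) (M u) (s u) = 0" "br (\<xi> u) (M u) (S k u) = 0" "PV u x = 0 \<Longrightarrow> PV u (br (\<xi> u) (M u) x) = br (\<xi> u) (M u) x"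
    "(\<And>i j. a i j u = b (ee i) (ee j)) \<Longrightarrow> br (\<xi> u) (M u) (z u) = - (sqrt (dg u) *\<^sub>R contract s u b (II V s u))"
proof -
  note so = null_formD(1)[OF n]
  note l = so_formD(2)[OF so_form_hodge[OF so_form_NV] u]
  note ll = linear_add[OF l] linear_diff[OF l] linear_scale[OF l] linear_neg[OF l] linear_0[OF l]
  note l' = so_formD(2)[OF so u]
  note ll' = linear_add[OF l'] linear_diff[OF l'] linear_scale[OF l'] linear_neg[OF l'] linear_0[OF l']
  show "br (\<xi> u) (M u) (s u) = 0"
    unfolding br_def by (simp add: M_frame[OF u] null_formD(2,3)[OF n u] ll ll')
  show "br (\<xi> u) (M u) (S k u) = 0"
    unfolding br_def by (simp add: M_frame[OF u] null_formD(2,3)[OF n u] ll ll' p PV_mB[OF u])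
  \<comment> \<open>A skew map that kills the normal bundle has its image in
    \<open>V\<close>.\<close>
  have VV: "PV u (\<xi> u (ee i) y) = \<xi> u (ee i) y" for i y
  proof -
    have "\<xi> u (ee i) y - PV u (\<xi> u (ee i) y) = 0"
    proof (rule lor_eqI)
      fix x
      have "lor (\<xi> u (ee i) y - PV u (\<xi> u (ee i) y)) x = lor (\<xi> u (ee i) y) (x - PV u x)"
        by (simp add: lor_simps PV_self_adjoint)
      also have "\<dots> = 0" unfolding so_formD(5)[OF so u, of _ y]
        by (simp add: p PV_lin PV_idem[OF u] lor_simps)
      finally show "lor (\<xi> u (ee i) y - PV u (\<xi> u (ee i) y)) x = lor 0 x" by (simp add: lor_zero_left)
    qed
    then show ?thesis by simp
  qed
  show "PV u (br (\<xi> u) (M u) x) = br (\<xi> u) (M u) x" if "PV u x = 0"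
    unfolding br_def by (simp add: p that ll PV_lin VV)
  show "br (\<xi> u) (M u) (z u) = - (sqrt (dg u) *\<^sub>R contract s u b (II V s u))"
    if ab: "\<And>i j. a i j u = b (ee i) (ee j)"
  proof -
    have x: "\<xi> u (ee i) (z u) = - (up 1 u (a i 1 u) (a i 2 u) *\<^sub>R S 1 u) - up 2 u (a i 1 u) (a i 2 u) *\<^sub>R S 2 u" for i
      using null_form_z(1)[OF n u] VV by simp
    show ?thesis
      unfolding br_def contract_BB[OF u, of b, symmetric]
      by (simp add: M_frame[OF u] p PV_m\<nu>[OF u], simp add: x ll M_frame[OF u] ab mB_def, simp add: algebra_simps)
  qed
qed

text \<open>The difference vanishes on \<open>s\<close> and \<open>ds\<close> and maps normal
  vectors into \<open>V\<close>, so it has no block from the normal bundle to itself;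
  \<open>so_zero\<close> then leaves the value at \<open>z\<close>, where the volume density divides
  out.\<close>

lemma star_closed_iff:
  assumes n: "null_form \<xi> a" and u: "u \<in> W" and p: "\<And>i x. PV u x = 0 \<Longrightarrow> \<xi> u (ee i) x = 0"
    and ab: "\<And>i j. a i j u = b (ee i) (ee j)"
  shows "(\<forall>v. dsp M u v - br (\<xi> u) (M u) v = 0) \<longleftrightarrow> Hstar V s (II V s) u = contract s u b (II V s u)"
proof -
  let ?T = "\<lambda>v. dsp M u v - br (\<xi> u) (M u) v"
  have Tz: "?T (z u) = - (sqrt (dg u) *\<^sub>R (Hstar V s (II V s) u - contract s u b (II V s u)))"
    by (simp add: dspM(3)[OF u] brM(4)[OF n u p ab] algebra_simps)
  have sq: "sqrt (dg u) \<noteq> 0" using dg_pos[OF u] by simp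
  show ?thesis
  proof
    assume "\<forall>v. ?T v = 0"
    then have "?T (z u) = 0" by blast
    then show "Hstar V s (II V s) u = contract s u b (II V s u)" unfolding Tz using sq by simp
  next
    assume e: "Hstar V s (II V s) u = contract s u b (II V s u)"
    note so = so_form_hodge[OF so_form_NV]
    have "?T v = 0" for v
    proof (rule so_zero[OF u, of ?T])
      show "lor (?T v) x = - lor v (?T x)" for v x
        by (simp add: lor_simps dsp_skew[OF so u] br_def so_formD(5)[OF so u] so_formD(5)[OF null_formD(1)[OF n] u])
      show "?T (s u) = 0" "?T (S i u) = 0" for i by (simp_all add: dspM[OF u] brM[OF n u p])
      show "lor (?T (z u)) x = 0" for x unfolding Tz e by (simp add: lor_simps)
      fix x y assume x: "PV u x = 0" and y: "PV u y = 0"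
      have "PV u (?T x) = ?T x" by (simp add: PV_lin dspM(4)[OF u x] brM(3)[OF n u p x])
      then have "lor (?T x) y = lor (?T x) (PV u y)" by (metis PV_self_adjoint)
      then show "lor (?T x) y = 0" by (simp add: y lor_simps)
    qed
    then show "\<forall>v. ?T v = 0" by blast
  qed
qed

text \<open>As Q is a multiple of the metric, its terms occur in pairs that differ by interchanging
  the two indices of the star of II, and these cancel by \<open>mB_sym\<close>.\<close>

lemma br_Q_M:
  assumes u: "u \<in> W" shows "br (form_to_endo V s (Qform V s) u) (M u) v = 0"
proof -
  let ?k = "1/4 * II_norm2 V s u"
  note so = so_form_hodge[OF so_form_NV]
  note l = so_formD(2)[OF so u]
  have 1: "lor (M u (ee i) v) (s u) = 0" for i by (simp add: so_formD(5)[OF so u] M_frame[OF u] lor_simps)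
  have 2: "lor (M u (ee 2) v) (S 1 u) = lor (M u (ee 1) v) (S 2 u)"
    by (simp add: so_formD(5)[OF so u] M_frame[OF u] mB_sym[OF u])
  show ?thesis
    unfolding br_def Q_eq[OF u]
    by (simp add: linear_diff[OF l] linear_scale[OF l] 1 2 M_frame[OF u] mB_sym[OF u] lor_simps)
qed

text \<open>Eliminates Q from both conditions: its bracket with \<xi> vanishes because the nilpotent
  algebra is abelian, and its bracket with *\<N> by \<open>br_Q_M\<close>.\<close>

lemma closed_conditions_iff:
  assumes so: "so_form \<xi>" and st: "\<And>w X. w \<in> W \<Longrightarrow> \<xi> w X \<in> stab_perp (span {s w})" and u: "u \<in> W"
  shows "((\<forall>X Y v. ext_cov (Dh V s) \<xi> u X Y v = 0) \<and>
      (\<forall>X Y v. ext_cov (\<lambda>Z f w. Dh V s Z f w - \<xi> w Z (f w)) (hodge_endo s (NV V)) u X Y v = 0))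
    \<longleftrightarrow> (\<forall>v. dsp \<xi> u v = 0 \<and> dsp M u v - br (\<xi> u) (M u) v = 0)"
proof -
  let ?Q = "form_to_endo V s (Qform V s)"
  note soM = so_form_hodge[OF so_form_NV]
  have D: "Dh V s = (\<lambda>X f w. split_conn V X f w - ?Q w X (f w))" by (simp add: Dh_def fun_eq_iff)
  have D': "(\<lambda>Z f w. Dh V s Z f w - \<xi> w Z (f w)) = (\<lambda>X f w. split_conn V X f w - (?Q w X (f w) + \<xi> w X (f w)))"
    by (simp add: Dh_def fun_eq_iff)
  have lQ: "linear (\<lambda>X. ?Q u X v + \<xi> u X v)" "linear (\<lambda>v. ?Q u X v + \<xi> u X v)" for v X
    by (rule linear_compose_add[OF linear_Q(1)[OF u] so_formD(3)[OF so u]],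
        rule linear_compose_add[OF linear_Q(2)[OF u] so_formD(2)[OF so u]])
  have 1: "ext_cov (Dh V s) \<xi> u X Y v = (X $ 1 * Y $ 2 - X $ 2 * Y $ 1) *\<^sub>R dsp \<xi> u v" for X Y v
  proof -
    have "ext_cov (Dh V s) \<xi> u (ee 1) (ee 2) v = dsp \<xi> u v"
      unfolding D ext_cov_minus[OF so u]
      using br_stab[OF u, of "?Q u" "\<xi> u" v] Q_stab[OF u] st[OF u] by simp
    then show ?thesis
      using ext_cov_alternating[where \<beta> = ?Q, OF so u linear_Q[OF u], of X Y v] unfolding D by simp
  qed
  have 2: "ext_cov (\<lambda>Z f w. Dh V s Z f w - \<xi> w Z (f w)) M u X Y v
      = (X $ 1 * Y $ 2 - X $ 2 * Y $ 1) *\<^sub>R (dsp M u v - br (\<xi> u) (M u) v)" for X Y v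
  proof -
    have b: "br (\<lambda>X v. ?Q u X v + \<xi> u X v) (M u) v = br (?Q u) (M u) v + br (\<xi> u) (M u) v"
      unfolding br_def by (simp add: linear_add[OF so_formD(2)[OF soM u]])
    have "ext_cov (\<lambda>Z f w. Dh V s Z f w - \<xi> w Z (f w)) M u (ee 1) (ee 2) v = dsp M u v - br (\<xi> u) (M u) v"
      unfolding D' using ext_cov_minus[where \<beta> = "\<lambda>w X v. ?Q w X v + \<xi> w X v", OF soM u, of v]
      by (simp add: b br_Q_M[OF u])
    then show ?thesis
      using ext_cov_alternating[where \<beta> = "\<lambda>w X v. ?Q w X v + \<xi> w X v", OF soM u lQ, of X Y v] unfolding D' by simp
  qed
  have e: "ee 1 $ 1 * ee 2 $ 2 - ee 1 $ 2 * ee 2 $ 1 = (1 :: real)" by (simp add: ee_nth)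
  have F: "(\<forall>(X :: real^2) (Y :: real^2) v. (X $ 1 * Y $ 2 - X $ 2 * Y $ 1) *\<^sub>R T v = 0) \<longleftrightarrow> (\<forall>v. T v = 0)" for T :: "'m lorentz \<Rightarrow> 'm lorentz"
  proof
    assume "\<forall>(X :: real^2) (Y :: real^2) v. (X $ 1 * Y $ 2 - X $ 2 * Y $ 1) *\<^sub>R T v = 0"
    from this[rule_format, of "ee 1" "ee 2"] show "\<forall>v. T v = 0" unfolding e by simp
  qed simp
  show ?thesis unfolding 1 2 F[of "dsp \<xi> u"] F[of "\<lambda>v. dsp M u v - br (\<xi> u) (M u) v"] by blast
qed

section \<open>From closed forms to the constrained Willmore equation and back\<close>

lemma gtrace_real:
  fixes b :: "real^2 \<Rightarrow> real^2 \<Rightarrow> real"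
  assumes u: "u \<in> W"
  shows "gtrace s u b = (gg 2 2 u * b (ee 1) (ee 1) - gg 1 2 u * b (ee 1) (ee 2) - gg 1 2 u * b (ee 2) (ee 1) + gg 1 1 u * b (ee 2) (ee 2)) / dg u"
  unfolding gtrace_def sum_2 ginv_comp[OF u] by (simp add: algebra_simps add_divide_distrib diff_divide_distrib)

lemma homology_class_ee:
  assumes n: "null_form \<xi> a" and u: "u \<in> W"
  shows "homology_class s \<xi> u (ee i) (ee j) = (a i j u + a j i u) / 2
     - (gg i j u / 2) * ((gg 2 2 u * a 1 1 u - gg 1 2 u * a 1 2 u - gg 1 2 u * a 2 1 u + gg 1 1 u * a 2 2 u) / dg u)"
proof -
  have t: "(THE r. \<xi> u (ee i) (S j u) = - (r *\<^sub>R s u)) = a i j u" for i j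
    using s_nz[OF u] by (simp add: null_formD[OF n] u)
  show ?thesis
    unfolding homology_class_def sym0_def gtrace_real[OF u] t metric_ee by simp
qed

lemma cov2_real:
  fixes q :: "real^2 \<Rightarrow> real^2 \<Rightarrow> real^2 \<Rightarrow> real"
  shows "cov2 s dird q u k i j = dird (ee k) (\<lambda>w. q w (ee i) (ee j)) u
    - (\<Gamma> 1 k i u * q u (ee 1) (ee j) + \<Gamma> 2 k i u * q u (ee 2) (ee j)) - (\<Gamma> 1 k j u * q u (ee i) (ee 1) + \<Gamma> 2 k j u * q u (ee i) (ee 2))"
  by (simp add: cov2_def sum_2)

lemma cov2_skew:
  fixes q :: "real^2 \<Rightarrow> real^2 \<Rightarrow> real^2 \<Rightarrow> real"
  assumes u: "u \<in> W" and q: "\<And>w i j. w \<in> W \<Longrightarrow> a i j w = q w (ee i) (ee j)"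
  shows "cov2 s dird q u 1 2 k - cov2 s dird q u 2 1 k = cu a k u"
proof -
  have "dird (ee l) (\<lambda>w. q w (ee i) (ee k)) u = dird (ee l) (a i k) u" for l i
    by (rule dird_cong[OF W u]) (simp add: q)
  then show ?thesis
    unfolding cov2_real cu_def by (simp add: q[OF u] \<Gamma>_sym[OF u, of _ 2 1])
qed

text \<open>On a surface a skew pair of indices has one independent component.\<close>

lemma cov2_closed_iff:
  fixes q :: "real^2 \<Rightarrow> real^2 \<Rightarrow> real^2 \<Rightarrow> real"
  assumes u: "u \<in> W" and q: "\<And>w i j. w \<in> W \<Longrightarrow> a i j w = q w (ee i) (ee j)"
  shows "(\<forall>i j k. cov2 s dird q u i j k - cov2 s dird q u j i k = 0) \<longleftrightarrow> (\<forall>k. cu a k u = 0)"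
proof -
  have "cu a k u = cov2 s dird q u 1 2 k - cov2 s dird q u 2 1 k" for k
    by (rule cov2_skew[where a = a and q = q, OF u q, symmetric])
  then show ?thesis unfolding forall_2 by auto
qed

text \<open>Closedness makes the coefficients of \<xi> symmetric and tracefree, so they agree with
  the homology class \<open>q\<close> and not merely modulo trace and skew part. Then closedness of
  \<xi> is closedness of \<open>q\<close>, and the second equation is read at
  \<open>z\<close>.\<close>

lemma closed_imp_willmore:
  assumes so: "so_form \<xi>" and st: "\<And>w X. w \<in> W \<Longrightarrow> \<xi> w X \<in> stab_perp (span {s w})"
    and hc: "\<And>w. w \<in> W \<Longrightarrow> homology_class s \<xi> w = q w"
    and dsp: "\<And>w v. w \<in> W \<Longrightarrow> dsp \<xi> w v = 0 \<and> dsp M w v - br (\<xi> w) (M w) v = 0" and u: "u \<in> W"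
  shows "(\<forall>i j k. cov2 s dird q u i j k - cov2 s dird q u j i k = 0) \<and>
     Hstar V s (II V s) u = contract s u (q u) (II V s u)"
proof -
  define a where "a = (\<lambda>i j w. lor (\<xi> w (ee i) (S j w)) (z w))"
  have n: "null_form \<xi> a" unfolding a_def by (rule stab_null_form[OF so st])
  have d: "\<And>v. dsp \<xi> w v = 0" if "w \<in> W" for w using dsp that by blast
  note k = dsp_null_zero_imp[OF n _ d]
  have aq: "a i j w = q w (ee i) (ee j)" if w: "w \<in> W" for w i j
  proof -
    have "a i j w = a j i w" using k(1)[OF w w] exhaust_2[of i] exhaust_2[of j] by auto
    moreover have "gg 2 2 w * a 1 1 w - gg 1 2 w * a 1 2 w - gg 1 2 w * a 2 1 w + gg 1 1 w * a 2 2 w = 0"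
      using k(3)[OF w w] k(1)[OF w w] by (simp add: algebra_simps)
    ultimately show ?thesis
      using homology_class_ee[OF n w, of i j] by (simp add: hc[OF w])
  qed
  \<comment> \<open>On a normal vector \<xi> gives a multiple of \<open>s\<close>; pairing with
    \<open>z\<close> and using skewness expresses the factor through the normal part of \<xi> z,
    which vanishes.\<close>
  have p: "\<xi> u (ee i) x = 0" if x: "PV u x = 0" for i x
  proof -
    obtain c where c: "\<xi> u (ee i) x = c *\<^sub>R s u"
      using stab_perpD(3)[OF st[OF u]] x perp_frame_iff[OF u] by blast
    have "lor (\<xi> u (ee i) x) (z u) = - lor x (PV u (\<xi> u (ee i) (z u)))"
      by (simp add: so_formD(5)[OF so u, of _ x] k(2)[OF u u])
    also have "\<dots> = 0" by (simp add: PV_self_adjoint[symmetric] x lor_simps)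
    finally show ?thesis using c by (simp add: lor_simps frame_lor[OF u])
  qed
  have "cu a l u = 0" for l by (rule k(4)[OF u u])
  moreover have "\<forall>v. dsp M u v - br (\<xi> u) (M u) v = 0" using dsp[OF u] by blast
  ultimately show ?thesis
    using cov2_closed_iff[where a = a and q = q, OF u aq] star_closed_iff[where b = "q u", OF n u p aq[OF u]] by blast
qed

text \<open>The star of a tracefree symmetric Codazzi form is again Codazzi, like the imaginary part
  of a holomorphic quadratic differential. Its curl is the divergence of \<open>a\<close>, and by
  the Codazzi symmetry this divergence is the derivative of the trace.\<close>

lemma curl_star:
  assumes u: "u \<in> W" and d: "\<And>i j. a i j differentiable (at u)"
    and sym: "\<And>w. w \<in> W \<Longrightarrow> a 2 1 w = a 1 2 w"
    and tr: "\<And>w. w \<in> W \<Longrightarrow> gg 2 2 w * a 1 1 w - 2 * gg 1 2 w * a 1 2 w + gg 1 1 w * a 2 2 w = 0"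
    and cl: "\<And>k. cu a k u = 0"
  shows "cu (\<lambda>i j w. if i = 1 then hh 1 2 w * a 1 j w - hh 1 1 w * a 2 j w else hh 2 2 w * a 1 j w - hh 1 2 w * a 2 j w) k u = 0"
proof -
  let ?y = "\<lambda>l i j. dird (ee l) (a i j) u"
  note dG = diffI[OF smooth_gg u]
  have y21: "?y l 2 1 = ?y l 1 2" for l by (rule dird_cong[OF W u]) (rule sym)
  have trd: "gg 2 2 u * (?y l 1 1 - 2 * (\<Gamma> 1 l 1 u * a 1 1 u + \<Gamma> 2 l 1 u * a 1 2 u))
    - 2 * gg 1 2 u * (?y l 1 2 - (\<Gamma> 1 l 1 u * a 1 2 u + \<Gamma> 2 l 1 u * a 2 2 u) - (\<Gamma> 1 l 2 u * a 1 1 u + \<Gamma> 2 l 2 u * a 1 2 u))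
    + gg 1 1 u * (?y l 2 2 - 2 * (\<Gamma> 1 l 2 u * a 1 2 u + \<Gamma> 2 l 2 u * a 2 2 u)) = 0" for l
  proof (rule trace_derivative[OF dgg_\<Gamma>[OF u] tr[OF u]])
    have d2: "dird (ee l) (\<lambda>w. 2 * gg 1 2 w) u = 2 * dird (ee l) (gg 1 2) u" "(\<lambda>w. 2 * gg 1 2 w) differentiable (at u)"
      using dird_mult[OF differentiable_const dG, of "ee l" 2] dG by auto
    have "dird (ee l) (\<lambda>w. gg 2 2 w * a 1 1 w - 2 * gg 1 2 w * a 1 2 w + gg 1 1 w * a 2 2 w) u = 0"
      by (rule dird_const_on[OF u tr])
    then show "dird (ee l) (gg 2 2) u * a 1 1 u + gg 2 2 u * ?y l 1 1 - 2 * (dird (ee l) (gg 1 2) u * a 1 2 u + gg 1 2 u * ?y l 1 2)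
       + dird (ee l) (gg 1 1) u * a 2 2 u + gg 1 1 u * ?y l 2 2 = 0"
      by (simp add: dird_add dird_diff dird_mult d2 differentiable_diff dG d algebra_simps)
  qed
  \<comment> \<open>The covariant derivative of \<open>a\<close>, with the derivative index first;
    \<open>bs\<close>, \<open>bt\<close> and \<open>bc\<close> are its symmetry, its trace and the
    Codazzi property.\<close>
  define b where "b l i j = ?y l i j - (\<Gamma> 1 l i u * a 1 j u + \<Gamma> 2 l i u * a 2 j u) - (\<Gamma> 1 l j u * a i 1 u + \<Gamma> 2 l j u * a i 2 u)" for l i j
  have bs: "b l 2 1 = b l 1 2" for l by (simp add: b_def y21 sym[OF u])
  have bt: "gg 2 2 u * b l 1 1 - 2 * gg 1 2 u * b l 1 2 + gg 1 1 u * b l 2 2 = 0" for l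
    using trd[of l] by (simp add: b_def sym[OF u] algebra_simps)
  have bc: "b 1 2 j = b 2 1 j" for j
    using cl[of j] by (simp add: b_def cu_def \<Gamma>_sym[OF u, of _ 2 1])
  have e: "hh i j u = gg i j u * (1 / sqrt (dg u))" for i j by (simp add: hh_def)
  have "cu (\<lambda>i j w. if i = 1 then hh 1 2 w * a 1 j w - hh 1 1 w * a 2 j w else hh 2 2 w * a 1 j w - hh 1 2 w * a 2 j w) k u
    = hh 2 2 u * b 1 1 k - hh 1 2 u * b 1 2 k - hh 1 2 u * b 2 1 k + hh 1 1 u * b 2 2 k"
    unfolding cu_def b_def using exhaust_2[of k]
    by (auto simp: dird_diff dird_mult diff_hh[OF u] d dhh[OF u] \<Gamma>_sym[OF u, of _ 2 1] algebra_simps)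
  also have "\<dots> = (gg 2 2 u * b 1 1 k - gg 1 2 u * b 1 2 k - gg 1 2 u * b 2 1 k + gg 1 1 u * b 2 2 k) * (1 / sqrt (dg u))"
    unfolding e by (simp add: algebra_simps)
  also have "gg 2 2 u * b 1 1 k - gg 1 2 u * b 1 2 k - gg 1 2 u * b 2 1 k + gg 1 1 u * b 2 2 k = 0"
    using exhaust_2[of k]
  proof
    assume "k = 1"
    then show ?thesis using bt[of 1] bs[of 1] bs[of 2] bc[of 1] bc[of 2] by (simp add: algebra_simps)
  next
    assume "k = 2"
    then show ?thesis using bt[of 2] bs[of 1] bs[of 2] bc[of 1] bc[of 2] by (simp add: algebra_simps)
  qed
  finally show ?thesis by simp
qed

lemma willmore_imp_flat:
  assumes so: "so_form \<xi>" and st: "\<And>w X. w \<in> W \<Longrightarrow> \<xi> w X \<in> stab_perp (span {s w}) \<inter> so_sub (V w)"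
    and \<xi>q: "\<And>w i j. w \<in> W \<Longrightarrow> \<xi> w (ee i) (S j w) = - (q w (ee i) (ee j) *\<^sub>R s w)"
    and sym: "\<And>w. w \<in> W \<Longrightarrow> q w (ee 2) (ee 1) = q w (ee 1) (ee 2)"
    and tr: "\<And>w. w \<in> W \<Longrightarrow> gtrace s w (q w) = 0"
    and cw: "\<And>w. w \<in> W \<Longrightarrow> (\<forall>i j k. cov2 s dird q w i j k - cov2 s dird q w j i k = 0) \<and>
     Hstar V s (II V s) w = contract s w (q w) (II V s w)"
  shows "flat_on W (family_conn V s \<xi> t)"
proof -
  define a where "a = (\<lambda>i j w. q w (ee i) (ee j))"
  have st1: "\<xi> w X \<in> stab_perp (span {s w})" if "w \<in> W" for w X using st[OF that] by blast
  have n: "null_form \<xi> a"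
    unfolding null_form_def a_def using so \<xi>q stab_perpD(2)[OF st1] by blast
  have p: "\<xi> w X x = 0" if "w \<in> W" "PV w x = 0" for w X x
    using so_sub_zero[OF that(1) _ that(2)] st[OF that(1)] by blast
  have asym: "a 2 1 w = a 1 2 w" if "w \<in> W" for w using sym[OF that] by (simp add: a_def)
  have atr: "gg 2 2 w * a 1 1 w - 2 * gg 1 2 w * a 1 2 w + gg 1 1 w * a 2 2 w = 0" if w: "w \<in> W" for w
    using tr[OF w] dg_nz[OF w] asym[OF w] by (simp add: gtrace_real[OF w] a_def)
  have acu: "cu a k w = 0" if "w \<in> W" for k w
    using cov2_closed_iff[OF that, of a q] cw[OF that] by (simp add: a_def)
  have 1: "dsp \<xi> w v = 0" if w: "w \<in> W" for w v
    by (rule dsp_null_zero[OF n w p asym[OF w] atr[OF w] acu[OF w]])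
  \<comment> \<open>The coefficients of *\<xi>. Their skew part and their trace are multiples of the
    trace of \<open>a\<close>, so the criterion \<open>dsp_null_zero\<close> applies to *\<xi> as
    well as to \<xi>.\<close>
  let ?b = "\<lambda>(i::2) j w. if i = 1 then hh 1 2 w * a 1 j w - hh 1 1 w * a 2 j w else hh 2 2 w * a 1 j w - hh 1 2 w * a 2 j w"
  have n': "null_form (hodge_endo s \<xi>) ?b"
    unfolding null_form_def
  proof (intro conjI ballI allI so_form_hodge so)
    fix w i j assume w: "w \<in> W"
    show "hodge_endo s \<xi> w (ee i) (s w) = 0"
      using exhaust_2[of i] by (auto simp: hodge_endo_ee(1,2)[OF w] null_formD(2)[OF n w])
    show "hodge_endo s \<xi> w (ee i) (S j w) = - (?b i j w *\<^sub>R s w)"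
      using exhaust_2[of i] by (auto simp: hodge_endo_ee(1,2)[OF w] null_formD(3)[OF n w] algebra_simps)
  qed
  have 2: "dsp (hodge_endo s \<xi>) w v = 0" if w: "w \<in> W" for w v
  proof (rule dsp_null_zero[OF n' w])
    show "hodge_endo s \<xi> w (ee i) x = 0" if w: "w \<in> W" and "PV w x = 0" for w i x
      using exhaust_2[of i] by (auto simp: hodge_endo_ee(1,2)[OF w] p[OF w that(2)])
    have "?b 2 1 w - ?b 1 2 w = (gg 2 2 w * a 1 1 w - 2 * gg 1 2 w * a 1 2 w + gg 1 1 w * a 2 2 w) / sqrt (dg w)"
      by (simp add: hh_def asym[OF w] add_divide_distrib diff_divide_distrib)
    then show "?b 2 1 w = ?b 1 2 w" by (simp add: atr[OF w])
    show "gg 2 2 w * ?b 1 1 w - 2 * gg 1 2 w * ?b 1 2 w + gg 1 1 w * ?b 2 2 w = 0"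
    proof -
      have "gg 2 2 w * ?b 1 1 w - 2 * gg 1 2 w * ?b 1 2 w + gg 1 1 w * ?b 2 2 w
        = (gg 1 2 w / sqrt (dg w)) * (gg 2 2 w * a 1 1 w - 2 * gg 1 2 w * a 1 2 w + gg 1 1 w * a 2 2 w)"
        by (simp add: hh_def asym[OF w] algebra_simps add_divide_distrib diff_divide_distrib)
      then show ?thesis by (simp add: atr[OF w])
    qed
    show "cu ?b k w = 0" for k
      by (rule curl_star[OF w null_form_diff[OF n w] asym atr acu[OF w]])
  qed
  have 3: "dsp M w v - br (\<xi> w) (M w) v = 0" if w: "w \<in> W" for w v
  proof -
    have "a i j w = q w (ee i) (ee j)" for i j by (simp add: a_def)
    from star_closed_iff[where b = "q w", OF n w p[OF w] this] show ?thesis using cw[OF w] by blast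
  qed
  have "br (\<xi> w) (\<xi> w) v = 0" if "w \<in> W" for w v
    by (rule br_stab[OF that st1[OF that] st1[OF that]])
  then show ?thesis using flat_family_iff[OF so] 1 2 3 by blast
qed

lemma flat_imp_closed:
  assumes so: "so_form \<xi>" and st: "\<And>w X. w \<in> W \<Longrightarrow> \<xi> w X \<in> stab_perp (span {s w})"
    and fl: "\<And>t. flat_on W (family_conn V s \<xi> t)" and u: "u \<in> W"
  shows "dsp \<xi> u v = 0 \<and> dsp M u v - br (\<xi> u) (M u) v = 0"
proof -
  have "br (\<xi> w) (\<xi> w) v = 0" if "w \<in> W" for w v
    by (rule br_stab[OF that st[OF that] st[OF that]])
  then show ?thesis using flat_family_iff[OF so] fl u by blast
qed

end

section \<open>The central sphere congruence\<close>

lemma smooth_on_local: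
  assumes "open W" "\<And>u. u \<in> W \<Longrightarrow> \<exists>T. open T \<and> u \<in> T \<and> smooth_on f T"
  shows "smooth_on f W"
proof -
  have "Ck_on k f W" if "\<And>u. u \<in> W \<Longrightarrow> \<exists>T. open T \<and> u \<in> T \<and> Ck_on k f T" for k and f :: "real^2 \<Rightarrow> 'a"
    using that
  proof (induction k arbitrary: f)
    case 0
    have "isCont f u" if u: "u \<in> W" for u
    proof -
      obtain T where "open T" "u \<in> T" "continuous_on T f" using 0[OF u] by auto
      then show ?thesis by (simp add: continuous_on_eq_continuous_at)
    qed
    then show ?case by (simp add: continuous_at_imp_continuous_on)
  next
    case (Suc k)
    have "f differentiable (at u)" if u: "u \<in> W" for u
      using Suc.prems[OF u] Ck_diff by blast
    then have "f differentiable_on W" by (simp add: differentiable_at_imp_differentiable_on)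
    moreover have "Ck_on k (dird (ee i) f) W" for i
    proof (rule Suc.IH)
      fix u assume "u \<in> W"
      then obtain T where "open T" "u \<in> T" "Ck_on (Suc k) f T" using Suc.prems by blast
      then show "\<exists>T. open T \<and> u \<in> T \<and> Ck_on k (dird (ee i) f) T" by auto
    qed
    ultimately show ?case by simp
  qed
  moreover have "\<exists>T. open T \<and> u \<in> T \<and> Ck_on k f T" if "u \<in> W" for u k
    using assms(2)[OF that] unfolding smooth_on_def by blast
  ultimately show ?thesis unfolding smooth_on_def by blast
qed

lemma lor_orthonormal_sum:
  assumes "finite D" "d \<in> D" "\<And>b c. b \<in> D \<Longrightarrow> c \<in> D \<Longrightarrow> b \<noteq> c \<Longrightarrow> lor b c = 0"
  shows "lor (\<Sum>b\<in>D. c b *\<^sub>R b) d = c d * lor d d"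
proof -
  have "lor (\<Sum>b\<in>D. c b *\<^sub>R b) d = (\<Sum>b\<in>D. c b * lor b d)"
    by (simp add: bounded_bilinear.sum_left[OF bounded_bilinear_lor] lor_scaleR_left)
  also have "\<dots> = (\<Sum>b\<in>D. if b = d then c d * lor d d else 0)"
  proof (rule sum.cong)
    show "c b * lor b d = (if b = d then c d * lor d d else 0)" if "b \<in> D" for b
      using assms(3)[OF that assms(2)] by simp
  qed simp
  finally show ?thesis using assms(1,2) by simp
qed

lemma has_signature_nondegenerate:
  assumes "has_signature p q E"
  shows "dim E = p + q" "\<And>x. x \<in> E \<Longrightarrow> (\<And>y. y \<in> E \<Longrightarrow> lor x y = 0) \<Longrightarrow> x = 0"
proof -
  obtain B C where BC: "finite B" "finite C" "card B = p" "card C = q" "\<And>b. b \<in> B \<Longrightarrow> lor b b = 1"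
     "\<And>c. c \<in> C \<Longrightarrow> lor c c = -1" "\<And>b c. b \<in> B \<union> C \<Longrightarrow> c \<in> B \<union> C \<Longrightarrow> b \<noteq> c \<Longrightarrow> lor b c = 0" "E = span (B \<union> C)"
    using assms unfolding has_signature_def by blast
  have f: "finite (B \<union> C)" using BC by simp
  have nz: "lor d d \<noteq> 0" if "d \<in> B \<union> C" for d using that BC(5)[of d] BC(6)[of d] by auto
  note os = lor_orthonormal_sum[OF f _ BC(7)]
  have disj: "B \<inter> C = {}"
  proof -
    have False if "x \<in> B" "x \<in> C" for x using BC(5)[OF that(1)] BC(6)[OF that(2)] by simp
    then show ?thesis by blast
  qed
  have "independent (B \<union> C)"
  proof
    assume "dependent (B \<union> C)"
    then obtain c d where cd: "d \<in> B \<union> C" "c d \<noteq> 0" "(\<Sum>b\<in>B \<union> C. c b *\<^sub>R b) = 0"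
      unfolding dependent_finite[OF f] by blast
    then show False using os[OF cd(1), of c] nz[OF cd(1)] by (simp add: lor_zero_left)
  qed
  then have "dim E = card (B \<union> C)" unfolding BC(8) by (rule dim_span_eq_card_independent)
  then show "dim E = p + q" using card_Un_disjoint[OF BC(1,2) disj] BC by simp
  fix x assume x: "x \<in> E" and 0: "\<And>y. y \<in> E \<Longrightarrow> lor x y = 0"
  then obtain c where c: "x = (\<Sum>b\<in>B \<union> C. c b *\<^sub>R b)" unfolding BC(8) span_finite[OF f] by blast
  have "c d = 0" if d: "d \<in> B \<union> C" for d
    using os[OF d, of c] 0[of d] nz[OF d] d by (simp add: c[symmetric] BC(8) span_base)
  then show "x = 0" unfolding c by simp
qed

text \<open>Reduces the independence demanded of a local frame to a dimension count, the dimension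
  being supplied by the signature.\<close>

lemma span_image_dim:
  fixes f :: "nat \<Rightarrow> 'b::euclidean_space"
  assumes "dim (span (f ` {..<k})) = k"
  shows "inj_on f {..<k}" "independent (f ` {..<k})"
proof -
  have d: "dim (f ` {..<k}) = k" using assms by simp
  have "k \<le> card (f ` {..<k})" using dim_le_card'[of "f ` {..<k}"] d by simp
  then have c: "card (f ` {..<k}) = k" using card_image_le[of "{..<k}" f] by simp
  then show "inj_on f {..<k}" by (simp add: eq_card_imp_inj_on)
  show "independent (f ` {..<k})"
    by (rule card_le_dim_spanning[OF span_superset order_refl]) (simp_all add: c d)
qed

lemma image_lessThan_4: "f ` {..<4::nat} = {f 0, f 1, f 2, f 3}"
  by (auto simp: numeral_eq_Suc lessThan_Suc)

context null_immersion
begin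

text \<open>Corrects a section \<open>b\<close> not orthogonal to \<open>s\<close> to the null section dual to \<open>s\<close> in \<open>span {s, ds, b}\<close>.\<close>

definition frame_z :: "(real^2 \<Rightarrow> 'm lorentz) \<Rightarrow> real^2 \<Rightarrow> 'm lorentz" where
  "frame_z b w = (let z0 = (- 1 / lor (b w) (s w)) *\<^sub>R b w;
      z1 = z0 - up 1 w (lor z0 (S 1 w)) (lor z0 (S 2 w)) *\<^sub>R S 1 w - up 2 w (lor z0 (S 1 w)) (lor z0 (S 2 w)) *\<^sub>R S 2 w
    in z1 + (lor z1 z1 / 2) *\<^sub>R s w)"

lemma adapted_frame_z:
  assumes b: "smooth_on b W" and bs: "\<And>w. w \<in> W \<Longrightarrow> lor (b w) (s w) \<noteq> 0"
    and V: "\<And>w. w \<in> W \<Longrightarrow> V w = span {s w, S 1 w, S 2 w, b w}"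
  shows "adapted_frame W s (frame_z b) V"
proof
  define z0 where "z0 w = (- 1 / lor (b w) (s w)) *\<^sub>R b w" for w
  define z1 where "z1 w = z0 w - up 1 w (lor (z0 w) (S 1 w)) (lor (z0 w) (S 2 w)) *\<^sub>R S 1 w
    - up 2 w (lor (z0 w) (S 1 w)) (lor (z0 w) (S 2 w)) *\<^sub>R S 2 w" for w
  have z: "frame_z b w = z1 w + (lor (z1 w) (z1 w) / 2) *\<^sub>R s w" for w
    by (simp add: frame_z_def z1_def z0_def Let_def)
  have 0: "smooth_on z0 W" unfolding z0_def[abs_def] by (intro smooth_ops b bs)
  have 1: "smooth_on z1 W" unfolding z1_def[abs_def] by (intro smooth_ops smooth_up 0 smooth_S)
  have h: "smooth_on (\<lambda>w. lor (z1 w) (z1 w) / 2) W"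
    by (intro smooth_ops 1) simp
  show "smooth_on (frame_z b) W" unfolding z[abs_def] by (intro smooth_ops 1 h)
  fix w i assume w: "w \<in> W"
  have z0s: "lor (z0 w) (s w) = - 1" using bs[OF w] by (simp add: z0_def lor_simps)
  have sS: "lor (S i w) (s w) = 0" for i using perp_s[OF w] by (simp add: lor_sym)
  have z1s: "lor (z1 w) (s w) = - 1" by (simp add: z1_def lor_simps sS z0s)
  have z1S: "lor (z1 w) (S i w) = 0" for i
    using exhaust_2[of i] up_lower[OF w, of "lor (z0 w) (S 1 w)" "lor (z0 w) (S 2 w)"]
    by (auto simp: z1_def lor_simps gg_def[symmetric] gg_sym)
  have sz1: "lor (s w) (z1 w) = - 1" using z1s by (simp add: lor_sym)
  show "lor (frame_z b w) (frame_z b w) = 0" by (simp add: z lor_simps z1s sz1 null_s[OF w])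
  show "lor (s w) (frame_z b w) = - 1" by (simp add: z lor_simps sz1 null_s[OF w])
  show "lor (frame_z b w) (S i w) = 0" by (simp add: z lor_simps z1S perp_s[OF w])
  have e1: "frame_z b w = (- 1 / lor (b w) (s w)) *\<^sub>R b w + (- up 1 w (lor (z0 w) (S 1 w)) (lor (z0 w) (S 2 w))) *\<^sub>R S 1 w
      + (- up 2 w (lor (z0 w) (S 1 w)) (lor (z0 w) (S 2 w))) *\<^sub>R S 2 w + (lor (z1 w) (z1 w) / 2) *\<^sub>R s w"
    by (simp add: z z1_def z0_def)
  define k where "k = - lor (b w) (s w)"
  have e2: "b w = k *\<^sub>R frame_z b w + (k * up 1 w (lor (z0 w) (S 1 w)) (lor (z0 w) (S 2 w))) *\<^sub>R S 1 w
      + (k * up 2 w (lor (z0 w) (S 1 w)) (lor (z0 w) (S 2 w))) *\<^sub>R S 2 w + (- k * (lor (z1 w) (z1 w) / 2)) *\<^sub>R s w"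
  proof -
    have "k *\<^sub>R z0 w = b w" using bs[OF w] by (simp add: k_def z0_def)
    then show ?thesis by (simp add: z z1_def[of w] algebra_simps)
  qed
  have "span {s w, S 1 w, S 2 w, b w} = span {s w, S 1 w, S 2 w, frame_z b w}"
  proof (rule span_eq[THEN iffD2], intro conjI subsetI)
    fix x assume "x \<in> {s w, S 1 w, S 2 w, b w}"
    moreover have "b w \<in> span {s w, S 1 w, S 2 w, frame_z b w}"
      by (subst e2) (intro span_add span_scale span_base; simp)
    ultimately show "x \<in> span {s w, S 1 w, S 2 w, frame_z b w}" by (auto intro: span_base)
  next
    fix x assume "x \<in> {s w, S 1 w, S 2 w, frame_z b w}"
    moreover have "frame_z b w \<in> span {s w, S 1 w, S 2 w, b w}"
      by (subst e1) (intro span_add span_scale span_base; simp)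
    ultimately show "x \<in> span {s w, S 1 w, S 2 w, b w}" by (auto intro: span_base)
  qed
  then show "V w = span {s w, dird (ee 1) s w, dird (ee 2) s w, frame_z b w}" using V[OF w] by simp
qed

text \<open>Modulo \<open>span {s, ds}\<close> this is \<open>det g\<close> times the \<open>g\<close>-trace of \<open>D ds\<close>; a congruence \<open>V\<close> has tracefree \<open>II\<^sup>V\<close>
  exactly if it contains this vector.\<close>

definition hv :: "real^2 \<Rightarrow> 'm lorentz" where
  "hv w = gg 2 2 w *\<^sub>R dird (ee 1) (S 1) w - (2 * gg 1 2 w) *\<^sub>R dird (ee 1) (S 2) w + gg 1 1 w *\<^sub>R dird (ee 2) (S 2) w"

definition CV :: "real^2 \<Rightarrow> 'm lorentz set" where
  "CV w = span {s w, S 1 w, S 2 w, hv w}"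

lemma smooth_hv: "smooth_on hv W"
  unfolding hv_def[abs_def] by (intro smooth_ops smooth_gg smooth_S)

text \<open>By \<open>dS_s\<close> the product is minus the metric contracted with its own adjugate,
  that is -2 times the determinant. Thus \<open>hv\<close> can take the part of the transverse
  section in \<open>frame_z\<close>.\<close>

lemma hv_s:
  assumes u: "u \<in> W" shows "lor (hv u) (s u) \<noteq> 0"
proof -
  have "lor (hv u) (s u) = - 2 * dg u"
    by (simp add: hv_def lor_simps dS_s[OF u] dg_def algebra_simps)
  then show ?thesis using dg_nz[OF u] by simp
qed

lemma adapted_CV: "adapted_frame W s (frame_z hv) CV"
  by (rule adapted_frame_z[OF smooth_hv hv_s]) (simp_all add: CV_def)

end

context adapted_frame
begin

lemma trace_II:
  assumes u: "u \<in> W"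
  shows "dg u *\<^sub>R gtrace s u (II V s u) = PV u (hv u) - hv u"
proof -
  have "gtrace s u (II V s u) = (1 / dg u) *\<^sub>R (gg 2 2 u *\<^sub>R BB 1 1 u - gg 1 2 u *\<^sub>R BB 1 2 u - gg 1 2 u *\<^sub>R BB 1 2 u + gg 1 1 u *\<^sub>R BB 2 2 u)"
    unfolding gtrace_def sum_2 II_ee[OF u] ginv_comp[OF u] BB_sym[OF u, of 2 1] by (simp add: algebra_simps)
  then have "dg u *\<^sub>R gtrace s u (II V s u) = gg 2 2 u *\<^sub>R BB 1 1 u - gg 1 2 u *\<^sub>R BB 1 2 u - gg 1 2 u *\<^sub>R BB 1 2 u + gg 1 1 u *\<^sub>R BB 2 2 u"
    using dg_nz[OF u] by simp
  also have "\<dots> = PV u (hv u) - hv u"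
    by (simp add: BB_def hv_def PV_lin algebra_simps,
        simp only: mult_2 scaleR_left_distrib add_ac)
  finally show ?thesis .
qed

lemma trace_II_iff: "u \<in> W \<Longrightarrow> gtrace s u (II V s u) = 0 \<longleftrightarrow> hv u \<in> V u"
  using trace_II[of u] dg_nz[of u] by (auto simp: in_V_iff)

lemma has_signature_V:
  assumes u: "u \<in> W" shows "has_signature 3 1 (V u)"
proof -
  let ?E = "gg 1 1 u" and ?F = "gg 1 2 u"
  have p: "?E > 0" "dg u > 0" "dg u / ?E > 0" using gg11_pos[OF u] dg_pos[OF u] by auto
  \<comment> \<open>Gram-Schmidt for the tangent vectors; in the plane of \<open>s\<close> and
    \<open>z\<close>, whose product is -1, the difference is spacelike and the sum timelike.\<close>
  define e1 where "e1 = (1 / sqrt ?E) *\<^sub>R S 1 u"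
  define f where "f = S 2 u - (?F / ?E) *\<^sub>R S 1 u"
  define e2 where "e2 = (1 / sqrt (dg u / ?E)) *\<^sub>R f"
  define e3 where "e3 = (1 / sqrt 2) *\<^sub>R (s u - z u)"
  define c where "c = (1 / sqrt 2) *\<^sub>R (s u + z u)"
  have ff: "lor f f = dg u / ?E" "lor (S 1 u) f = 0" "lor f (S 1 u) = 0"
    using p by (simp_all add: f_def lor_simps frame_lor[OF u] gg_sym dg_def field_simps)
  have fs: "lor f (s u) = 0" "lor f (z u) = 0" "lor (s u) f = 0" "lor (z u) f = 0"
    by (simp_all add: f_def lor_simps frame_lor[OF u])
  have sq2: "(1 / sqrt x) * ((1 / sqrt x) * x) = 1" if "x > 0" for x :: real using that by (simp add: field_simps)
  have n: "lor e1 e1 = 1" "lor e2 e2 = 1" "lor e3 e3 = 1" "lor c c = - 1"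
    unfolding e1_def e2_def e3_def c_def lor_scaleR_left lor_scaleR_right ff(1) frame_lor(9)[OF u]
    using sq2[OF p(1)] sq2[OF p(3)] sq2[of 2] by (simp_all add: lor_simps frame_lor[OF u])
  have o: "lor e1 e2 = 0" "lor e2 e1 = 0" "lor e1 e3 = 0" "lor e3 e1 = 0" "lor e2 e3 = 0" "lor e3 e2 = 0"
    "lor e1 c = 0" "lor c e1 = 0" "lor e2 c = 0" "lor c e2 = 0" "lor e3 c = 0" "lor c e3 = 0"
    by (simp_all add: e1_def e2_def e3_def c_def lor_simps frame_lor[OF u] ff fs)
  have ne: "e1 \<noteq> e2" "e1 \<noteq> e3" "e2 \<noteq> e3" using n o by auto
  have "V u = span {e1, e2, e3, c}"
  proof -
    have in_V: "e1 \<in> V u" "e2 \<in> V u" "e3 \<in> V u" "c \<in> V u"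
      by (simp_all add: in_V_iff[OF u] e1_def e2_def e3_def c_def f_def PV_lin PV_frame[OF u])
    have 1: "S 1 u = sqrt ?E *\<^sub>R e1" using p by (simp add: e1_def)
    have 2: "S 2 u = sqrt (dg u / ?E) *\<^sub>R e2 + (?F / ?E * sqrt ?E) *\<^sub>R e1"
      using p by (simp add: e1_def e2_def f_def)
    have t: "sqrt 2 / 2 * (1 / sqrt 2) = (1 / 2 :: real)" by simp
    have 3: "s u = (sqrt 2 / 2) *\<^sub>R e3 + (sqrt 2 / 2) *\<^sub>R c" "z u = (sqrt 2 / 2) *\<^sub>R c - (sqrt 2 / 2) *\<^sub>R e3"
      unfolding e3_def c_def scaleR_scaleR t
      by (simp_all add: algebra_simps flip: scaleR_left_distrib)
    have "s u \<in> span {e1, e2, e3, c}" "z u \<in> span {e1, e2, e3, c}" "S 1 u \<in> span {e1, e2, e3, c}" "S 2 u \<in> span {e1, e2, e3, c}"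
      by ((subst 3(1) | subst 3(2) | subst 1 | subst 2), intro span_add span_diff span_scale span_base, simp_all)+
    then have "V u \<subseteq> span {e1, e2, e3, c}" unfolding V_span[OF u] by (intro span_minimal) auto
    moreover have "span {e1, e2, e3, c} \<subseteq> V u"
      using in_V by (intro span_minimal) (auto simp: V_span[OF u])
    ultimately show ?thesis by blast
  qed
  then show ?thesis
    unfolding has_signature_def
    by (intro exI[of _ "{e1, e2, e3}"] exI[of _ "{c}"]) (use n o ne in \<open>auto simp: insert_commute\<close>)
qed

end

context null_immersion
begin

lemma central_frame_CV:
  assumes V: "\<And>w. w \<in> W \<Longrightarrow> V w = CV w"
  shows "central_frame W s (frame_z hv) V"
proof -
  interpret adapted_frame W s "frame_z hv" V
    by (rule adapted_frame_z[OF smooth_hv hv_s]) (simp_all add: V CV_def)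
  show ?thesis
  proof
    fix w assume w: "w \<in> W"
    have "hv w \<in> V w" by (simp add: V[OF w] CV_def span_base)
    then have h: "PV w (hv w) = hv w" by (simp add: in_V_iff[OF w])
    have "gg 2 2 w *\<^sub>R BB 1 1 w - (2 * gg 1 2 w) *\<^sub>R BB 1 2 w + gg 1 1 w *\<^sub>R BB 2 2 w = PV w (hv w) - hv w"
      by (simp add: BB_def hv_def PV_lin algebra_simps)
    then show "gg 2 2 w *\<^sub>R BB 1 1 w - (2 * gg 1 2 w) *\<^sub>R BB 1 2 w + gg 1 1 w *\<^sub>R BB 2 2 w = 0"
      by (simp add: h)
  qed
qed

end

section \<open>Independence of chart and section\<close>

text \<open>A change of coordinates and of section multiplies \<open>hv\<close> by the cube of the
  conformal factor and the square of the Jacobian, modulo the span of the section and its first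
  derivatives. One inclusion suffices, since the roles of the two sides can be exchanged.\<close>

lemma CV_reparametrize:
  fixes s s' :: "real^2 \<Rightarrow> ('m::finite) lorentz" and \<tau> :: "real^2 \<Rightarrow> real^2" and l :: "real^2 \<Rightarrow> real"
  assumes A: "null_immersion T s" and B: "null_immersion W' s'" and \<tau>: "smooth_on \<tau> T" "\<tau> ` T \<subseteq> W'"
    and l: "smooth_on l T" and s: "\<And>w. w \<in> T \<Longrightarrow> s w = l w *\<^sub>R s' (\<tau> w)" and u: "u \<in> T"
  shows "null_immersion.CV s u \<subseteq> null_immersion.CV s' (\<tau> u)"
proof -
  interpret A: null_immersion T s by (rule A)
  interpret B: null_immersion W' s' by (rule B)
  have \<tau>u: "\<tau> w \<in> W'" if "w \<in> T" for w using \<tau>(2) that by blast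
  define t where "t i k w = dird (ee i) \<tau> w $ k" for i k w
  have st: "smooth_on (t i k) T" for i k
    unfolding t_def[abs_def] by (intro smooth_on_linear[OF bounded_linear_vec_nth A.W] smooth_on_dird_ee \<tau>)
  have sc: "smooth_on (\<lambda>w. f (\<tau> w)) T" if "smooth_on f W'" for f :: "real^2 \<Rightarrow> 'm lorentz"
    by (rule smooth_on_compose[OF A.W B.W \<tau>(2,1) that])
  have dc: "dird (ee i) (\<lambda>w. f (\<tau> w)) w = t i 1 w *\<^sub>R dird (ee 1) f (\<tau> w) + t i 2 w *\<^sub>R dird (ee 2) f (\<tau> w)"
    if f: "smooth_on f W'" and w: "w \<in> T" for f :: "real^2 \<Rightarrow> 'm lorentz" and i w
    unfolding t_def dird_compose[OF A.diffI[OF \<tau>(1) w] B.diffI[OF f \<tau>u[OF w]]]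
    by (rule dird_expand[OF B.diffI[OF f \<tau>u[OF w]]])
  note sml = smooth_on_dird_ee[OF l]
  have D1: "A.S i w = dird (ee i) l w *\<^sub>R s' (\<tau> w) + l w *\<^sub>R (t i 1 w *\<^sub>R B.S 1 (\<tau> w) + t i 2 w *\<^sub>R B.S 2 (\<tau> w))"
    if w: "w \<in> T" for i w
  proof -
    have "A.S i w = dird (ee i) (\<lambda>w. l w *\<^sub>R s' (\<tau> w)) w" by (rule dird_cong[OF A.W w s])
    then show ?thesis
      by (simp add: dird_scaleR[OF A.diffI[OF l w] A.diffI[OF sc[OF B.smooth_s] w]] dc[OF B.smooth_s w])
  qed
  let ?L = "span {s' (\<tau> u), B.S 1 (\<tau> u), B.S 2 (\<tau> u)}"
  have base: "s' (\<tau> u) \<in> ?L" "B.S i (\<tau> u) \<in> ?L" for i using exhaust_2[of i] by (auto intro: span_base)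
  \<comment> \<open>The second derivatives of \<open>s'\<close> pulled back by the Jacobian
    \<open>t\<close>. All other terms of the second derivatives of \<open>s\<close> involve at most
    first derivatives of \<open>s'\<close>, hence lie in \<open>?L\<close>.\<close>
  let ?D = "\<lambda>i j. t i 1 u *\<^sub>R (t j 1 u *\<^sub>R dird (ee 1) (B.S 1) (\<tau> u) + t j 2 u *\<^sub>R dird (ee 2) (B.S 1) (\<tau> u))
      + t i 2 u *\<^sub>R (t j 1 u *\<^sub>R dird (ee 1) (B.S 2) (\<tau> u) + t j 2 u *\<^sub>R dird (ee 2) (B.S 2) (\<tau> u))"
  have D2: "dird (ee j) (A.S i) u - l u *\<^sub>R ?D i j \<in> ?L" for i j
  proof -
    note dl = A.diffI[OF sml u] A.diffI[OF l u] A.diffI[OF st u] A.diffI[OF sc[OF B.smooth_s] u] A.diffI[OF sc[OF B.smooth_S] u]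
    have "dird (ee j) (A.S i) u = dird (ee j) (\<lambda>w. dird (ee i) l w *\<^sub>R s' (\<tau> w) + l w *\<^sub>R (t i 1 w *\<^sub>R B.S 1 (\<tau> w) + t i 2 w *\<^sub>R B.S 2 (\<tau> w))) u"
      by (rule dird_cong[OF A.W u D1])
    also have "\<dots> = (dird (ee j) (dird (ee i) l) u *\<^sub>R s' (\<tau> u) + dird (ee i) l u *\<^sub>R (t j 1 u *\<^sub>R B.S 1 (\<tau> u) + t j 2 u *\<^sub>R B.S 2 (\<tau> u)))
      + (dird (ee j) l u *\<^sub>R (t i 1 u *\<^sub>R B.S 1 (\<tau> u) + t i 2 u *\<^sub>R B.S 2 (\<tau> u))
      + l u *\<^sub>R ((dird (ee j) (t i 1) u *\<^sub>R B.S 1 (\<tau> u) + t i 1 u *\<^sub>R (t j 1 u *\<^sub>R dird (ee 1) (B.S 1) (\<tau> u) + t j 2 u *\<^sub>R dird (ee 2) (B.S 1) (\<tau> u)))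
        + (dird (ee j) (t i 2) u *\<^sub>R B.S 2 (\<tau> u) + t i 2 u *\<^sub>R (t j 1 u *\<^sub>R dird (ee 1) (B.S 2) (\<tau> u) + t j 2 u *\<^sub>R dird (ee 2) (B.S 2) (\<tau> u)))))"
      by (simp add: dird_add dird_scaleR dl differentiable_add differentiable_scaleR dc[OF B.smooth_s u] dc[OF B.smooth_S u])
    finally have e: "dird (ee j) (A.S i) u - l u *\<^sub>R ?D i j =
        dird (ee j) (dird (ee i) l) u *\<^sub>R s' (\<tau> u) + dird (ee i) l u *\<^sub>R (t j 1 u *\<^sub>R B.S 1 (\<tau> u) + t j 2 u *\<^sub>R B.S 2 (\<tau> u))
      + dird (ee j) l u *\<^sub>R (t i 1 u *\<^sub>R B.S 1 (\<tau> u) + t i 2 u *\<^sub>R B.S 2 (\<tau> u))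
      + l u *\<^sub>R (dird (ee j) (t i 1) u *\<^sub>R B.S 1 (\<tau> u) + dird (ee j) (t i 2) u *\<^sub>R B.S 2 (\<tau> u))"
      by (simp add: algebra_simps)
    show ?thesis unfolding e by (intro span_add span_scale base)
  qed
  have g: "A.gg i j u = (l u)\<^sup>2 * (t i 1 u * (t j 1 u * B.gg 1 1 (\<tau> u) + t j 2 u * B.gg 1 2 (\<tau> u))
     + t i 2 u * (t j 1 u * B.gg 1 2 (\<tau> u) + t j 2 u * B.gg 2 2 (\<tau> u)))" for i j
  proof -
    have "lor (B.S i (\<tau> u)) (s' (\<tau> u)) = 0" for i using B.perp_s[OF \<tau>u[OF u]] by (simp add: lor_sym)
    then show ?thesis
      unfolding A.gg_def D1[OF u]
      by (simp add: lor_simps B.gg_def B.null_s[OF \<tau>u[OF u]] B.perp_s[OF \<tau>u[OF u]] lor_sym[of "B.S 2 (\<tau> u)" "B.S 1 (\<tau> u)"]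
        power2_eq_square algebra_simps)
  qed
  define dt where "dt = t 1 1 u * t 2 2 u - t 1 2 u * t 2 1 u"
  have sym: "dird (ee 2) (B.S 1) (\<tau> u) = dird (ee 1) (B.S 2) (\<tau> u)" by (rule B.dS_sym[OF \<tau>u[OF u]])
  \<comment> \<open>Contraction with the adjugate of the metric; under pull-back by a matrix such a
    contraction is multiplied by the square of its determinant, here \<open>dt\<close>.\<close>
  have h: "A.gg 2 2 u *\<^sub>R ?D 1 1 - (2 * A.gg 1 2 u) *\<^sub>R ?D 2 1 + A.gg 1 1 u *\<^sub>R ?D 2 2 = ((l u)\<^sup>2 * dt\<^sup>2) *\<^sub>R B.hv (\<tau> u)"
  proof (rule lor_eqI)
    fix x
    let ?a = "lor (dird (ee 1) (B.S 1) (\<tau> u)) x" and ?b = "lor (dird (ee 1) (B.S 2) (\<tau> u)) x" and ?c = "lor (dird (ee 2) (B.S 2) (\<tau> u)) x"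
    show "lor (A.gg 2 2 u *\<^sub>R ?D 1 1 - (2 * A.gg 1 2 u) *\<^sub>R ?D 2 1 + A.gg 1 1 u *\<^sub>R ?D 2 2) x = lor (((l u)\<^sup>2 * dt\<^sup>2) *\<^sub>R B.hv (\<tau> u)) x"
      unfolding B.hv_def sym g dt_def lor_scaleR_left lor_add_left lor_diff_left by algebra
  qed
  have "A.hv u - l u *\<^sub>R (((l u)\<^sup>2 * dt\<^sup>2) *\<^sub>R B.hv (\<tau> u)) =
     A.gg 2 2 u *\<^sub>R (dird (ee 1) (A.S 1) u - l u *\<^sub>R ?D 1 1) - (2 * A.gg 1 2 u) *\<^sub>R (dird (ee 1) (A.S 2) u - l u *\<^sub>R ?D 2 1)
     + A.gg 1 1 u *\<^sub>R (dird (ee 2) (A.S 2) u - l u *\<^sub>R ?D 2 2)"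
    unfolding h[symmetric] A.hv_def by (simp only: scaleR_add_right scaleR_diff_right scaleR_scaleR mult.commute[of "l u"] mult.assoc) (simp add: algebra_simps)
  also have "\<dots> \<in> ?L" by (intro span_add span_diff span_scale D2)
  also have "?L \<subseteq> B.CV (\<tau> u)" unfolding B.CV_def by (intro span_mono) auto
  finally have "A.hv u - l u *\<^sub>R (((l u)\<^sup>2 * dt\<^sup>2) *\<^sub>R B.hv (\<tau> u)) \<in> B.CV (\<tau> u)" .
  moreover have "l u *\<^sub>R (((l u)\<^sup>2 * dt\<^sup>2) *\<^sub>R B.hv (\<tau> u)) \<in> B.CV (\<tau> u)"
    unfolding B.CV_def by (intro span_scale span_base) simp
  ultimately have hv: "A.hv u \<in> B.CV (\<tau> u)"
    unfolding B.CV_def using span_add by fastforce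
  have "A.S i u \<in> B.CV (\<tau> u)" for i
    unfolding D1[OF u] B.CV_def by (intro span_add span_scale span_base) auto
  moreover have "s u \<in> B.CV (\<tau> u)" unfolding s[OF u] B.CV_def by (intro span_scale span_base) auto
  ultimately show ?thesis
    using hv unfolding A.CV_def by (intro span_minimal) (auto simp: B.CV_def)
qed

section \<open>The bivector dual to a bilinear form\<close>

context null_immersion
begin

definition sharp :: "(real^2 \<Rightarrow> real^2 \<Rightarrow> real^2 \<Rightarrow> real) \<Rightarrow> real^2 \<Rightarrow> real^2 \<Rightarrow> 'm lorentz" where
  "sharp q w X = up 1 w (q w X (ee 1)) (q w X (ee 2)) *\<^sub>R S 1 w + up 2 w (q w X (ee 1)) (q w X (ee 2)) *\<^sub>R S 2 w"

text \<open>The formula uses only \<open>s\<close> and \<open>ds\<close>, so it needs no choice of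
  congruence; by \<open>qform_mem\<close> its values lie in so(V) for every \<open>V\<close> with an
  adapted frame.\<close>

definition qform :: "(real^2 \<Rightarrow> real^2 \<Rightarrow> real^2 \<Rightarrow> real) \<Rightarrow> real^2 \<Rightarrow> real^2 \<Rightarrow> 'm lorentz \<Rightarrow> 'm lorentz" where
  "qform q w X v = lor v (s w) *\<^sub>R sharp q w X - lor v (sharp q w X) *\<^sub>R s w"

lemma lor_sharp:
  assumes u: "u \<in> W" and q: "linear (q u X)"
  shows "lor (sharp q u X) (s u) = 0" "lor (sharp q u X) (dird Y s u) = q u X Y"
proof -
  show "lor (sharp q u X) (s u) = 0"
    by (simp add: sharp_def lor_simps perp_s[OF u] lor_sym[of "dird _ s u" "s u"])
  have S: "lor (sharp q u X) (S i u) = q u X (ee i)" for i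
    using exhaust_2[of i] up_lower[OF u, of "q u X (ee 1)" "q u X (ee 2)"]
    by (auto simp: sharp_def lor_simps gg_def[symmetric] gg_sym)
  show "lor (sharp q u X) (dird Y s u) = q u X Y"
    unfolding dird_expand[OF diffI[OF smooth_s u], of Y] linear_expand2[OF q, of Y]
    by (simp add: lor_simps S)
qed

lemma qform_frame:
  assumes u: "u \<in> W" and q: "linear (q u X)"
  shows "qform q u X (s u) = 0" "qform q u X (dird Y s u) = - (q u X Y *\<^sub>R s u)"
proof -
  have "lor (dird Y s u) (s u) = 0"
    unfolding dird_expand[OF diffI[OF smooth_s u], of Y] by (simp add: lor_simps perp_s[OF u] lor_sym[of "dird _ s u" "s u"])
  then show "qform q u X (s u) = 0" "qform q u X (dird Y s u) = - (q u X Y *\<^sub>R s u)"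
    using lor_sharp[where q = q, OF u q] by (simp_all add: qform_def null_s[OF u] lor_sym[of _ "sharp q u X"])
qed

lemma qform_linear:
  assumes q: "\<And>Y. linear (\<lambda>X. q u X Y)" shows "linear (\<lambda>X. qform q u X v)"
  by (rule linearI) (simp_all add: qform_def sharp_def linear_add[OF q] linear_scale[OF q] up_linear lor_simps algebra_simps)

lemma qform_smooth:
  assumes q: "\<And>Y. smooth_on (\<lambda>u. q u X Y) W" shows "smooth_on (\<lambda>u. qform q u X v) W"
  unfolding qform_def sharp_def by (intro smooth_ops smooth_up smooth_S q)

end

lemma (in adapted_frame) qform_mem:
  assumes u: "u \<in> W" and q: "linear (q u X)"
  shows "qform q u X \<in> stab_perp (span {s u}) \<inter> so_sub (V u)"
proof -
  have "PV u (sharp q u X) = sharp q u X"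
    by (simp add: sharp_def PV_lin PV_frame[OF u])
  from wedge_stab[OF u this lor_sharp(1)[where q = q, OF u q]] show ?thesis by (simp add: qform_def[abs_def])
qed

lemma null_lineD:
  assumes "null_line (l :: ('m::finite) lorentz set)" "v \<in> l" "v \<noteq> 0"
  shows "l = span {v}" "lor v v = 0" "snd v \<noteq> 0"
proof -
  obtain b where b: "b \<noteq> 0" "lor b b = 0" "l = span {b}" using assms(1) unfolding null_line_def by blast
  then obtain c where c: "v = c *\<^sub>R b" using assms(2) by (auto simp: span_singleton)
  with assms(3) have "c \<noteq> 0" by auto
  then show "l = span {v}" unfolding b(3) c using span_image_scale[of "{b}" "\<lambda>_. c"] by simp
  show n: "lor v v = 0" by (simp add: c lor_simps b)
  show "snd v \<noteq> 0"
  proof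
    assume "snd v = 0"
    then have "fst v = 0" using n by (simp add: lor_def)
    then show False using \<open>snd v = 0\<close> assms(3) by (simp add: prod_eq_iff)
  qed
qed

section \<open>Charts, positive sections and the induced metric\<close>

locale immersed =
  fixes A :: "'a::topological_space chart set" and \<Lambda> :: "'a \<Rightarrow> ('m::finite) lorentz set"
  assumes surf: "smooth_surface A" and imm: "immersed_surface A \<Lambda>"
begin

lemma chart:
  assumes "P \<in> A"
  shows "open (fst P)" "open (snd P ` fst P)" "continuous_on (fst P) (snd P)"
    "\<And>u. u \<in> fst P \<Longrightarrow> inv_into (fst P) (snd P) (snd P u) = u"
  using surf assms unfolding smooth_surface_def homeomorphism_def by blast+

lemma chart_ex: obtains P u where "P \<in> A" "u \<in> fst P" "snd P u = p"
proof -
  have "(\<Union>P\<in>A. snd P ` fst P) = UNIV" using surf unfolding smooth_surface_def by blast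
  then obtain P where "P \<in> A" "p \<in> snd P ` fst P" by blast
  then show ?thesis using that by blast
qed

lemma open_preimage: "P \<in> A \<Longrightarrow> open U \<Longrightarrow> open {u \<in> fst P. snd P u \<in> U}"
proof -
  assume "P \<in> A" "open U"
  then have "open (fst P \<inter> snd P -` U)" using continuous_open_preimage[OF chart(3) chart(1)] by blast
  moreover have "{u \<in> fst P. snd P u \<in> U} = fst P \<inter> snd P -` U" by auto
  ultimately show ?thesis by simp
qed

lemma transition_props:
  assumes P: "P \<in> A" and P': "P' \<in> A"
  shows "open (overlap P P')" "smooth_on (transition P P') (overlap P P')"
    "transition P P' ` overlap P P' \<subseteq> fst P'" "\<And>u. u \<in> overlap P P' \<Longrightarrow> snd P' (transition P P' u) = snd P u"
    "\<And>u u'. u \<in> fst P \<Longrightarrow> u' \<in> fst P' \<Longrightarrow> snd P u = snd P' u' \<Longrightarrow> u \<in> overlap P P' \<and> transition P P' u = u'"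
proof -
  show "open (overlap P P')" unfolding overlap_def by (rule open_preimage[OF P chart(2)[OF P']])
  show "smooth_on (transition P P') (overlap P P')" using surf P P' unfolding smooth_surface_def by blast
  show "transition P P' ` overlap P P' \<subseteq> fst P'" by (auto simp: transition_def overlap_def inv_into_into)
  show "snd P' (transition P P' u) = snd P u" if "u \<in> overlap P P'" for u
    using that by (auto simp: transition_def overlap_def f_inv_into_f)
  show "u \<in> overlap P P' \<and> transition P P' u = u'" if "u \<in> fst P" "u' \<in> fst P'" "snd P u = snd P' u'" for u u'
    using that chart(4)[OF P' that(2)] by (auto simp: transition_def overlap_def)
qed

lemma positive_immersion:
  assumes \<sigma>: "positive_section A \<Lambda> \<sigma>" and P: "P \<in> A"
  shows "null_immersion (fst P) (\<sigma> \<circ> snd P)" "\<And>p. \<Lambda> p = span {\<sigma> p}" "\<And>p. snd (\<sigma> p) > 0"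
proof -
  have pc: "\<sigma> p \<in> \<Lambda> p" "lor (\<sigma> p) (\<sigma> p) = 0" "snd (\<sigma> p) > 0" for p
    using \<sigma> by (auto simp: positive_section_def pos_cone_def)
  then show "snd (\<sigma> p) > 0" for p by blast
  have nl: "null_line (\<Lambda> p)" for p using imm unfolding immersed_surface_def by blast
  have nz: "\<sigma> p \<noteq> 0" for p using pc(3)[of p] by auto
  show L: "\<Lambda> p = span {\<sigma> p}" for p by (rule null_lineD(1)[OF nl pc(1) nz])
  have sm: "smooth_on (\<sigma> \<circ> snd P) (fst P)"
    using \<sigma> P unfolding positive_section_def smooth_map_on_def by auto
  show "null_immersion (fst P) (\<sigma> \<circ> snd P)"
  proof
    show "open (fst P)" by (rule chart(1)[OF P])
    show "smooth_on (\<sigma> \<circ> snd P) (fst P)" by (rule sm)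
    show n: "lor ((\<sigma> \<circ> snd P) w) ((\<sigma> \<circ> snd P) w) = 0" for w by (simp add: pc)
    fix w X assume w: "w \<in> fst P" and X: "X \<noteq> (0 :: real^2)"
    let ?s = "\<sigma> \<circ> snd P"
    note d = smooth_on_differentiable[OF sm chart(1)[OF P] w]
    have "dird X (\<lambda>w. lor (?s w) (?s w)) w = 0" by (simp only: n dird_const)
    then have perp: "lor (?s w) (dird X ?s w) = 0"
      using dird_lor[OF d d, of X] by (simp add: lor_sym)
    have pos: "snd (?s w) > 0" by (simp add: pc)
    note np = null_perp_nonneg[OF n pos perp]
    \<comment> \<open>A null derivative orthogonal to the section would lie in \<Lambda>, contrary
      to the immersion condition.\<close>
    have "lor (dird X ?s w) (dird X ?s w) \<noteq> 0"
    proof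
      assume "lor (dird X ?s w) (dird X ?s w) = 0"
      then have "dird X ?s w \<in> \<Lambda> (snd P w)" using np(2) by (simp add: L)
      then show False using imm \<sigma> P w X unfolding immersed_surface_def by blast
    qed
    then show "metric ?s w X X > 0" using np(1) by (simp add: metric_def)
  qed
qed

text \<open>Normalizing the second component to 1 gives a global positive section without gluing;
  every positive section is its own second component times this one.\<close>

definition \<sigma>0 :: "'a \<Rightarrow> 'm lorentz" where "\<sigma>0 p = (SOME v. v \<in> \<Lambda> p \<and> snd v = 1)"

lemma \<sigma>0_eq: assumes "v \<in> \<Lambda> p" "v \<noteq> 0" shows "\<sigma>0 p = (1 / snd v) *\<^sub>R v"
proof -
  have nl: "null_line (\<Lambda> p)" using imm unfolding immersed_surface_def by blast
  note n = null_lineD[OF nl assms]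
  show ?thesis unfolding \<sigma>0_def
  proof (rule some_equality)
    show "(1 / snd v) *\<^sub>R v \<in> \<Lambda> p \<and> snd ((1 / snd v) *\<^sub>R v) = 1"
      using n by (simp add: span_scale span_base)
    fix w assume "w \<in> \<Lambda> p \<and> snd w = 1"
    then show "w = (1 / snd v) *\<^sub>R v" using n by (auto simp: span_singleton nonzero_eq_divide_eq)
  qed
qed

lemma positive_\<sigma>0: "positive_section A \<Lambda> \<sigma>0"
  unfolding positive_section_def
proof (intro conjI allI)
  have nl: "null_line (\<Lambda> p)" for p using imm unfolding immersed_surface_def by blast
  show "\<sigma>0 p \<in> \<Lambda> p \<inter> pos_cone" for p
  proof -
    obtain v where v: "v \<noteq> 0" "v \<in> \<Lambda> p" using nl[of p] unfolding null_line_def by (auto intro: span_base)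
    note n = null_lineD[OF nl v(2,1)]
    show ?thesis unfolding \<sigma>0_eq[OF v(2,1)] pos_cone_def
      using n v by (auto simp: lor_simps span_scale span_base)
  qed
  show "smooth_map_on A UNIV \<sigma>0"
    unfolding smooth_map_on_def
  proof
    fix P assume P: "P \<in> A"
    have "smooth_on (\<sigma>0 \<circ> snd P) (fst P)"
    proof (rule smooth_on_local[OF chart(1)[OF P]])
      fix u assume u: "u \<in> fst P"
      obtain U b where U: "open U" "snd P u \<in> U" "smooth_map_on A U (b (0::nat))"
        "\<And>p'. p' \<in> U \<Longrightarrow> independent {b 0 p'} \<and> \<Lambda> p' = span {b 0 p'}"
        using imm[unfolded immersed_surface_def smooth_subbundle_def, THEN conjunct1, rule_format, of "snd P u"]
        by (auto simp: lessThan_Suc)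
      let ?T = "{w \<in> fst P. snd P w \<in> U}"
      have T: "open ?T" by (rule open_preimage[OF P U(1)])
      have b: "b 0 p' \<in> \<Lambda> p'" "b 0 p' \<noteq> 0" if "p' \<in> U" for p'
        using U(4)[OF that] dependent_single by (auto intro: span_base)
      have sb: "smooth_on (b 0 \<circ> snd P) ?T" using U(3) P unfolding smooth_map_on_def by blast
      have "smooth_on (\<lambda>w. (1 / snd ((b 0 \<circ> snd P) w)) *\<^sub>R (b 0 \<circ> snd P) w) ?T"
        using null_lineD(3)[OF nl b]
        by (intro smooth_on_scaleR smooth_on_divide smooth_on_const smooth_on_linear[OF bounded_linear_snd] sb T) auto
      then have "smooth_on (\<sigma>0 \<circ> snd P) ?T"
        by (rule smooth_on_cong[OF T]) (auto simp: \<sigma>0_eq[OF b])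
      then show "\<exists>T. open T \<and> u \<in> T \<and> smooth_on (\<sigma>0 \<circ> snd P) T" using T u U(2) by blast
    qed
    then show "smooth_on (\<sigma>0 \<circ> snd P) {u \<in> fst P. snd P u \<in> UNIV}" by simp
  qed
qed

section \<open>Existence and uniqueness of the central congruence\<close>

definition CVs :: "('a \<Rightarrow> 'm lorentz) \<Rightarrow> 'a chart \<Rightarrow> real^2 \<Rightarrow> 'm lorentz set" where
  "CVs \<sigma> P u = null_immersion.CV (\<sigma> \<circ> snd P) u"

lemma CVs_subset:
  assumes \<sigma>: "positive_section A \<Lambda> \<sigma>" and \<sigma>': "positive_section A \<Lambda> \<sigma>'" and P: "P \<in> A" and P': "P' \<in> A"
    and u: "u \<in> fst P" "u' \<in> fst P'" "snd P u = snd P' u'"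
  shows "CVs \<sigma> P u \<subseteq> CVs \<sigma>' P' u'"
proof -
  note tr = transition_props[OF P P']
  note I = positive_immersion[OF \<sigma> P] and I' = positive_immersion[OF \<sigma>' P']
  interpret N: null_immersion "fst P" "\<sigma> \<circ> snd P" by (rule I)
  interpret N': null_immersion "fst P'" "\<sigma>' \<circ> snd P'" by (rule I')
  let ?T = "overlap P P'"
  have sub: "?T \<subseteq> fst P" by (auto simp: overlap_def)
  have uT: "u \<in> ?T" "transition P P' u = u'" using tr(5)[OF u] by auto
  have IT: "null_immersion ?T (\<sigma> \<circ> snd P)"
  proof
    show "open ?T" "smooth_on (\<sigma> \<circ> snd P) ?T" by (rule tr(1), rule smooth_on_subset[OF N.smooth_s sub])
    fix w assume "w \<in> ?T"
    then have w: "w \<in> fst P" using sub by blast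
    show "lor ((\<sigma> \<circ> snd P) w) ((\<sigma> \<circ> snd P) w) = 0" by (rule N.null_s[OF w])
    show "metric (\<sigma> \<circ> snd P) w X X > 0" if "X \<noteq> 0" for X by (rule N.pos[OF w that])
  qed
  \<comment> \<open>The conformal factor between the two sections, read off from their second
    components and therefore visibly smooth.\<close>
  let ?l = "\<lambda>w. snd ((\<sigma> \<circ> snd P) w) / snd ((\<sigma>' \<circ> snd P') (transition P P' w))"
  have sl: "smooth_on ?l ?T"
  proof (rule smooth_on_divide[OF tr(1)])
    show "smooth_on (\<lambda>w. snd ((\<sigma> \<circ> snd P) w)) ?T"
      by (rule smooth_on_linear[OF bounded_linear_snd tr(1) smooth_on_subset[OF N.smooth_s sub]])
    show "smooth_on (\<lambda>w. snd ((\<sigma>' \<circ> snd P') (transition P P' w))) ?T"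
      by (rule smooth_on_linear[OF bounded_linear_snd tr(1) smooth_on_compose[OF tr(1) chart(1)[OF P'] tr(3,2) N'.smooth_s]])
    show "snd ((\<sigma>' \<circ> snd P') (transition P P' w)) \<noteq> 0" for w using I'(3)[of "snd P' (transition P P' w)"] by simp
  qed
  have e: "(\<sigma> \<circ> snd P) w = ?l w *\<^sub>R (\<sigma>' \<circ> snd P') (transition P P' w)" if w: "w \<in> ?T" for w
  proof -
    have "\<sigma> (snd P w) \<in> span {\<sigma>' (snd P w)}" using \<sigma> I'(2) unfolding positive_section_def by blast
    then obtain c where c: "\<sigma> (snd P w) = c *\<^sub>R \<sigma>' (snd P w)" by (auto simp: span_singleton)
    then have "c = snd (\<sigma> (snd P w)) / snd (\<sigma>' (snd P w))" using I'(3)[of "snd P w"] by simp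
    then show ?thesis using c by (simp add: tr(4)[OF w])
  qed
  show ?thesis
    using CV_reparametrize[OF IT I'(1) tr(2,3) sl e uT(1)] unfolding CVs_def uT(2) .
qed

text \<open>An arbitrary chart point over \<open>p\<close> is chosen. The choice is harmless because
  \<open>CVs_subset\<close> applies in both directions, which is \<open>V0_eq\<close>.\<close>

definition V0 :: "'a \<Rightarrow> 'm lorentz set" where
  "V0 p = (let Pu = (SOME Pu. fst Pu \<in> A \<and> snd Pu \<in> fst (fst Pu) \<and> snd (fst Pu) (snd Pu) = p) in CVs \<sigma>0 (fst Pu) (snd Pu))"

lemma V0_eq:
  assumes \<sigma>: "positive_section A \<Lambda> \<sigma>" and P: "P \<in> A" and u: "u \<in> fst P"
  shows "V0 (snd P u) = CVs \<sigma> P u"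
proof -
  define Pu where "Pu = (SOME Pu. fst Pu \<in> A \<and> snd Pu \<in> fst (fst Pu) \<and> snd (fst Pu) (snd Pu) = snd P u)"
  have "fst Pu \<in> A \<and> snd Pu \<in> fst (fst Pu) \<and> snd (fst Pu) (snd Pu) = snd P u"
    unfolding Pu_def by (rule someI[of _ "(P, u)"]) (use P u in simp)
  then show ?thesis
    unfolding V0_def Pu_def[symmetric] Let_def
    using CVs_subset[OF positive_\<sigma>0 \<sigma>, of "fst Pu" P "snd Pu" u] CVs_subset[OF \<sigma> positive_\<sigma>0, of P "fst Pu" u "snd Pu"] P u
    by auto
qed

lemma enveloped_V0: "enveloped_congruence A \<Lambda> V0"
  unfolding enveloped_congruence_def
proof (intro conjI allI impI ballI)
  have sig: "has_signature 3 1 (V0 (snd P u))" if P: "P \<in> A" and u: "u \<in> fst P" for P u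
  proof -
    interpret N: null_immersion "fst P" "\<sigma>0 \<circ> snd P" by (rule positive_immersion[OF positive_\<sigma>0 P])
    interpret F: adapted_frame "fst P" "\<sigma>0 \<circ> snd P" "N.frame_z N.hv" N.CV by (rule N.adapted_CV)
    show ?thesis using F.has_signature_V[OF u] unfolding V0_eq[OF positive_\<sigma>0 P u] CVs_def .
  qed
  then show "has_signature 3 1 (V0 p)" for p by (metis chart_ex)
  show "smooth_subbundle A 4 V0"
    unfolding smooth_subbundle_def
  proof
    fix p obtain P u where P: "P \<in> A" "u \<in> fst P" "snd P u = p" by (rule chart_ex)
    interpret N: null_immersion "fst P" "\<sigma>0 \<circ> snd P" by (rule positive_immersion[OF positive_\<sigma>0 P(1)])
    define F where "F = (\<lambda>i::nat. if i = 0 then \<sigma>0 \<circ> snd P else if i = 1 then N.S 1 else if i = 2 then N.S 2 else N.hv)"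
    define b where "b = (\<lambda>i p'. F i (inv_into (fst P) (snd P) p'))"
    have sF: "smooth_on (F i) (fst P)" for i
      unfolding F_def using N.smooth_s N.smooth_S N.smooth_hv by auto
    have sb: "smooth_map_on A (snd P ` fst P) (b i)" for i
      unfolding smooth_map_on_def
    proof
      fix P' assume P': "P' \<in> A"
      note tr = transition_props[OF P' P(1)]
      have "b i \<circ> snd P' = (\<lambda>w. F i (transition P' P w))" by (simp add: b_def transition_def fun_eq_iff)
      then show "smooth_on (b i \<circ> snd P') {u \<in> fst P'. snd P' u \<in> snd P ` fst P}"
        using smooth_on_compose[OF tr(1) chart(1)[OF P(1)] tr(3,2) sF, of i] by (simp add: overlap_def)
    qed
    have E: "V0 p' = span ((\<lambda>i. b i p') ` {..<4})" if p': "p' \<in> snd P ` fst P" for p'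
    proof -
      let ?w = "inv_into (fst P) (snd P) p'"
      have w: "?w \<in> fst P" "snd P ?w = p'" using p' by (simp_all add: inv_into_into f_inv_into_f)
      show ?thesis
        using V0_eq[OF positive_\<sigma>0 P(1) w(1)] unfolding w(2) CVs_def N.CV_def image_lessThan_4 b_def F_def by simp
    qed
    show "\<exists>U b. open U \<and> p \<in> U \<and> (\<forall>i<4::nat. smooth_map_on A U (b i)) \<and>
       (\<forall>p'\<in>U. inj_on (\<lambda>i. b i p') {..<4} \<and> independent ((\<lambda>i. b i p') ` {..<4}) \<and> V0 p' = span ((\<lambda>i. b i p') ` {..<4}))"
    proof (intro exI conjI ballI allI impI)
      show "open (snd P ` fst P)" "p \<in> snd P ` fst P" using chart(2)[OF P(1)] P by auto
      show "smooth_map_on A (snd P ` fst P) (b i)" for i by (rule sb)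
      fix p' assume p': "p' \<in> snd P ` fst P"
      then obtain w where w: "w \<in> fst P" "p' = snd P w" by blast
      have "dim (span ((\<lambda>i. b i p') ` {..<4})) = 4"
        using has_signature_nondegenerate(1)[OF sig[OF P(1) w(1)]] unfolding w(2)[symmetric] E[OF p'] by simp
      \<comment> \<open>The signature gives dimension four, and four vectors that span a space of
        dimension four are distinct and independent.\<close>
      note d = span_image_dim[OF this]
      show "inj_on (\<lambda>i. b i p') {..<4}" "independent ((\<lambda>i. b i p') ` {..<4})" by (rule d)+
      show "V0 p' = span ((\<lambda>i. b i p') ` {..<4})" by (rule E[OF p'])
    qed
  qed
  fix \<sigma> P u assume \<sigma>: "positive_section A \<Lambda> \<sigma>" and P: "P \<in> A" and u: "u \<in> fst P"
  interpret N: null_immersion "fst P" "\<sigma> \<circ> snd P" by (rule positive_immersion[OF \<sigma> P])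
  have "dird X (\<sigma> \<circ> snd P) u \<in> N.CV u" for X
    unfolding dird_expand[OF N.diffI[OF N.smooth_s u], of X] N.CV_def by (intro span_add span_scale span_base) auto
  moreover have "\<sigma> (snd P u) \<in> N.CV u" unfolding N.CV_def by (intro span_base) simp
  ultimately show "span (insert (\<sigma> (snd P u)) (range (\<lambda>X. dird X (\<sigma> \<circ> snd P) u))) \<subseteq> V0 (snd P u)"
    unfolding V0_eq[OF \<sigma> P u] CVs_def by (intro span_minimal) (auto simp: N.CV_def)
qed

lemma central_frame_V0:
  assumes \<sigma>: "positive_section A \<Lambda> \<sigma>" and P: "P \<in> A"
  shows "central_frame (fst P) (\<sigma> \<circ> snd P) (null_immersion.frame_z (\<sigma> \<circ> snd P) (null_immersion.hv (\<sigma> \<circ> snd P))) (V0 \<circ> snd P)"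
proof -
  interpret N: null_immersion "fst P" "\<sigma> \<circ> snd P" by (rule positive_immersion[OF \<sigma> P])
  show ?thesis by (rule N.central_frame_CV) (simp add: V0_eq[OF \<sigma> P] CVs_def)
qed

lemma trace_V0:
  assumes \<sigma>: "positive_section A \<Lambda> \<sigma>" and P: "P \<in> A" and u: "u \<in> fst P"
  shows "gtrace (\<sigma> \<circ> snd P) u (II (V0 \<circ> snd P) (\<sigma> \<circ> snd P) u) = 0"
proof -
  interpret N: null_immersion "fst P" "\<sigma> \<circ> snd P" by (rule positive_immersion[OF \<sigma> P])
  interpret F: central_frame "fst P" "\<sigma> \<circ> snd P" "N.frame_z N.hv" "V0 \<circ> snd P" by (rule central_frame_V0[OF \<sigma> P])
  show ?thesis
    unfolding F.trace_II_iff[OF u] by (simp add: V0_eq[OF \<sigma> P u] CVs_def N.CV_def span_base)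
qed

text \<open>By \<open>trace_II_iff\<close> a tracefree congruence contains \<open>hv\<close>, hence
  all of \<open>V0\<close>, and both have dimension four. The work lies in producing an adapted
  frame of \<open>V\<close>, without which the criterion cannot be applied.\<close>

lemma central_unique:
  assumes V: "enveloped_congruence A \<Lambda> V"
    and tr: "\<And>\<sigma> P u. positive_section A \<Lambda> \<sigma> \<Longrightarrow> P \<in> A \<Longrightarrow> u \<in> fst P \<Longrightarrow> gtrace (\<sigma> \<circ> snd P) u (II (V \<circ> snd P) (\<sigma> \<circ> snd P) u) = 0"
  shows "V p = V0 p"
proof -
  have sig: "has_signature 3 1 (V p)" for p using V unfolding enveloped_congruence_def by blast
  have sig0: "has_signature 3 1 (V0 p)" for p using enveloped_V0 unfolding enveloped_congruence_def by blast
  note dV = has_signature_nondegenerate[OF sig] and d0 = has_signature_nondegenerate(1)[OF sig0]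
  have subV: "subspace (V p)" for p using sig unfolding has_signature_def by (metis subspace_span)
  have sub0: "subspace (V0 p)" for p using sig0 unfolding has_signature_def by (metis subspace_span)
  obtain P u where P: "P \<in> A" "u \<in> fst P" "snd P u = p" by (rule chart_ex)
  let ?s = "\<sigma>0 \<circ> snd P"
  interpret N: null_immersion "fst P" ?s by (rule positive_immersion[OF positive_\<sigma>0 P(1)])
  have env: "?s w \<in> V (snd P w)" "dird X ?s w \<in> V (snd P w)" if w: "w \<in> fst P" for w X
  proof -
    have "span (insert (\<sigma>0 (snd P w)) (range (\<lambda>X. dird X ?s w))) \<subseteq> V (snd P w)"
      using V positive_\<sigma>0 P(1) w unfolding enveloped_congruence_def by blast
    then show "?s w \<in> V (snd P w)" "dird X ?s w \<in> V (snd P w)" by (auto intro: span_base)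
  qed
  have "smooth_subbundle A 4 V" using V unfolding enveloped_congruence_def by blast
  then have "\<exists>U b. open U \<and> p \<in> U \<and> (\<forall>i<4::nat. smooth_map_on A U (b i)) \<and>
     (\<forall>p'\<in>U. inj_on (\<lambda>i. b i p') {..<4} \<and> independent ((\<lambda>i. b i p') ` {..<4}) \<and> V p' = span ((\<lambda>i. b i p') ` {..<4}))"
    unfolding smooth_subbundle_def by (rule spec)
  then obtain U b where Ub: "open U \<and> p \<in> U \<and> (\<forall>i<4::nat. smooth_map_on A U (b i)) \<and>
     (\<forall>p'\<in>U. inj_on (\<lambda>i. b i p') {..<4} \<and> independent ((\<lambda>i. b i p') ` {..<4}) \<and> V p' = span ((\<lambda>i. b i p') ` {..<4}))"
    by (elim exE)
  then have U: "open U" "p \<in> U" "\<And>i. i < 4 \<Longrightarrow> smooth_map_on A U (b i)"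
    "\<And>p'. p' \<in> U \<Longrightarrow> V p' = span ((\<lambda>i. b i p') ` {..<4})" by simp_all
  \<comment> \<open>Otherwise \<open>s\<close> would be a nonzero vector of \<open>V\<close>
    orthogonal to \<open>V\<close>, against nondegeneracy.\<close>
  have "\<exists>i<4. lor (b i p) (?s u) \<noteq> 0"
  proof (rule ccontr)
    assume "\<not> ?thesis"
    then have z: "lor (b i p) (?s u) = 0" if "i < 4" for i using that by blast
    have "subspace {y. lor (?s u) y = 0}" by (auto simp: subspace_def lor_simps)
    moreover have "(\<lambda>i. b i p) ` {..<4} \<subseteq> {y. lor (?s u) y = 0}" using z by (auto simp: lor_sym)
    ultimately have "V p \<subseteq> {y. lor (?s u) y = 0}" unfolding U(4)[OF U(2)] by (rule span_minimal[rotated])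
    then have "?s u = 0" using dV(2)[OF env(1)[OF P(2)]] unfolding P(3) by blast
    then show False using positive_immersion(3)[OF positive_\<sigma>0 P(1), of p] P(3) by simp
  qed
  then obtain i where i: "i < 4" "lor (b i p) (?s u) \<noteq> 0" by blast
  let ?b = "b i \<circ> snd P"
  define T0 where "T0 = {w \<in> fst P. snd P w \<in> U}"
  have T0: "open T0" unfolding T0_def by (rule open_preimage[OF P(1) U(1)])
  have T0s: "T0 \<subseteq> fst P" by (auto simp: T0_def)
  have sb: "smooth_on ?b T0" using U(3)[OF i(1)] P(1) unfolding smooth_map_on_def T0_def by blast
  have ss: "smooth_on ?s T0" by (rule smooth_on_subset[OF N.smooth_s T0s])
  \<comment> \<open>The neighbourhood shrinks so that the chosen frame section stays transverse to
    the complement of \<open>s\<close>.\<close>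
  define T where "T = T0 \<inter> (\<lambda>w. lor (?b w) (?s w)) -` (- {0})"
  have T: "open T"
    unfolding T_def by (rule continuous_open_preimage[OF smooth_on_continuous[OF smooth_on_lor[OF T0 sb ss]] T0]) auto
  have Ts: "T \<subseteq> T0" by (auto simp: T_def)
  have uT: "u \<in> T" using i(2) P U(2) by (auto simp: T_def T0_def)
  have IT: "null_immersion T ?s"
  proof
    show "open T" "smooth_on ?s T" by (rule T, rule smooth_on_subset[OF ss Ts])
    fix w assume "w \<in> T"
    then have w: "w \<in> fst P" using Ts T0s by blast
    show "lor (?s w) (?s w) = 0" by (rule N.null_s[OF w])
    show "metric ?s w X X > 0" if "X \<noteq> 0" for X by (rule N.pos[OF w that])
  qed
  interpret M: null_immersion T ?s by (rule IT)
  \<comment> \<open>A frame for the explicit span comes before one for \<open>V\<close>: its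
    signature shows that the span has dimension four, which is how it is identified with
    \<open>V\<close>.\<close>
  have "adapted_frame T ?s (N.frame_z ?b) (\<lambda>w. span {?s w, N.S 1 w, N.S 2 w, ?b w})"
    by (rule M.adapted_frame_z) (use smooth_on_subset[OF sb Ts] in \<open>auto simp: T_def\<close>)
  then interpret G: adapted_frame T ?s "N.frame_z ?b" "\<lambda>w. span {?s w, N.S 1 w, N.S 2 w, ?b w}" .
  have Veq: "V (snd P w) = span {?s w, N.S 1 w, N.S 2 w, ?b w}" if w: "w \<in> T" for w
  proof -
    have w': "w \<in> fst P" "snd P w \<in> U" using w Ts by (auto simp: T0_def)
    have "?b w \<in> V (snd P w)" unfolding U(4)[OF w'(2)] using i(1) by (auto intro: span_base)
    then have "span {?s w, N.S 1 w, N.S 2 w, ?b w} \<subseteq> V (snd P w)"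
      using env[OF w'(1)] by (intro span_minimal subV) auto
    moreover have "dim (V (snd P w)) \<le> dim (span {?s w, N.S 1 w, N.S 2 w, ?b w})"
      unfolding dV(1) has_signature_nondegenerate(1)[OF G.has_signature_V[OF w]] by simp
    ultimately show ?thesis using subspace_dim_equal[OF subspace_span subV] by blast
  qed
  interpret H: adapted_frame T ?s "N.frame_z ?b" "V \<circ> snd P"
    by (rule M.adapted_frame_z) (use smooth_on_subset[OF sb Ts] Veq in \<open>auto simp: T_def\<close>)
  have "N.hv u \<in> V p"
    using H.trace_II_iff[OF uT] tr[OF positive_\<sigma>0 P(1,2)] P(3) by simp
  then have "V0 p \<subseteq> V p"
    using env[OF P(2)] V0_eq[OF positive_\<sigma>0 P(1,2)] unfolding P(3) CVs_def N.CV_def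
    by (simp only:) (intro span_minimal subV; auto)
  moreover have "dim (V p) \<le> dim (V0 p)" unfolding dV(1) d0 ..
  ultimately show ?thesis using subspace_dim_equal[OF sub0 subV] by blast
qed

lemma central_congruence_eq: "central_congruence A \<Lambda> = V0"
  unfolding central_congruence_def
proof (rule the_equality)
  show "enveloped_congruence A \<Lambda> V0 \<and> (\<forall>\<sigma>. positive_section A \<Lambda> \<sigma> \<longrightarrow> (\<forall>P\<in>A. \<forall>u\<in>fst P.
        gtrace (\<sigma> \<circ> snd P) u (II (V0 \<circ> snd P) (\<sigma> \<circ> snd P) u) = 0))"
    using enveloped_V0 trace_V0 by blast
  fix V assume "enveloped_congruence A \<Lambda> V \<and> (\<forall>\<sigma>. positive_section A \<Lambda> \<sigma> \<longrightarrow> (\<forall>P\<in>A. \<forall>u\<in>fst P.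
        gtrace (\<sigma> \<circ> snd P) u (II (V \<circ> snd P) (\<sigma> \<circ> snd P) u) = 0))"
  then show "V = V0" using central_unique by blast
qed

section \<open>The constrained Willmore condition\<close>

lemma so_form_of_endo:
  fixes s z :: "real^2 \<Rightarrow> 'm lorentz"
  assumes \<xi>: "endo_one_form A F \<xi>" and F: "\<And>p. F p \<subseteq> stab_perp (\<Lambda> p)" and P: "P \<in> A"
    and af: "adapted_frame (fst P) s z V"
  shows "adapted_frame.so_form (fst P) (\<xi> P)"
proof -
  interpret adapted_frame "fst P" s z V by (rule af)
  show ?thesis
    unfolding so_form_def
  proof (intro ballI conjI allI)
    fix w X v assume w: "w \<in> fst P"
    have "\<xi> P w X \<in> F (snd P w)" using \<xi> P w unfolding endo_one_form_def by blast
    then show "\<xi> P w X \<in> so_lor" using F unfolding stab_perp_def by blast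
    show "linear (\<lambda>X. \<xi> P w X v)" using \<xi> P w unfolding endo_one_form_def by blast
    have "smooth_on (\<lambda>u. \<xi> P u X v) (fst P)" using \<xi> P unfolding endo_one_form_def by blast
    then show "(\<lambda>w. \<xi> P w X v) differentiable (at w)" by (rule diffI[OF _ w])
  qed
qed

lemma endo_values:
  assumes "endo_one_form A F \<xi>" "P \<in> A" "u \<in> fst P"
  shows "\<xi> P u X \<in> F (snd P u)"
  using assms unfolding endo_one_form_def by blast

section \<open>The form attached to a quadratic differential\<close>

definition \<xi>q :: "('a chart \<Rightarrow> real^2 \<Rightarrow> real^2 \<Rightarrow> real^2 \<Rightarrow> real) \<Rightarrow> 'a chart \<Rightarrow> real^2 \<Rightarrow> real^2 \<Rightarrow> 'm lorentz \<Rightarrow> 'm lorentz" where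
  "\<xi>q q P = null_immersion.qform (\<sigma>0 \<circ> snd P) (q P)"

context
  fixes q :: "'a chart \<Rightarrow> real^2 \<Rightarrow> real^2 \<Rightarrow> real^2 \<Rightarrow> real"
  assumes q: "quadratic_differential A \<Lambda> q"
begin

lemma q_field: "quadratic_form_field A q"
  using q unfolding quadratic_differential_def by blast

lemma q_props:
  assumes P: "P \<in> A" and u: "u \<in> fst P"
  shows "linear (q P u X)" "linear (\<lambda>X. q P u X Y)" "q P u X Y = q P u Y X" "smooth_on (\<lambda>u. q P u X Y) (fst P)"
proof -
  have b: "bilinear (q P u)" and s: "\<forall>X Y. q P u X Y = q P u Y X" and m: "\<forall>X Y. smooth_on (\<lambda>u. q P u X Y) (fst P)"
    using q_field P u unfolding quadratic_form_field_def by simp_all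
  show "linear (q P u X)" "linear (\<lambda>X. q P u X Y)" using b unfolding bilinear_def by blast+
  show "q P u X Y = q P u Y X" using s by blast
  show "smooth_on (\<lambda>u. q P u X Y) (fst P)" using m by blast
qed

lemma q_trace:
  "positive_section A \<Lambda> \<sigma> \<Longrightarrow> P \<in> A \<Longrightarrow> u \<in> fst P \<Longrightarrow> gtrace (\<sigma> \<circ> snd P) u (q P u) = 0"
  using q unfolding quadratic_differential_def by blast

lemma q_pullback:
  assumes "P \<in> A" "P' \<in> A" "u \<in> overlap P P'"
  shows "q P u X Y = q P' (transition P P' u) (dird X (transition P P') u) (dird Y (transition P P') u)"
  using q_field assms unfolding quadratic_form_field_def by blast

text \<open>The form is built with \<open>\<sigma>0\<close> but has no conformal weight. Rescaling
  the section by l replaces its derivative by l times the old one plus a multiple of the section,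
  which is killed, so both sides scale by l.\<close>

lemma \<xi>q_frame:
  assumes \<sigma>: "positive_section A \<Lambda> \<sigma>" and P: "P \<in> A" and u: "u \<in> fst P"
  shows "\<xi>q q P u X (dird Y (\<sigma> \<circ> snd P) u) = - (q P u X Y *\<^sub>R (\<sigma> \<circ> snd P) u)"
proof -
  let ?s = "\<sigma>0 \<circ> snd P"
  interpret N: null_immersion "fst P" ?s by (rule positive_immersion[OF positive_\<sigma>0 P])
  interpret N': null_immersion "fst P" "\<sigma> \<circ> snd P" by (rule positive_immersion[OF \<sigma> P])
  let ?l = "\<lambda>w. snd ((\<sigma> \<circ> snd P) w)"
  have e: "(\<sigma> \<circ> snd P) w = ?l w *\<^sub>R ?s w" for w
  proof -
    have "\<sigma> (snd P w) \<in> \<Lambda> (snd P w)" using \<sigma> unfolding positive_section_def by blast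
    moreover have n: "snd (\<sigma> (snd P w)) \<noteq> 0" using positive_immersion(3)[OF \<sigma> P, of "snd P w"] by simp
    moreover have "\<sigma> (snd P w) \<noteq> 0" using n by auto
    ultimately show ?thesis using \<sigma>0_eq[of "\<sigma> (snd P w)" "snd P w"] by auto
  qed
  have dl: "?l differentiable (at u)"
    by (rule N.diffI[OF smooth_on_linear[OF bounded_linear_snd N.W N'.smooth_s] u])
  have "dird Y (\<sigma> \<circ> snd P) u = dird Y (\<lambda>w. ?l w *\<^sub>R ?s w) u"
    by (rule dird_cong[OF N.W u e])
  also have "\<dots> = dird Y ?l u *\<^sub>R ?s u + ?l u *\<^sub>R dird Y ?s u"
    by (rule dird_scaleR[OF dl N.diffI[OF N.smooth_s u]])
  finally have d: "dird Y (\<sigma> \<circ> snd P) u = dird Y ?l u *\<^sub>R ?s u + ?l u *\<^sub>R dird Y ?s u" .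
  note f = N.qform_frame[where q = "q P" and X = X, OF u q_props(1)[OF P u]]
  interpret F: adapted_frame "fst P" ?s "N.frame_z N.hv" N.CV by (rule N.adapted_CV)
  have l: "linear (N.qform (q P) u X)"
    using F.qform_mem[where q = "q P", OF u q_props(1)[OF P u]] so_lorD(1) unfolding so_sub_def by blast
  have "\<xi>q q P u X (dird Y (\<sigma> \<circ> snd P) u) = - (q P u X Y *\<^sub>R (?l u *\<^sub>R ?s u))"
    unfolding d \<xi>q_def linear_add[OF l] linear_scale[OF l] f by (simp add: mult.commute)
  then show ?thesis by (simp only: e[of u, symmetric])
qed

lemma \<xi>q_mem:
  assumes P: "P \<in> A" and u: "u \<in> fst P"
  shows "\<xi>q q P u X \<in> stab_perp (\<Lambda> (snd P u)) \<inter> so_sub (V0 (snd P u))"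
proof -
  interpret N: null_immersion "fst P" "\<sigma>0 \<circ> snd P" by (rule positive_immersion[OF positive_\<sigma>0 P])
  interpret F: adapted_frame "fst P" "\<sigma>0 \<circ> snd P" "N.frame_z N.hv" N.CV by (rule N.adapted_CV)
  show ?thesis
    using F.qform_mem[where q = "q P", OF u q_props(1)[OF P u]]
    unfolding \<xi>q_def V0_eq[OF positive_\<sigma>0 P u] CVs_def positive_immersion(2)[OF positive_\<sigma>0 P, of "snd P u"] comp_def .
qed

lemma \<xi>q_form: "endo_one_form A (\<lambda>p. stab_perp (\<Lambda> p) \<inter> so_sub (V0 p)) (\<xi>q q)"
  unfolding endo_one_form_def
proof (intro conjI ballI allI)
  fix P assume P: "P \<in> A"
  interpret N: null_immersion "fst P" "\<sigma>0 \<circ> snd P" by (rule positive_immersion[OF positive_\<sigma>0 P])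
  show "linear (\<lambda>X. \<xi>q q P u X v)" if u: "u \<in> fst P" for u v
    unfolding \<xi>q_def by (rule N.qform_linear[where q = "q P"]) (rule q_props(2)[OF P u])
  show "\<xi>q q P u X \<in> stab_perp (\<Lambda> (snd P u)) \<inter> so_sub (V0 (snd P u))" if u: "u \<in> fst P" for u X
    by (rule \<xi>q_mem[OF P u])
  show "smooth_on (\<lambda>u. \<xi>q q P u X v) (fst P)" for X v
  proof -
    have "smooth_on (\<lambda>u. q P u X Y) (fst P)" for Y
      using q_field P unfolding quadratic_form_field_def by blast
    then show ?thesis unfolding \<xi>q_def by (rule N.qform_smooth[where q = "q P"])
  qed
next
  fix P P' u X assume P: "P \<in> A" and P': "P' \<in> A" and u: "u \<in> overlap P P'"
  note tr = transition_props[OF P P']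
  let ?s = "\<sigma>0 \<circ> snd P" and ?s' = "\<sigma>0 \<circ> snd P'" and ?t = "transition P P'"
  interpret N: null_immersion "fst P" ?s by (rule positive_immersion[OF positive_\<sigma>0 P])
  interpret N': null_immersion "fst P'" ?s' by (rule positive_immersion[OF positive_\<sigma>0 P'])
  interpret F: central_frame "fst P" ?s "N.frame_z N.hv" "V0 \<circ> snd P" by (rule central_frame_V0[OF positive_\<sigma>0 P])
  have uP: "u \<in> fst P" using u by (simp add: overlap_def)
  have tu: "?t u \<in> fst P'" using tr(3) u by blast
  have L: "\<Lambda> (snd P u) = span {?s u}" using positive_immersion(2)[OF positive_\<sigma>0 P] by simp
  show "\<xi>q q P u X = \<xi>q q P' (?t u) (dird X ?t u)"
  \<comment> \<open>Both pieces lie in the same algebra over the common point, so comparing them on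
    the coordinate derivatives of the section suffices; there the chain rule meets the pull-back law
    of \<open>q\<close>.\<close>
  proof (rule F.stab_sub_unique[OF uP])
    show "\<xi>q q P u X \<in> stab_perp (span {?s u}) \<inter> so_sub ((V0 \<circ> snd P) u)"
      using \<xi>q_mem[OF P uP] unfolding L by simp
    show "\<xi>q q P' (?t u) (dird X ?t u) \<in> stab_perp (span {?s u}) \<inter> so_sub ((V0 \<circ> snd P) u)"
      using \<xi>q_mem[OF P' tu] unfolding tr(4)[OF u] L by simp
    fix i
    have "N.S i u = dird (ee i) (\<lambda>w. ?s' (?t w)) u"
      by (rule dird_cong[OF tr(1) u]) (simp add: tr(4))
    also have "\<dots> = dird (dird (ee i) ?t u) ?s' (?t u)"
      by (rule dird_compose[OF smooth_on_differentiable[OF tr(2,1) u] N'.diffI[OF N'.smooth_s tu]])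
    finally have "N.S i u = dird (dird (ee i) ?t u) ?s' (?t u)" .
    then have "\<xi>q q P' (?t u) (dird X ?t u) (N.S i u) = - (q P' (?t u) (dird X ?t u) (dird (ee i) ?t u) *\<^sub>R ?s' (?t u))"
      using \<xi>q_frame[OF positive_\<sigma>0 P' tu] by simp
    also have "\<dots> = - (q P u X (ee i) *\<^sub>R ?s u)" using q_pullback[OF P P' u] by (simp add: tr(4)[OF u])
    finally show "\<xi>q q P u X (N.S i u) = \<xi>q q P' (?t u) (dird X ?t u) (N.S i u)"
      using \<xi>q_frame[OF positive_\<sigma>0 P uP] by simp
  qed
qed

text \<open>The symmetric tracefree projection fixes \<open>q\<close>, which already has both
  properties.\<close>

lemma \<xi>q_class: "has_class A \<Lambda> (\<xi>q q) q"
  unfolding has_class_def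
proof (intro allI impI ballI ext)
  fix \<sigma> P u X Y assume \<sigma>: "positive_section A \<Lambda> \<sigma>" and P: "P \<in> A" and u: "u \<in> fst P"
  have nz: "(\<sigma> \<circ> snd P) u \<noteq> 0" using positive_immersion(3)[OF \<sigma> P, of "snd P u"] by auto
  have e: "(\<lambda>X Y. THE r. \<xi>q q P u X (dird Y (\<sigma> \<circ> snd P) u) = - (r *\<^sub>R (\<sigma> \<circ> snd P) u)) = q P u"
    using nz by (simp add: \<xi>q_frame[OF \<sigma> P u] fun_eq_iff)
  show "homology_class (\<sigma> \<circ> snd P) (\<xi>q q P) u X Y = q P u X Y"
    unfolding homology_class_def e sym0_def by (simp add: q_trace[OF \<sigma> P u] q_props(3)[OF P u, of Y X])
qed

end

end

lemma central_constrained_willmore_iff: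
  assumes "central_congruence A \<Lambda> = V"
  shows "constrained_willmore A \<Lambda> q \<longleftrightarrow> (\<forall>\<sigma>. positive_section A \<Lambda> \<sigma> \<longrightarrow> (\<forall>P\<in>A. \<forall>u\<in>fst P.
    (\<forall>i j k. cov2 (\<sigma> \<circ> snd P) dird (q P) u i j k - cov2 (\<sigma> \<circ> snd P) dird (q P) u j i k = 0) \<and>
    Hstar (V \<circ> snd P) (\<sigma> \<circ> snd P) (II (V \<circ> snd P) (\<sigma> \<circ> snd P)) u
      = contract (\<sigma> \<circ> snd P) u (q P u) (II (V \<circ> snd P) (\<sigma> \<circ> snd P) u)))"
  unfolding constrained_willmore_def assms Let_def ..

theorem theorem14p5:
  fixes A :: "('a::{t2_space, second_countable_topology}) chart set"
    and \<Lambda> :: "'a \<Rightarrow> ('m::finite) lorentz set"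
    and q :: "'a chart \<Rightarrow> real^2 \<Rightarrow> real^2 \<Rightarrow> real^2 \<Rightarrow> real"
    and n :: nat
  assumes "CARD('m) = n + 1" and "n > 2"
    and "smooth_surface A"
    and "immersed_surface A \<Lambda>"
    and "quadratic_differential A \<Lambda> q"
  shows "(constrained_willmore A \<Lambda> q \<longleftrightarrow>
            (\<exists>\<xi>. endo_one_form A (\<lambda>p. stab_perp (\<Lambda> p)) \<xi> \<and> has_class A \<Lambda> \<xi> q \<and>
               d_closed_and_star_closed A \<Lambda> \<xi>)) \<and>
         (constrained_willmore A \<Lambda> q \<longleftrightarrow>
            (\<exists>\<xi>. endo_one_form A (\<lambda>p. stab_perp (\<Lambda> p) \<inter> so_sub (central_congruence A \<Lambda> p)) \<xi> \<and>
               has_class A \<Lambda> \<xi> q \<and> flat_family A \<Lambda> \<xi>))"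
    (is "(?i \<longleftrightarrow> ?ii) \<and> (?i \<longleftrightarrow> ?iii)")
proof -
  interpret immersed A \<Lambda> by standard (fact assms(3,4))+
  note qd = assms(5)
  note cc = central_congruence_eq
  note sp = positive_immersion(2)
  have 1: ?iii if ?i
  proof (intro exI conjI)
    show "endo_one_form A (\<lambda>p. stab_perp (\<Lambda> p) \<inter> so_sub (central_congruence A \<Lambda> p)) (\<xi>q q)"
      unfolding cc by (rule \<xi>q_form[OF qd])
    show "has_class A \<Lambda> (\<xi>q q) q" by (rule \<xi>q_class[OF qd])
    show "flat_family A \<Lambda> (\<xi>q q)"
      unfolding flat_family_def cc
    proof (intro allI impI ballI)
      fix \<sigma> P t assume \<sigma>: "positive_section A \<Lambda> \<sigma>" and P: "P \<in> A"
      interpret N: null_immersion "fst P" "\<sigma> \<circ> snd P" by (rule positive_immersion[OF \<sigma> P])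
      interpret F: central_frame "fst P" "\<sigma> \<circ> snd P" "N.frame_z N.hv" "V0 \<circ> snd P" by (rule central_frame_V0[OF \<sigma> P])
      show "flat_on (fst P) (family_conn (V0 \<circ> snd P) (\<sigma> \<circ> snd P) (\<xi>q q P) t)"
      proof (rule F.willmore_imp_flat[where q = "q P"])
        show "F.so_form (\<xi>q q P)"
          by (rule so_form_of_endo[OF \<xi>q_form[OF qd] Int_lower1 P F.adapted_frame_axioms])
        fix w assume w: "w \<in> fst P"
        show "\<xi>q q P w X \<in> stab_perp (span {(\<sigma> \<circ> snd P) w}) \<inter> so_sub ((V0 \<circ> snd P) w)" for X
          using \<xi>q_mem[OF qd P w] sp[OF \<sigma> P, of "snd P w"] by simp
        show "\<xi>q q P w (ee i) (N.S j w) = - (q P w (ee i) (ee j) *\<^sub>R (\<sigma> \<circ> snd P) w)" for i j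
          by (rule \<xi>q_frame[OF qd \<sigma> P w])
        show "q P w (ee 2) (ee 1) = q P w (ee 1) (ee 2)" by (rule q_props(3)[OF qd P w])
        show "gtrace (\<sigma> \<circ> snd P) w (q P w) = 0" by (rule q_trace[OF qd \<sigma> P w])
        show "(\<forall>i j k. cov2 (\<sigma> \<circ> snd P) dird (q P) w i j k - cov2 (\<sigma> \<circ> snd P) dird (q P) w j i k = 0) \<and>
            Hstar (V0 \<circ> snd P) (\<sigma> \<circ> snd P) (II (V0 \<circ> snd P) (\<sigma> \<circ> snd P)) w
            = contract (\<sigma> \<circ> snd P) w (q P w) (II (V0 \<circ> snd P) (\<sigma> \<circ> snd P) w)"
          using \<open>?i\<close>[unfolded central_constrained_willmore_iff[OF cc]] \<sigma> P w by blast
      qed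
    qed
  qed
  \<comment> \<open>Flatness contains both equations of (ii), and the restriction to so(V) is simply
    dropped.\<close>
  have 2: ?ii if h: ?iii
  proof -
    obtain \<xi> where \<xi>: "endo_one_form A (\<lambda>p. stab_perp (\<Lambda> p) \<inter> so_sub (V0 p)) \<xi>" "has_class A \<Lambda> \<xi> q" "flat_family A \<Lambda> \<xi>"
      using h unfolding cc by blast
    have "endo_one_form A (\<lambda>p. stab_perp (\<Lambda> p)) \<xi>"
      using \<xi>(1) unfolding endo_one_form_def by blast
    moreover have "d_closed_and_star_closed A \<Lambda> \<xi>"
      unfolding d_closed_and_star_closed_def cc Let_def
    proof (intro allI impI ballI)
      fix \<sigma> P u assume \<sigma>: "positive_section A \<Lambda> \<sigma>" and P: "P \<in> A" and u: "u \<in> fst P"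
      interpret N: null_immersion "fst P" "\<sigma> \<circ> snd P" by (rule positive_immersion[OF \<sigma> P])
      interpret F: central_frame "fst P" "\<sigma> \<circ> snd P" "N.frame_z N.hv" "V0 \<circ> snd P" by (rule central_frame_V0[OF \<sigma> P])
      have so: "F.so_form (\<xi> P)" by (rule so_form_of_endo[OF \<xi>(1) Int_lower1 P F.adapted_frame_axioms])
      have st: "\<xi> P w X \<in> stab_perp (span {(\<sigma> \<circ> snd P) w})" if "w \<in> fst P" for w X
        using endo_values[OF \<xi>(1) P that, of X] sp[OF \<sigma> P, of "snd P w"] by simp
      have fl: "flat_on (fst P) (family_conn (V0 \<circ> snd P) (\<sigma> \<circ> snd P) (\<xi> P) t)" for t
        using \<xi>(3) \<sigma> P unfolding flat_family_def cc by blast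
      show "(\<forall>X Y v. ext_cov (Dh (V0 \<circ> snd P) (\<sigma> \<circ> snd P)) (\<xi> P) u X Y v = 0) \<and>
        (\<forall>X Y v. ext_cov (\<lambda>Z f w. Dh (V0 \<circ> snd P) (\<sigma> \<circ> snd P) Z f w - \<xi> P w Z (f w))
          (hodge_endo (\<sigma> \<circ> snd P) (NV (V0 \<circ> snd P))) u X Y v = 0)"
        using F.closed_conditions_iff[OF so st u] F.flat_imp_closed[OF so st fl u] by blast
    qed
    ultimately show ?ii using \<xi>(2) by blast
  qed
  \<comment> \<open>Here \<xi> is not assumed to kill the normal bundle; this is recovered chart by
    chart in \<open>closed_imp_willmore\<close>.\<close>
  have 3: ?i if h: ?ii
  proof -
    obtain \<xi> where \<xi>: "endo_one_form A (\<lambda>p. stab_perp (\<Lambda> p)) \<xi>" "has_class A \<Lambda> \<xi> q" "d_closed_and_star_closed A \<Lambda> \<xi>"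
      using h by blast
    show ?i
      unfolding central_constrained_willmore_iff[OF cc]
    proof (intro allI impI ballI)
      fix \<sigma> P u assume \<sigma>: "positive_section A \<Lambda> \<sigma>" and P: "P \<in> A" and u: "u \<in> fst P"
      interpret N: null_immersion "fst P" "\<sigma> \<circ> snd P" by (rule positive_immersion[OF \<sigma> P])
      interpret F: central_frame "fst P" "\<sigma> \<circ> snd P" "N.frame_z N.hv" "V0 \<circ> snd P" by (rule central_frame_V0[OF \<sigma> P])
      have so: "F.so_form (\<xi> P)" by (rule so_form_of_endo[OF \<xi>(1) order_refl P F.adapted_frame_axioms])
      have st: "\<xi> P w X \<in> stab_perp (span {(\<sigma> \<circ> snd P) w})" if "w \<in> fst P" for w X
        using endo_values[OF \<xi>(1) P that, of X] sp[OF \<sigma> P, of "snd P w"] by simp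
      have hc: "homology_class (\<sigma> \<circ> snd P) (\<xi> P) w = q P w" if "w \<in> fst P" for w
        using \<xi>(2) \<sigma> P that unfolding has_class_def by blast
      have cl: "(\<forall>X Y v. ext_cov (Dh (V0 \<circ> snd P) (\<sigma> \<circ> snd P)) (\<xi> P) w X Y v = 0) \<and>
        (\<forall>X Y v. ext_cov (\<lambda>Z f w. Dh (V0 \<circ> snd P) (\<sigma> \<circ> snd P) Z f w - \<xi> P w Z (f w))
          (hodge_endo (\<sigma> \<circ> snd P) (NV (V0 \<circ> snd P))) w X Y v = 0)" if w: "w \<in> fst P" for w
        using \<xi>(3) \<sigma> P w unfolding d_closed_and_star_closed_def cc Let_def by blast
      have dz: "F.dsp (\<xi> P) w v = 0 \<and> F.dsp F.M w v - br (\<xi> P w) (F.M w) v = 0" if w: "w \<in> fst P" for w v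
        using F.closed_conditions_iff[OF so st w] cl[OF w] by blast
      show "(\<forall>i j k. cov2 (\<sigma> \<circ> snd P) dird (q P) u i j k - cov2 (\<sigma> \<circ> snd P) dird (q P) u j i k = 0) \<and>
          Hstar (V0 \<circ> snd P) (\<sigma> \<circ> snd P) (II (V0 \<circ> snd P) (\<sigma> \<circ> snd P)) u
          = contract (\<sigma> \<circ> snd P) u (q P u) (II (V0 \<circ> snd P) (\<sigma> \<circ> snd P) u)"
        by (rule F.closed_imp_willmore[where q = "q P", OF so st hc dz u])
    qed
  qed
  show ?thesis using 1 2 3 by blast
qed

end
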